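(* Let $\mathcal S^{\Lambda\mathrm{nt}}_{i\mathbb R}$ and $\mathcal S^{\Lambda\mathrm{nt}}_{i\mathbb H}$ be the spaces of $\Lambda$-non-trivial self-adjoint unitaries anti-commuting with $C$, respectively with $J$ (see context). Then $\mathcal S^{\Lambda\mathrm{nt}}_{i\mathbb R}$ has exactly two path components: the map $\mathrm{ind}_{\Lambda,2}:\mathcal S^{\Lambda\mathrm{nt}}_{i\mathbb R}\to\mathbb Z_2$ is norm continuous and descends to a bijection $$\mathrm{ind}_{\Lambda,2}:\pi_0(\mathcal S^{\Lambda\mathrm{nt}}_{i\mathbb R})\xrightarrow{\ \sim\ }\mathbb Z_2 .$$ The space $\mathcal S^{\Lambda\mathrm{nt}}_{i\mathbb H}$ has exactly one path component: $\pi_0(\mathcal S^{\Lambda\mathrm{nt}}_{i\mathbb H})\cong\{0\}$.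
   Context: $\mathcal H$ is an infinite-dimensional separable complex Hilbert space, $\mathcal B$ its bounded linear operators with the operator norm topology, $\mathcal K$ the compact operators. $\Lambda\in\mathcal B$ is a fixed self-adjoint projection with infinite-dimensional range and kernel; $\Lambda^\perp=\mathbb 1-\Lambda$. $C,J:\mathcal H\to\mathcal H$ are fixed anti-unitary operators with $C^2=\mathbb 1$, $J^2=-\mathbb 1$, both commuting with $\Lambda$. A self-adjoint unitary (SAU) is called non-trivial iff both its $+1$ and $-1$ eigenspaces are infinite-dimensional. A SAU $U$ on $\mathcal H$ is called $\Lambda$-non-trivial iff there is a SAU $V$ on $\mathcal H$ such that (1) $[V,\Lambda]=0$; (2) the restrictions of $V$ to $\mathrm{im}\,\Lambda$ and to $\mathrm{im}\,\Lambda^\perp$ are both non-trivial SAUs (on these Hilbert spaces); (3) $U-V\in\mathcal K$. $\mathcal S^{\Lambda\mathrm{nt}}$ is the set of $\Lambda$-non-trivial SAUs, and $\mathcal S^{\Lambda\mathrm{nt}}_{i\mathbb R}=\{U\in\mathcal S^{\Lambda\mathrm{nt}}:UC=-CU\}$, $\mathcal S^{\Lambda\mathrm{nt}}_{i\mathbb H}=\{U\in\mathcal S^{\Lambda\mathrm{nt}}:UJ=-JU\}$, with the operator norm subspace topology. For such $U$ the operator $\Lambda U\Lambda+\mathbb 1-\Lambda$ is Fredholm, and $\mathrm{ind}_{\Lambda,2}(U):=\dim\ker(\Lambda U\Lambda+\mathbb 1-\Lambda)\bmod 2\in\mathbb Z_2$. $\pi_0$ denotes the set of path components. *)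

theory Defs
  imports "HOL-Analysis.Analysis" "HOL-Library.Z2"
begin

(* Complex inner product spaces.  The inner product is conjugate linear in its first argument.
   The real inner product inherited from real_inner is the real part of the complex one, so the
   norm, metric and topology are those of the complex inner product (see
   norm_eq_sqrt_Re_cinner below). *)

class complex_inner = real_inner +
  fixes scaleC :: "complex \<Rightarrow> 'a \<Rightarrow> 'a"  (infixr "*\<^sub>C" 75)
    and cinner :: "'a \<Rightarrow> 'a \<Rightarrow> complex"
  assumes scaleC_add_right: "c *\<^sub>C (x + y) = c *\<^sub>C x + c *\<^sub>C y"
    and scaleC_add_left: "(c + d) *\<^sub>C x = c *\<^sub>C x + d *\<^sub>C x"
    and scaleC_scaleC: "c *\<^sub>C d *\<^sub>C x = (c * d) *\<^sub>C x"
    and scaleC_one: "1 *\<^sub>C x = x"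
    and scaleR_eq_scaleC: "r *\<^sub>R x = complex_of_real r *\<^sub>C x"
    and cinner_commute: "cinner x y = cnj (cinner y x)"
    and cinner_add_left: "cinner (x + y) z = cinner x z + cinner y z"
    and cinner_scaleC_left: "cinner (c *\<^sub>C x) y = cnj c * cinner x y"
    and inner_eq_Re_cinner: "inner x y = Re (cinner x y)"

class chilbert_space = complex_inner + complete_space

lemma cinner_self: "cinner x x = complex_of_real ((norm x)\<^sup>2)" for x :: "'a::complex_inner"
proof (rule complex_eqI)
  show "Re (cinner x x) = Re (complex_of_real ((norm x)\<^sup>2))"
    by (simp add: inner_eq_Re_cinner[symmetric] power2_norm_eq_inner)
  show "Im (cinner x x) = Im (complex_of_real ((norm x)\<^sup>2))"
    using arg_cong[OF cinner_commute[of x x], of Im] by simp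
qed

lemma norm_eq_sqrt_Re_cinner: "norm x = sqrt (Re (cinner x x))" for x :: "'a::complex_inner"
  by (simp add: cinner_self)

instantiation complex :: chilbert_space
begin

definition scaleC_complex :: "complex \<Rightarrow> complex \<Rightarrow> complex"
  where "scaleC_complex c x = c * x"

definition cinner_complex :: "complex \<Rightarrow> complex \<Rightarrow> complex"
  where "cinner_complex x y = cnj x * y"

instance
  by standard
    (simp_all add: scaleC_complex_def cinner_complex_def algebra_simps scaleR_conv_of_real
      inner_complex_def)

end

global_interpretation complex_vector: vector_space "scaleC :: complex \<Rightarrow> 'a \<Rightarrow> 'a::complex_inner"
  defines cspan = complex_vector.span
    and cdim = complex_vector.dim
  by unfold_locales (simp_all add: scaleC_add_right scaleC_add_left scaleC_scaleC scaleC_one)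

definition cfinite_dim :: "'a::complex_inner set \<Rightarrow> bool"
  where "cfinite_dim S \<longleftrightarrow> (\<exists>B. finite B \<and> S \<subseteq> cspan B)"

(* The bounded complex linear operators, as a subset of the normed space of bounded real linear
   operators; the operator norm is the same whether one regards the scalars as real or complex. *)
definition bounded_ops :: "('a::complex_inner \<Rightarrow>\<^sub>L 'a) set"
  where "bounded_ops = {T. \<forall>c x. blinfun_apply T (c *\<^sub>C x) = c *\<^sub>C blinfun_apply T x}"

definition compact_ops :: "('a::complex_inner \<Rightarrow>\<^sub>L 'a) set"
  where "compact_ops = {K \<in> bounded_ops. compact (closure (blinfun_apply K ` cball 0 1))}"

definition selfadjoint_projection :: "('a::complex_inner \<Rightarrow>\<^sub>L 'a) \<Rightarrow> bool"
  where "selfadjoint_projection P \<longleftrightarrow>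
    P \<in> bounded_ops \<and> P o\<^sub>L P = P \<and>
    (\<forall>x y. cinner (blinfun_apply P x) y = cinner x (blinfun_apply P y))"

definition antiunitary :: "('a::complex_inner \<Rightarrow> 'a) \<Rightarrow> bool"
  where "antiunitary A \<longleftrightarrow>
    (\<forall>x y. A (x + y) = A x + A y) \<and> (\<forall>c x. A (c *\<^sub>C x) = cnj c *\<^sub>C A x) \<and>
    surj A \<and> (\<forall>x y. cinner (A x) (A y) = cinner y x)"

(* U leaves the closed subspace M invariant and its restriction to M is a self-adjoint unitary
   operator of the Hilbert space M.  A self-adjoint unitary on the whole space is the case
   M = UNIV. *)
definition sau_on :: "'a::complex_inner set \<Rightarrow> ('a \<Rightarrow>\<^sub>L 'a) \<Rightarrow> bool"
  where "sau_on M U \<longleftrightarrow>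
    U \<in> bounded_ops \<and> blinfun_apply U ` M = M \<and>
    (\<forall>x\<in>M. \<forall>y\<in>M. cinner (blinfun_apply U x) (blinfun_apply U y) = cinner x y) \<and>
    (\<forall>x\<in>M. \<forall>y\<in>M. cinner (blinfun_apply U x) y = cinner x (blinfun_apply U y))"

definition eigenspace_on :: "'a::complex_inner set \<Rightarrow> ('a \<Rightarrow>\<^sub>L 'a) \<Rightarrow> complex \<Rightarrow> 'a set"
  where "eigenspace_on M U c = {x \<in> M. blinfun_apply U x = c *\<^sub>C x}"

definition nontrivial_sau_on :: "'a::complex_inner set \<Rightarrow> ('a \<Rightarrow>\<^sub>L 'a) \<Rightarrow> bool"
  where "nontrivial_sau_on M U \<longleftrightarrow>
    sau_on M U \<and> \<not> cfinite_dim (eigenspace_on M U 1) \<and> \<not> cfinite_dim (eigenspace_on M U (-1))"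

definition nontrivial_saus :: "('a::complex_inner \<Rightarrow>\<^sub>L 'a) \<Rightarrow> ('a \<Rightarrow>\<^sub>L 'a) set"
  where "nontrivial_saus \<Lambda> = {U. sau_on UNIV U \<and>
    (\<exists>V. sau_on UNIV V \<and> V o\<^sub>L \<Lambda> = \<Lambda> o\<^sub>L V \<and>
      nontrivial_sau_on (range (blinfun_apply \<Lambda>)) V \<and>
      nontrivial_sau_on (range (blinfun_apply (id_blinfun - \<Lambda>))) V \<and>
      U - V \<in> compact_ops)}"

(* The space S_iR for an anti-unitary A with square 1, the space S_iH for one with square -1. *)
definition nontrivial_saus_anticomm ::
    "('a::complex_inner \<Rightarrow>\<^sub>L 'a) \<Rightarrow> ('a \<Rightarrow> 'a) \<Rightarrow> ('a \<Rightarrow>\<^sub>L 'a) set"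
  where "nontrivial_saus_anticomm \<Lambda> A =
    {U \<in> nontrivial_saus \<Lambda>. \<forall>x. blinfun_apply U (A x) = - A (blinfun_apply U x)}"

(* of_nat :: nat => bit is reduction modulo 2. *)
definition ind2 :: "('a::complex_inner \<Rightarrow>\<^sub>L 'a) \<Rightarrow> ('a \<Rightarrow>\<^sub>L 'a) \<Rightarrow> bit"
  where "ind2 \<Lambda> U =
    of_nat (cdim {x. blinfun_apply ((\<Lambda> o\<^sub>L U o\<^sub>L \<Lambda>) + id_blinfun - \<Lambda>) x = 0})"

end

theory Submission
  imports Defs
begin

text \<open>
  Write \<open>A\<close> for \<open>C\<close> or \<open>J\<close>. Since \<open>A\<close> exchanges the two eigenspaces of a self-adjoint unitary \<open>U\<close>
  anti-commuting with it, \<open>\<Lambda>\<close>-non-triviality of \<open>U\<close> amounts to compactness of \<open>[U, \<Lambda>]\<close>. All paths are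
  normalised segments: if \<open>\<parallel>U - V\<parallel> < 2\<close>, then \<open>(1 - t) U + t V\<close> squares to \<open>1 - t (1 - t) (U - V)\<^sup>2\<close>,
  which has an inverse square root given by the binomial series.

  Put \<open>S = 2\<Lambda> - 1\<close>. The kernel of \<open>U + S U S\<close> is \<open>E + U E\<close> with \<open>E\<close> the finite-dimensional kernel of the
  compression of \<open>U\<close> to the range of \<open>\<Lambda>\<close>. If \<open>E = 0\<close>, then \<open>\<parallel>U - S U S\<parallel> < 2\<close>, and the midpoint of the
  segment from \<open>U\<close> to \<open>S U S\<close> commutes with \<open>\<Lambda>\<close>. In the quaternionic case \<open>E\<close> can always be removed by
  moving \<open>U\<close> along segments, in the real case two dimensions at a time. Operators commuting with \<open>\<Lambda>\<close>
  are connected to each other: a spectral subspace of \<open>V V' + V' V\<close> reduces the claim to connecting \<open>V\<close>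
  with \<open>- V\<close>, which is done through a \<open>W\<close> anti-commuting with \<open>V\<close>.

  Replacing \<open>\<Lambda>\<close> by \<open>\<Lambda> - e e\<^sup>*\<close>, with \<open>e\<close> a real unit vector in its range, does not change the space but
  changes the parity of \<open>dim E\<close>. This reduces the odd component to the even one, and, by removing a
  basis of \<open>E\<close>, local constancy of the parity to the case \<open>E = 0\<close>, where the compression is bounded
  below.
\<close>

section \<open>Complex inner product spaces\<close>

text \<open>Functional calculus is reduced to two tools: square roots and inverse square roots are
  binomial series, and spectral projections are projections onto kernels.

  Compactness enters through D, half of U - S U S. Writing T for half of U + S U S, one has T^2 +
  D^2 = 1, so the kernel of T is the eigenspace of the compact operator D^2 at 1. It therefore has
  finite dimension, and the rest of the spectrum of D^2 stays away from 1. This gap is what makes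
  the segment from U to S U S short as soon as E = 0.

  The two symmetries differ in how E can be removed. The space E is invariant under A, and a part of
  it, the range of a projection P, is removed with the help of a self-adjoint unitary of that range
  which anti-commutes with A. As A exchanges its eigenspaces, P must have even rank. In the
  quaternionic case x and A x are orthogonal, so every nonzero E contains a suitable plane. In the
  real case one dimension can be left over, and this is the invariant.\<close>

instance chilbert_space \<subseteq> banach ..

lemma scaleC_zero_right [simp]: "c *\<^sub>C (0::'a::complex_inner) = 0"
  by (rule complex_vector.scale_zero_right)

lemma scaleC_zero_left [simp]: "0 *\<^sub>C (x::'a::complex_inner) = 0"
  by (rule complex_vector.scale_zero_left)

lemma scaleC_minus_right [simp]: "c *\<^sub>C (- x::'a::complex_inner) = - (c *\<^sub>C x)"
  by (rule complex_vector.scale_minus_right)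

lemma scaleC_minus_left [simp]: "(- c) *\<^sub>C (x::'a::complex_inner) = - (c *\<^sub>C x)"
  by (rule complex_vector.scale_minus_left)

lemma scaleC_diff_right: "c *\<^sub>C (x - y::'a::complex_inner) = c *\<^sub>C x - c *\<^sub>C y"
  by (rule complex_vector.scale_right_diff_distrib)

lemma scaleC_scaleR_commute: "c *\<^sub>C (r *\<^sub>R (x::'a::complex_inner)) = r *\<^sub>R (c *\<^sub>C x)"
  by (simp add: scaleR_eq_scaleC scaleC_scaleC mult.commute)

declare scaleC_one [simp]

lemma cinner_add_right: "cinner (x::'a::complex_inner) (y + z) = cinner x y + cinner x z"
  by (metis cinner_add_left cinner_commute complex_cnj_add)

lemma cinner_scaleC_right: "cinner (x::'a::complex_inner) (c *\<^sub>C y) = c * cinner x y"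
  by (metis cinner_commute cinner_scaleC_left complex_cnj_cnj complex_cnj_mult)

lemma cinner_zero_left [simp]: "cinner 0 (x::'a::complex_inner) = 0"
  by (metis cinner_scaleC_left complex_cnj_zero mult_zero_left scaleC_zero_left)

lemma cinner_zero_right [simp]: "cinner (x::'a::complex_inner) 0 = 0"
  by (metis cinner_commute cinner_zero_left complex_cnj_zero)

lemma cinner_minus_left [simp]: "cinner (- x) (y::'a::complex_inner) = - cinner x y"
  by (metis add_eq_0_iff cinner_add_left cinner_zero_left add.right_inverse)

lemma cinner_minus_right [simp]: "cinner (x::'a::complex_inner) (- y) = - cinner x y"
  by (metis add_eq_0_iff cinner_add_right cinner_zero_right add.right_inverse)

lemma cinner_diff_left: "cinner (x - y) (z::'a::complex_inner) = cinner x z - cinner y z"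
  using cinner_add_left[of x "- y" z] by simp

lemma cinner_diff_right: "cinner (x::'a::complex_inner) (y - z) = cinner x y - cinner x z"
  using cinner_add_right[of x y "- z"] by simp

lemma cinner_scaleR_left: "cinner (r *\<^sub>R x) (y::'a::complex_inner) = of_real r * cinner x y"
  by (simp add: scaleR_eq_scaleC cinner_scaleC_left)

lemma cinner_scaleR_right: "cinner (x::'a::complex_inner) (r *\<^sub>R y) = of_real r * cinner x y"
  by (simp add: scaleR_eq_scaleC cinner_scaleC_right)

lemma cinner_sum_right: "cinner (x::'a::complex_inner) (\<Sum>i\<in>I. f i) = (\<Sum>i\<in>I. cinner x (f i))"
  by (induction I rule: infinite_finite_induct) (auto simp: cinner_add_right)

lemma cinner_sum_left: "cinner (\<Sum>i\<in>I. f i) (x::'a::complex_inner) = (\<Sum>i\<in>I. cinner (f i) x)"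
  by (induction I rule: infinite_finite_induct) (auto simp: cinner_add_left)

lemma cinner_eq_0_iff [simp]: "cinner (x::'a::complex_inner) x = 0 \<longleftrightarrow> x = 0"
  by (auto simp: cinner_self)

lemma cinner_eq_0_commute: "cinner (x::'a::complex_inner) y = 0 \<longleftrightarrow> cinner y x = 0"
  by (metis cinner_commute complex_cnj_zero)

lemma Im_cinner: "Im (cinner (x::'a::complex_inner) y) = inner (\<i> *\<^sub>C x) y"
  by (simp add: inner_eq_Re_cinner cinner_scaleC_left)

lemma norm_scaleC: "norm (c *\<^sub>C (x::'a::complex_inner)) = cmod c * norm x"
proof -
  have "cinner (c *\<^sub>C x) (c *\<^sub>C x) = (c * cnj c) * cinner x x"
    by (simp only: cinner_scaleC_left cinner_scaleC_right mult_ac)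
  then have "complex_of_real ((norm (c *\<^sub>C x))\<^sup>2) = complex_of_real ((cmod c * norm x)\<^sup>2)"
    by (simp only: cinner_self complex_norm_square[symmetric] power_mult_distrib of_real_mult of_real_power)
  then have "(norm (c *\<^sub>C x))\<^sup>2 = (cmod c * norm x)\<^sup>2"
    unfolding of_real_eq_iff .
  then show ?thesis by (simp add: power2_eq_iff_nonneg)
qed

lemma norm_cinner_le: "cmod (cinner (x::'a::complex_inner) y) \<le> norm x * norm y"
proof (cases "cinner x y = 0")
  case False
  define c where "c = sgn (cinner x y)"
  have c: "cmod c = 1" using False by (simp add: c_def norm_sgn)
  have "cinner (c *\<^sub>C x) y = complex_of_real (cmod (cinner x y))"
    using False by (simp add: cinner_scaleC_left c_def sgn_div_norm scaleR_conv_of_real field_simps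
        complex_norm_square[symmetric] power2_eq_square[symmetric])
  then have "cmod (cinner x y) = inner (c *\<^sub>C x) y"
    by (simp add: inner_eq_Re_cinner)
  also have "\<dots> \<le> norm (c *\<^sub>C x) * norm y" by (rule norm_cauchy_schwarz)
  finally show ?thesis by (simp add: norm_scaleC c)
qed simp

lemma bounded_bilinear_cinner: "bounded_bilinear (cinner :: 'a::complex_inner \<Rightarrow> 'a \<Rightarrow> complex)"
  by standard (auto simp: cinner_add_left cinner_add_right cinner_scaleR_left cinner_scaleR_right
      scaleR_conv_of_real norm_cinner_le intro!: exI[of _ 1])

lemma bounded_bilinear_scaleC: "bounded_bilinear (scaleC :: complex \<Rightarrow> 'a::complex_inner \<Rightarrow> 'a)"
  by standard (auto simp: scaleC_add_left scaleC_add_right scaleC_scaleR_commute norm_scaleC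
      scaleR_eq_scaleC[where 'a='a] scaleC_scaleC scaleR_conv_of_real[where 'a=complex] intro!: exI[of _ 1])

lemmas tendsto_scaleC [tendsto_intros] = bounded_bilinear.tendsto[OF bounded_bilinear_scaleC]

section \<open>The Banach algebra of bounded complex linear operators\<close>

text \<open>As a type of its own the algebra has products, powers and a norm in the sense of the
  type classes, so that power series and Cauchy products of operators make sense.\<close>

typedef (overloaded) 'a cop = "bounded_ops :: ('a::complex_inner \<Rightarrow>\<^sub>L 'a) set"
  morphisms blinfun_of_cop cop_of_blinfun
  by (rule exI[of _ 0]) (simp add: bounded_ops_def)

setup_lifting type_definition_cop

lift_definition app :: "'a::complex_inner cop \<Rightarrow> 'a \<Rightarrow> 'a" is blinfun_apply .

declare [[coercion app]]

instantiation cop :: (complex_inner) real_normed_vector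
begin

lift_definition norm_cop :: "'a cop \<Rightarrow> real" is norm .

lift_definition minus_cop :: "'a cop \<Rightarrow> 'a cop \<Rightarrow> 'a cop" is minus
  by (simp add: bounded_ops_def blinfun.bilinear_simps scaleC_diff_right)

lift_definition uminus_cop :: "'a cop \<Rightarrow> 'a cop" is uminus
  by (simp add: bounded_ops_def blinfun.bilinear_simps)

lift_definition zero_cop :: "'a cop" is 0
  by (simp add: bounded_ops_def)

lift_definition plus_cop :: "'a cop \<Rightarrow> 'a cop \<Rightarrow> 'a cop" is plus
  by (simp add: bounded_ops_def blinfun.bilinear_simps scaleC_add_right)

lift_definition scaleR_cop :: "real \<Rightarrow> 'a cop \<Rightarrow> 'a cop" is scaleR
  by (simp add: bounded_ops_def blinfun.bilinear_simps scaleC_scaleR_commute)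

definition dist_cop :: "'a cop \<Rightarrow> 'a cop \<Rightarrow> real"
  where "dist_cop a b = norm (a - b)"

definition uniformity_cop :: "('a cop \<times> 'a cop) filter"
  where "uniformity_cop = (INF e\<in>{0 <..}. principal {(x, y). dist x y < e})"

definition open_cop :: "'a cop set \<Rightarrow> bool"
  where "open_cop S = (\<forall>x\<in>S. \<forall>\<^sub>F (x', y) in uniformity. x' = x \<longrightarrow> y \<in> S)"

definition sgn_cop :: "'a cop \<Rightarrow> 'a cop"
  where "sgn_cop x = scaleR (inverse (norm x)) x"

instance
  apply standard
  unfolding dist_cop_def open_cop_def sgn_cop_def uniformity_cop_def
  apply (rule refl | (transfer, simp add: algebra_simps norm_triangle_ineq; fail))+
  done

end

text \<open>Not \<open>ring_1\<close>, since the space may be zero.\<close>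

instantiation cop :: (complex_inner) "{monoid_mult, real_normed_algebra}"
begin

lift_definition times_cop :: "'a cop \<Rightarrow> 'a cop \<Rightarrow> 'a cop" is "(o\<^sub>L)"
  by (simp add: bounded_ops_def)

lift_definition one_cop :: "'a cop" is id_blinfun
  by (simp add: bounded_ops_def)

instance
  by standard (transfer; auto intro!: blinfun_eqI simp: blinfun.bilinear_simps norm_blinfun_compose)+

end


lemma app_simps [simp]:
  "app (S + T) x = S x + T x" "app (S - T) x = S x - T x" "app (- T) x = - T x"
  "app 0 x = 0" "app 1 x = x" "app (S * T) x = S (T x)" "app (r *\<^sub>R T) x = r *\<^sub>R T x"
  by (transfer; simp add: blinfun.bilinear_simps)+

lemma app_add [simp]: "app T (x + y) = T x + T y"
  and app_diff [simp]: "app T (x - y) = T x - T y"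
  and app_minus [simp]: "app T (- x) = - T x"
  and app_zero [simp]: "app T 0 = 0"
  and app_scaleR [simp]: "app T (r *\<^sub>R x) = r *\<^sub>R T x"
  by (transfer; simp add: blinfun.bilinear_simps)+

lemma app_scaleC [simp]: "app T (c *\<^sub>C x) = c *\<^sub>C T x"
  by transfer (simp add: bounded_ops_def)

lemma cop_eqI:
  fixes S T :: "'a::complex_inner cop"
  shows "(\<And>x. app S x = app T x) \<Longrightarrow> S = T"
  by transfer (auto intro: blinfun_eqI)

lemma norm_app_le: "norm (app T x) \<le> norm T * norm x"
  by transfer (rule norm_blinfun)

lemma norm_cop_bound: "0 \<le> b \<Longrightarrow> (\<And>x. norm (app T x) \<le> b * norm x) \<Longrightarrow> norm T \<le> b"
  by transfer (rule norm_blinfun_bound)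

lemma bounded_bilinear_app: "bounded_bilinear app"
  by standard (auto intro!: exI[of _ 1] norm_app_le)

lemmas tendsto_app [tendsto_intros] = bounded_bilinear.tendsto[OF bounded_bilinear_app]
lemmas continuous_on_app [continuous_intros] = bounded_bilinear.continuous_on[OF bounded_bilinear_app]

lemma blinfun_of_cop_simps:
  "blinfun_of_cop (S - T) = blinfun_of_cop S - blinfun_of_cop T"
  "blinfun_of_cop (S * T) = blinfun_of_cop S o\<^sub>L blinfun_of_cop T"
  "blinfun_of_cop 1 = id_blinfun"
  by (simp_all add: minus_cop.rep_eq times_cop.rep_eq one_cop.rep_eq)

lemma closed_bounded_ops: "closed (bounded_ops :: ('a::complex_inner \<Rightarrow>\<^sub>L 'a) set)"
proof -
  have eq: "bounded_ops = (\<Inter>c. \<Inter>x. {T :: 'a \<Rightarrow>\<^sub>L 'a. T (c *\<^sub>C x) - c *\<^sub>C T x = 0})"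
    by (auto simp: bounded_ops_def)
  have "closed {T :: 'a \<Rightarrow>\<^sub>L 'a. T (c *\<^sub>C x) - c *\<^sub>C T x = 0}" for c x
    by (intro closed_Collect_eq continuous_intros bounded_bilinear.continuous_on[OF bounded_bilinear_scaleC])
  then show ?thesis unfolding eq by (intro closed_INT ballI)
qed

instance cop :: (chilbert_space) banach
proof
  fix X :: "nat \<Rightarrow> 'a cop"
  assume X: "Cauchy X"
  have d: "dist (blinfun_of_cop S) (blinfun_of_cop T) = dist S T" for S T :: "'a cop"
    by (simp add: dist_norm norm_cop.rep_eq minus_cop.rep_eq)
  have "Cauchy (\<lambda>n. blinfun_of_cop (X n))"
    using X unfolding Cauchy_def d .
  then obtain L where L: "(\<lambda>n. blinfun_of_cop (X n)) \<longlonglongrightarrow> L"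
    by (auto simp: Cauchy_convergent_iff convergent_def)
  then have "L \<in> bounded_ops"
    by (rule closed_sequentially[OF closed_bounded_ops blinfun_of_cop])
  then obtain T where T: "L = blinfun_of_cop T"
    using cop_of_blinfun_inverse[of L] by metis
  have "X \<longlonglongrightarrow> T"
    using L unfolding T tendsto_iff d .
  then show "convergent X" by (auto simp: convergent_def)
qed

section \<open>Binomial series in a Banach algebra\<close>

text \<open>The series of \<open>1 - x\<close> raised to the power \<open>a\<close>.\<close>

definition binom_series :: "real \<Rightarrow> 'b::{real_normed_algebra,monoid_mult} \<Rightarrow> 'b"
  where "binom_series a x = (\<Sum>n. ((a gchoose n) * (- 1) ^ n) *\<^sub>R x ^ n)"

text \<open>The class does not force \<open>norm 1 = 1\<close> (it is 0 in the zero algebra), and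
  the exponent 0 must be covered.\<close>

lemma norm_power_le:
  fixes x :: "'b::{real_normed_algebra,monoid_mult}"
  shows "norm (x ^ n) \<le> norm (1::'b) * norm x ^ n"
proof (induction n)
  case (Suc n)
  have "norm (x ^ Suc n) \<le> norm (x ^ n) * norm x"
    by (subst power_Suc2) (rule norm_mult_ineq)
  also have "\<dots> \<le> norm (1::'b) * norm x ^ n * norm x"
    by (rule mult_right_mono[OF Suc]) simp
  finally show ?case by (simp add: mult_ac)
qed simp

text \<open>Covers both regimes in use: every exponent at a radius \<open>r < 1\<close>, and the
  exponent 1/2 at the boundary \<open>r = 1\<close>.\<close>

definition binom_abs_summable :: "real \<Rightarrow> real \<Rightarrow> bool"
  where "binom_abs_summable a r \<longleftrightarrow> summable (\<lambda>n. \<bar>a gchoose n\<bar> * r ^ n)"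

lemma binom_series_summable:
  fixes x :: "'b::{real_normed_algebra,monoid_mult}"
  assumes "binom_abs_summable a r" "norm x \<le> r"
  shows "summable (\<lambda>n. norm (((a gchoose n) * (- 1) ^ n) *\<^sub>R x ^ n))"
proof (rule summable_comparison_test)
  show "summable (\<lambda>n. norm (1::'b) * (\<bar>a gchoose n\<bar> * r ^ n))"
    using assms by (intro summable_mult) (simp add: binom_abs_summable_def)
  have "norm (x ^ n) \<le> norm (1::'b) * r ^ n" for n
    using norm_power_le[of x n] assms(2)
    by (auto elim!: order_trans intro!: mult_left_mono power_mono)
  then show "\<exists>N. \<forall>n\<ge>N. norm (norm (((a gchoose n) * (- 1) ^ n) *\<^sub>R x ^ n)) \<le> norm (1::'b) * (\<bar>a gchoose n\<bar> * r ^ n)"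
    by (simp add: abs_mult power_abs mult.left_commute[of "norm 1"] mult_left_mono)
qed

lemma binom_series_sums:
  fixes x :: "'b::{real_normed_algebra,monoid_mult,banach}"
  assumes "binom_abs_summable a r" "norm x \<le> r"
  shows "(\<lambda>n. ((a gchoose n) * (- 1) ^ n) *\<^sub>R x ^ n) sums binom_series a x"
  unfolding binom_series_def
  by (rule summable_sums[OF summable_norm_cancel[OF binom_series_summable[OF assms]]])

text \<open>Cauchy product; Vandermonde's identity adds the exponents.\<close>

lemma binom_series_mult:
  fixes x :: "'b::{real_normed_algebra,monoid_mult,banach}"
  assumes a: "binom_abs_summable a r" and b: "binom_abs_summable b r" and x: "norm x \<le> r"
  shows "binom_series a x * binom_series b x = binom_series (a + b) x"
proof -
  have "(\<Sum>i\<le>n. (((a gchoose i) * (- 1) ^ i) *\<^sub>R x ^ i) * (((b gchoose (n - i)) * (- 1) ^ (n - i)) *\<^sub>R x ^ (n - i)))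
      = ((a + b gchoose n) * (- 1) ^ n) *\<^sub>R x ^ n" for n
  proof -
    have "(\<Sum>i\<le>n. (((a gchoose i) * (- 1) ^ i) *\<^sub>R x ^ i) * (((b gchoose (n - i)) * (- 1) ^ (n - i)) *\<^sub>R x ^ (n - i)))
      = (\<Sum>i\<le>n. ((a gchoose i) * (b gchoose (n - i)) * (- 1) ^ n) *\<^sub>R x ^ n)"
      by (rule sum.cong) (auto simp: power_add[symmetric] mult_ac)
    also have "\<dots> = (\<Sum>i=0..n. (a gchoose i) * (b gchoose (n - i))) *\<^sub>R ((- 1) ^ n *\<^sub>R x ^ n)"
      by (simp add: scaleR_sum_left[symmetric] sum_distrib_right atLeast0AtMost)
    finally show ?thesis by (simp add: gbinomial_Vandermonde)
  qed
  then show ?thesis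
    using Cauchy_product[OF binom_series_summable[OF a x] binom_series_summable[OF b x]]
    by (simp add: binom_series_def)
qed

lemma binom_series_1: "binom_series 1 x = 1 - (x::'b::{real_normed_algebra,monoid_mult,banach})"
proof -
  have z: "((1::real) gchoose n) = 0" if "n \<ge> 2" for n
  proof -
    have "((1::real) gchoose n) = of_nat (1 choose n)" by (metis binomial_gbinomial of_nat_1)
    also have "\<dots> = 0" using that by simp
    finally show ?thesis .
  qed
  have "(\<lambda>n. (((1::real) gchoose n) * (- 1) ^ n) *\<^sub>R x ^ n) sums
      (\<Sum>n\<in>{0,1}. (((1::real) gchoose n) * (- 1) ^ n) *\<^sub>R x ^ n)"
    by (rule sums_finite) (auto simp: z)
  then show ?thesis by (simp add: binom_series_def sums_iff)
qed

lemma binom_series_0: "binom_series 0 x = (1::'b::{real_normed_algebra,monoid_mult,banach})"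
proof -
  have "(\<lambda>n. (((0::real) gchoose n) * (- 1) ^ n) *\<^sub>R x ^ n) sums
      (\<Sum>n\<in>{0}. (((0::real) gchoose n) * (- 1) ^ n) *\<^sub>R x ^ n)"
    by (rule sums_finite) (auto simp: gbinomial_0_left)
  then show ?thesis by (simp add: binom_series_def sums_iff)
qed

lemma binom_abs_summable_less:
  assumes "0 \<le> r" "r < 1"
  shows "binom_abs_summable a r"
proof -
  have "ereal (norm r) < conv_radius (\<lambda>n. a gchoose n)"
    using assms by (simp add: conv_radius_gchoose)
  from abs_summable_in_conv_radius[OF this] show ?thesis
    using assms by (simp add: binom_abs_summable_def abs_mult power_abs)
qed

text \<open>The partial sums of the binomial series for exponent 1/2 at the boundary point telescope to \<open>\<bar>-1/2 gchoose n\<bar>\<close>.\<close>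

lemma gchoose_half_partial_sum:
  "(\<Sum>n\<le>N. \<bar>(1/2::real) gchoose Suc n\<bar>) \<le> 1"
proof -
  have sgn: "((1/2::real) gchoose Suc n) * (- 1) ^ n = \<bar>(1/2::real) gchoose Suc n\<bar>" 
    and pos: "0 \<le> (- 1) ^ n * ((- 1/2::real) gchoose n)" for n
  proof -
    have "0 \<le> pochhammer (1/2::real) n" by (intro less_imp_le pochhammer_pos) simp
    then show neg: "0 \<le> (- 1) ^ n * ((- 1/2::real) gchoose n)"
      by (simp add: gbinomial_pochhammer mult.assoc[symmetric] power_mult_distrib[symmetric])
    \<comment> \<open>Absorption reduces the sign of the coefficients for exponent 1/2 to that for
      exponent -1/2, which can be read off the Pochhammer symbol.\<close>
    have "of_nat (Suc n) * ((1/2::real) gchoose Suc n) = 1/2 * (- 1/2 gchoose n)"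
      using gbinomial_absorption[of n "1/2::real"] by simp
    then have "(of_nat (Suc n) * ((1/2::real) gchoose Suc n)) * (- 1) ^ n = (1/2 * (- 1/2 gchoose n)) * (- 1) ^ n"
      by (rule arg_cong)
    then have "of_nat (Suc n) * (((1/2::real) gchoose Suc n) * (- 1) ^ n) = 1/2 * ((- 1) ^ n * (- 1/2 gchoose n))"
      by (simp only: mult_ac)
    then have "0 \<le> of_nat (Suc n) * (((1/2::real) gchoose Suc n) * (- 1) ^ n)"
      using neg by (simp only:)
    then have "0 \<le> ((1/2::real) gchoose Suc n) * (- 1) ^ n"
      by (simp only: zero_le_mult_iff[of "of_nat (Suc n)"]) simp
    moreover have "\<bar>((1/2::real) gchoose Suc n) * (- 1) ^ n\<bar> = \<bar>(1/2::real) gchoose Suc n\<bar>"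
      by (simp add: abs_mult power_abs)
    ultimately show "((1/2::real) gchoose Suc n) * (- 1) ^ n = \<bar>(1/2::real) gchoose Suc n\<bar>" by linarith
  qed
  have "(\<Sum>k\<le>Suc N. ((1/2::real) gchoose k) * (- 1) ^ k) = 1 - (\<Sum>n\<le>N. \<bar>(1/2::real) gchoose Suc n\<bar>)"
    by (subst sum.atMost_Suc_shift) (simp add: sgn[symmetric] sum_negf)
  moreover have "(\<Sum>k\<le>Suc N. ((1/2::real) gchoose k) * (- 1) ^ k) \<ge> 0"
    using pos[of "Suc N"] by (simp only: gbinomial_sum_lower_neg) simp
  ultimately show ?thesis by simp
qed

lemma binom_abs_summable_half: "binom_abs_summable (1/2) 1"
proof -
  have "summable (\<lambda>n. \<bar>(1/2::real) gchoose Suc n\<bar>)"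
    by (rule bounded_imp_summable[OF _ gchoose_half_partial_sum]) simp
  then show ?thesis
    unfolding binom_abs_summable_def
    using summable_Suc_iff[of "\<lambda>n. \<bar>(1/2::real) gchoose n\<bar>"] by simp
qed

lemma suminf_gchoose_half_le: "(\<Sum>n. \<bar>(1/2::real) gchoose Suc n\<bar>) \<le> 1"
proof (rule suminf_le_const)
  show "summable (\<lambda>n. \<bar>(1/2::real) gchoose Suc n\<bar>)"
    by (rule bounded_imp_summable[OF _ gchoose_half_partial_sum]) simp
  show "(\<Sum>n<N. \<bar>(1/2::real) gchoose Suc n\<bar>) \<le> 1" for N
  proof (rule order_trans[OF _ gchoose_half_partial_sum[of N]])
    show "(\<Sum>n<N. \<bar>(1/2::real) gchoose Suc n\<bar>) \<le> (\<Sum>n\<le>N. \<bar>(1/2::real) gchoose Suc n\<bar>)"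
      by (rule sum_mono2) auto
  qed
qed

lemma sqrt_series_square:
  fixes x :: "'b::{real_normed_algebra,monoid_mult,banach}"
  assumes "norm x \<le> 1"
  shows "binom_series (1/2) x * binom_series (1/2) x = 1 - x"
  using binom_series_mult[OF binom_abs_summable_half binom_abs_summable_half assms]
  by (simp add: binom_series_1)

text \<open>The coefficients after the constant term have absolute sum at most 1. The bound makes
  the square root \<open>H\<close> of an operator positive, because
  \<open>inner ((1 - H) x) x\<close> cannot exceed \<open>inner x x\<close>.\<close>

lemma norm_sqrt_series_le:
  fixes x :: "'b::{real_normed_algebra,monoid_mult,banach}"
  assumes x: "norm x \<le> 1"
  shows "norm (1 - binom_series (1/2) x) \<le> 1"
proof -
  define b where "b n = ((1/2::real) gchoose n) * (- 1) ^ n" for n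
  have bn: "\<bar>b n\<bar> = \<bar>(1/2::real) gchoose n\<bar>" for n by (simp add: b_def abs_mult power_abs)
  have xn: "norm (x ^ Suc n) \<le> 1" for n
  proof (induction n)
    case (Suc n)
    have "norm (x ^ Suc (Suc n)) \<le> norm x * norm (x ^ Suc n)"
      by (subst power_Suc) (rule norm_mult_ineq)
    also have "\<dots> \<le> 1" using x Suc by (simp add: mult_le_one)
    finally show ?case .
  qed (simp add: x)
  have s1: "summable (\<lambda>n. \<bar>b (Suc n)\<bar>)"
    using binom_abs_summable_half summable_Suc_iff[of "\<lambda>n. \<bar>(1/2::real) gchoose n\<bar>"]
    by (simp add: bn binom_abs_summable_def)
  have le: "norm (b (Suc n) *\<^sub>R x ^ Suc n) \<le> \<bar>b (Suc n)\<bar>" for n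
    using mult_left_mono[OF xn[of n], of "\<bar>b (Suc n)\<bar>"] by simp
  have s2: "summable (\<lambda>n. norm (b (Suc n) *\<^sub>R x ^ Suc n))"
    by (rule summable_comparison_test'[OF s1, of 0]) (use le in simp)
  have "(\<lambda>n. b n *\<^sub>R x ^ n) sums binom_series (1/2) x"
    using binom_series_sums[OF binom_abs_summable_half x] by (simp add: b_def)
  then have "(\<lambda>n. b (Suc n) *\<^sub>R x ^ Suc n) sums (binom_series (1/2) x - 1)"
    by (subst sums_Suc_iff) (simp add: b_def)
  then have "binom_series (1/2) x - 1 = (\<Sum>n. b (Suc n) *\<^sub>R x ^ Suc n)"
    by (simp add: sums_iff)
  also have "norm \<dots> \<le> (\<Sum>n. norm (b (Suc n) *\<^sub>R x ^ Suc n))"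
    by (rule summable_norm[OF s2])
  also have "\<dots> \<le> (\<Sum>n. \<bar>b (Suc n)\<bar>)"
    by (rule suminf_le[OF le s2 s1])
  also have "\<dots> \<le> 1" using suminf_gchoose_half_le by (simp add: bn)
  finally show ?thesis by (simp add: norm_minus_commute)
qed

text \<open>The inverse square root of \<open>1 - x\<close>.\<close>

definition isqrt_compl :: "'b::{real_normed_algebra,monoid_mult} \<Rightarrow> 'b"
  where "isqrt_compl = binom_series (- 1/2)"

lemma isqrt_compl_square:
  fixes x :: "'b::{real_normed_algebra,monoid_mult,banach}"
  assumes "norm x < 1"
  shows "(1 - x) * (isqrt_compl x * isqrt_compl x) = 1"
proof -
  have s: "binom_abs_summable a (norm x)" for a
    using assms by (simp add: binom_abs_summable_less)
  have "isqrt_compl x * isqrt_compl x = binom_series (- 1) x"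
    using binom_series_mult[OF s s, of x "-1/2" "-1/2"] by (simp add: isqrt_compl_def)
  then show ?thesis
    using binom_series_mult[OF s s, of x "1" "-1"] by (simp add: binom_series_1 binom_series_0)
qed

lemma continuous_on_isqrt_compl:
  assumes "r < 1"
  shows "continuous_on (cball 0 r) (isqrt_compl :: 'b \<Rightarrow> 'b::{real_normed_algebra,monoid_mult,banach})"
proof (cases "0 \<le> r")
  case r: True
  have s: "binom_abs_summable (- 1/2) r"
    using assms r by (simp add: binom_abs_summable_less)
  show ?thesis
  proof (rule uniform_limit_theorem)
    show "uniform_limit (cball 0 r) (\<lambda>N x::'b. \<Sum>n<N. ((-1/2 gchoose n) * (- 1) ^ n) *\<^sub>R x ^ n) isqrt_compl sequentially"
      unfolding isqrt_compl_def binom_series_def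
    proof (rule Weierstrass_m_test)
      show "summable (\<lambda>n. norm (1::'b) * (\<bar>-1/2 gchoose n\<bar> * r ^ n))"
        using s by (intro summable_mult) (simp add: binom_abs_summable_def)
      fix n and x :: 'b assume "x \<in> cball 0 r"
      then have "norm (x ^ n) \<le> norm (1::'b) * r ^ n"
        using norm_power_le[of x n]
        by (auto elim!: order_trans intro!: mult_left_mono power_mono)
      then show "norm (((-1/2 gchoose n) * (- 1) ^ n) *\<^sub>R x ^ n) \<le> norm (1::'b) * (\<bar>-1/2 gchoose n\<bar> * r ^ n)"
        by (simp add: abs_mult power_abs mult.left_commute[of "norm 1"] mult_left_mono)
    qed
    show "\<forall>\<^sub>F n in sequentially. continuous_on (cball 0 r) (\<lambda>x::'b. \<Sum>i<n. ((-1/2 gchoose i) * (- 1) ^ i) *\<^sub>R x ^ i)"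
      by (intro always_eventually allI continuous_intros)
  qed simp
next
  case False
  then have "cball 0 r = ({}::'b set)" by auto
  then show ?thesis by simp
qed

text \<open>Any property of the powers that survives real linear combinations and limits, such as
  self-adjointness or commuting with a given operator, passes to the sum.\<close>

lemma binom_series_closed:
  fixes x :: "'b::{real_normed_algebra,monoid_mult,banach}"
  assumes "binom_abs_summable a r" "norm x \<le> r"
    and "closed S" "subspace S" "\<And>n. x ^ n \<in> S"
  shows "binom_series a x \<in> S"
proof (rule closed_sequentially[OF assms(3)])
  show "(\<lambda>N. \<Sum>n<N. ((a gchoose n) * (- 1) ^ n) *\<^sub>R x ^ n) \<longlonglongrightarrow> binom_series a x"
    using binom_series_sums[OF assms(1,2)] by (simp add: sums_def)
  show "(\<Sum>n<N. ((a gchoose n) * (- 1) ^ n) *\<^sub>R x ^ n) \<in> S" for N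
    using assms by (intro subspace_sum subspace_mul)
qed

lemma isqrt_compl_closed:
  fixes x :: "'b::{real_normed_algebra,monoid_mult,banach}"
  assumes "norm x < 1" "closed S" "subspace S" "\<And>n. x ^ n \<in> S"
  shows "isqrt_compl x \<in> S"
  unfolding isqrt_compl_def
  using binom_series_closed[OF binom_abs_summable_less[of "norm x"], of x S "-1/2"] assms by simp

text \<open>With a factor \<open>x\<close> split off, the normalising factor is seen to differ from
  1 by a compact operator when \<open>x\<close> is compact. The value at 0 also follows.\<close>

lemma isqrt_compl_expand:
  fixes x :: "'b::{real_normed_algebra,monoid_mult,banach}"
  assumes "norm x < 1"
  obtains y where "isqrt_compl x = 1 + x * y"
proof -
  have s: "binom_abs_summable a (norm x)" for a
    using assms by (simp add: binom_abs_summable_less)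
  define c where "c n = ((-1/2::real) gchoose n) * (- 1) ^ n" for n
  have sums: "(\<lambda>n. c n *\<^sub>R x ^ n) sums isqrt_compl x"
    using binom_series_sums[OF s order_refl] by (simp add: c_def isqrt_compl_def)
  have "summable (\<lambda>n. \<bar>c (Suc n)\<bar> * norm x ^ Suc n)"
    using s[of "-1/2"] unfolding binom_abs_summable_def c_def
    by (subst summable_Suc_iff) (simp add: abs_mult power_abs)
  have "summable (\<lambda>n. c (Suc n) *\<^sub>R x ^ n)"
  proof (cases "x = 0")
    case True
    show ?thesis unfolding True by (rule summable_finite[of "{0}"]) (auto simp: gr0_conv_Suc)
  next
    case False
    have "summable (\<lambda>n. norm (1::'b) * inverse (norm x) * (\<bar>c (Suc n)\<bar> * norm x ^ Suc n))"
      by (rule summable_mult) fact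
    then have "summable (\<lambda>n. \<bar>c (Suc n)\<bar> * (norm (1::'b) * norm x ^ n))"
      using False by (simp add: mult_ac)
    then show ?thesis
      by (rule summable_comparison_test'[where N = 0]) (auto intro!: mult_left_mono norm_power_le)
  qed
  then have "(\<lambda>n. c (Suc n) *\<^sub>R x ^ Suc n) sums (x * (\<Sum>n. c (Suc n) *\<^sub>R x ^ n))"
    using sums_mult[OF summable_sums, of "\<lambda>n. c (Suc n) *\<^sub>R x ^ n" x] by simp
  moreover have "(\<lambda>n. c (Suc n) *\<^sub>R x ^ Suc n) sums (isqrt_compl x - 1)"
    using sums by (subst sums_Suc_iff) (simp add: c_def)
  ultimately have "x * (\<Sum>n. c (Suc n) *\<^sub>R x ^ n) = isqrt_compl x - 1"
    by (rule sums_unique2)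
  then have "isqrt_compl x = 1 + x * (\<Sum>n. c (Suc n) *\<^sub>R x ^ n)" by simp
  then show ?thesis by (rule that)
qed

section \<open>Self-adjoint and compact operators\<close>

text \<open>The real inner product is enough for complex linear operators, because the imaginary
  part of \<open>cinner x y\<close> is \<open>inner (\<i> *\<^sub>C x) y\<close>. It is also the one
  that an anti-unitary preserves without conjugation.\<close>

definition selfadj :: "'a::complex_inner cop \<Rightarrow> bool"
  where "selfadj T \<longleftrightarrow> (\<forall>x y. inner (T x) y = inner x (T y))"

lemma selfadjD: "selfadj T \<Longrightarrow> inner (app T x) y = inner x (T y)"
  by (simp add: selfadj_def)

lemma selfadj_iff_cinner: "selfadj T \<longleftrightarrow> (\<forall>x y. cinner (app T x) y = cinner x (T y))"
proof
  assume T: "selfadj T"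
  show "\<forall>x y. cinner (app T x) y = cinner x (T y)"
  proof (intro allI complex_eqI)
    fix x y
    show "Re (cinner (app T x) y) = Re (cinner x (T y))"
      using selfadjD[OF T, of x y] by (simp add: inner_eq_Re_cinner)
    show "Im (cinner (app T x) y) = Im (cinner x (T y))"
      using selfadjD[OF T, of "\<i> *\<^sub>C x" y] by (simp add: Im_cinner)
  qed
qed (simp add: selfadj_def inner_eq_Re_cinner)

lemma selfadj_cinnerD: "selfadj T \<Longrightarrow> cinner (app T x) y = cinner x (T y)"
  by (simp add: selfadj_iff_cinner)

lemma selfadj_0 [simp]: "selfadj 0" and selfadj_1 [simp]: "selfadj 1"
  by (simp_all add: selfadj_def)

lemma selfadj_add: "selfadj S \<Longrightarrow> selfadj T \<Longrightarrow> selfadj (S + T)"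
  and selfadj_diff: "selfadj S \<Longrightarrow> selfadj T \<Longrightarrow> selfadj (S - T)"
  and selfadj_minus: "selfadj S \<Longrightarrow> selfadj (- S)"
  and selfadj_scaleR: "selfadj S \<Longrightarrow> selfadj (r *\<^sub>R S)"
  by (simp_all add: selfadj_def inner_add_left inner_add_right inner_diff_left inner_diff_right)

lemma selfadj_mult: "selfadj S \<Longrightarrow> selfadj T \<Longrightarrow> S * T = T * S \<Longrightarrow> selfadj (S * T)"
  by (metis app_simps(6) selfadj_def)

lemma selfadj_conj: "selfadj S \<Longrightarrow> selfadj T \<Longrightarrow> selfadj (S * T * S)"
  by (simp add: selfadj_def)

lemma selfadj_square: "selfadj S \<Longrightarrow> selfadj (S * S)"
  by (simp add: selfadj_def)

lemma selfadj_power: "selfadj S \<Longrightarrow> selfadj (S ^ n)"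
  by (induction n) (auto intro: selfadj_mult simp: power_commutes)

lemmas selfadj_intros = selfadj_0 selfadj_1 selfadj_add selfadj_diff selfadj_minus selfadj_scaleR

text \<open>This is the adjoint of the equation \<open>R * S = T\<close>.\<close>

lemma selfadj_mult_swap:
  assumes "selfadj R" "selfadj S" "selfadj T" "R * S = T"
  shows "S * R = T"
proof (rule cop_eqI)
  fix x
  have "inner ((S * R) x - T x) y = 0" for y
  proof -
    have "inner ((S * R) x) y = inner x ((R * S) y)"
      using assms(1,2) by (simp add: selfadj_def)
    also have "\<dots> = inner (T x) y"
      by (simp only: assms(4) selfadjD[OF assms(3)])
    finally show ?thesis by (simp add: inner_diff_left)
  qed
  from this[of "(S * R) x - T x"] show "(S * R) x = T x" by simp
qed

lemma subspace_selfadj: "subspace {T :: 'a::complex_inner cop. selfadj T}"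
  by (simp add: subspace_def selfadj_intros)

lemma closed_selfadj: "closed {T :: 'a::complex_inner cop. selfadj T}"
proof -
  have eq: "{T :: 'a cop. selfadj T} = (\<Inter>x. \<Inter>y. {T. inner (app T x) y = inner x (T y)})"
    by (auto simp: selfadj_def)
  show ?thesis
    unfolding eq by (intro closed_INT ballI closed_Collect_eq continuous_intros)
qed

lemma subspace_commuting: "subspace {T :: 'a::complex_inner cop. S * T = T * S}"
  by (simp add: subspace_def distrib_left distrib_right)

lemma closed_commuting: "closed {T :: 'a::complex_inner cop. S * T = T * S}"
  by (intro closed_Collect_eq continuous_intros)

lemma commute_power: "(S::'b::monoid_mult) * T = T * S \<Longrightarrow> S * T ^ n = T ^ n * S"
  by (induction n) (auto simp: mult.assoc, metis mult.assoc)

lemma isqrt_compl_commute: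
  fixes X :: "'a::chilbert_space cop"
  assumes "norm X < 1" "S * X = X * S"
  shows "S * isqrt_compl X = isqrt_compl X * S"
  using isqrt_compl_closed[OF assms(1) closed_commuting subspace_commuting, of S] commute_power[OF assms(2)]
  by simp

lemma isqrt_compl_selfadj:
  fixes X :: "'a::chilbert_space cop"
  assumes "norm X < 1" "selfadj X"
  shows "selfadj (isqrt_compl X)"
  using isqrt_compl_closed[OF assms(1) closed_selfadj subspace_selfadj] selfadj_power[OF assms(2)]
  by simp

section \<open>Orthogonal projections\<close>

definition proj :: "'a::complex_inner cop \<Rightarrow> bool"
  where "proj P \<longleftrightarrow> P * P = P \<and> selfadj P"

lemma proj_idem: "proj P \<Longrightarrow> P * P = P" "proj P \<Longrightarrow> app P (P x) = P x"
  by (metis proj_def, metis app_simps(6) proj_def)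

lemma proj_selfadj: "proj P \<Longrightarrow> selfadj P"
  by (simp add: proj_def)

lemma proj_0 [simp]: "proj 0"
  by (simp add: proj_def)

lemma proj_compl: "proj P \<Longrightarrow> proj (1 - P)"
  by (simp add: proj_def algebra_simps selfadj_diff)

lemma proj_add: "proj P \<Longrightarrow> proj Q \<Longrightarrow> P * Q = 0 \<Longrightarrow> proj (P + Q)"
  using selfadj_mult_swap[of P Q 0] by (simp add: proj_def algebra_simps selfadj_add)

lemma proj_diff: "proj P \<Longrightarrow> proj Q \<Longrightarrow> P * Q = Q \<Longrightarrow> proj (P - Q)"
  using selfadj_mult_swap[of P Q Q] by (simp add: proj_def algebra_simps selfadj_diff)

lemma norm_proj_le: "proj P \<Longrightarrow> norm (app P x) \<le> norm x"
proof -
  assume P: "proj P"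
  have "norm (P x) * norm (P x) = inner (P x) (P x)"
    by (simp add: dot_square_norm power2_eq_square)
  also have "\<dots> = inner (P x) x"
    using P by (simp add: proj_idem selfadjD[OF proj_selfadj[OF P], of x "P x"] inner_commute)
  also have "\<dots> \<le> norm (P x) * norm x" by (rule norm_cauchy_schwarz)
  finally show ?thesis
    by (metis mult_le_cancel_left_pos norm_ge_zero order_le_less zero_less_norm_iff norm_zero)
qed

text \<open>The range of \<open>P - G\<close> consists of vectors fixed by \<open>P\<close> and
  killed by \<open>G\<close>. With \<open>G\<close> built from orthonormal sequences, the last
  assumption says that they are complete in the range of \<open>P\<close>.\<close>

lemma proj_eqI:
  assumes G: "proj G" and P: "proj P" and PG: "P * G = G"
    and 0: "\<And>y. app P y = y \<Longrightarrow> app G y = 0 \<Longrightarrow> y = 0"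
  shows "G = P"
proof -
  have "app P (G z) = G z" for z
    using arg_cong[OF PG, of "\<lambda>T. app T z"] by simp
  note pg = this
  have "P x - G (P x) = 0" for x
    by (rule 0) (simp_all add: pg proj_idem P G)
  then have "G * P = P" by (intro cop_eqI) simp
  with selfadj_mult_swap[OF proj_selfadj[OF P] proj_selfadj[OF G] proj_selfadj[OF G] PG]
  show ?thesis by simp
qed

lemma norm_square_selfadj: "selfadj T \<Longrightarrow> (norm (app T x))\<^sup>2 = inner ((T * T) x) x"
  by (simp add: power2_norm_eq_inner selfadj_def)

text \<open>A self-adjoint operator that leaves a closed subspace invariant also leaves its
  orthogonal complement invariant.\<close>

lemma proj_commuteI:
  assumes "proj Q" "selfadj T" "\<And>x. app Q x = x \<Longrightarrow> Q (T x) = T x"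
  shows "Q * T = T * Q"
proof -
  have 1: "Q * T * Q = T * Q"
    using assms(1,3) by (intro cop_eqI) (simp add: proj_idem)
  have s: "selfadj (Q * T * Q)"
    using assms by (simp add: selfadj_conj proj_selfadj)
  have "inner ((Q * T) x - (T * Q) x) y = 0" for x y
  proof -
    have "inner ((Q * T) x) y = inner x ((T * Q) y)"
      using assms by (simp add: selfadjD proj_selfadj)
    also have "\<dots> = inner ((T * Q) x) y"
      using s 1 by (simp add: selfadj_def)
    finally show ?thesis by (simp add: inner_diff_left)
  qed
  from this[of x "(Q * T) x - (T * Q) x" for x] show ?thesis
    by (intro cop_eqI) simp
qed

section \<open>Compact operators\<close>

definition compact_cop :: "'a::complex_inner cop \<Rightarrow> bool"
  where "compact_cop K \<longleftrightarrow> (\<forall>x::nat \<Rightarrow> 'a. bounded (range x) \<longrightarrow>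
    (\<exists>l r. strict_mono r \<and> (\<lambda>n. K (x (r n))) \<longlonglongrightarrow> l))"

lemma compact_copE:
  fixes x :: "nat \<Rightarrow> 'a::complex_inner"
  assumes "compact_cop K" "bounded (range x)"
  obtains l r where "strict_mono r" "(\<lambda>n. app K (x (r n))) \<longlonglongrightarrow> l"
  using assms unfolding compact_cop_def by blast

text \<open>The sequential form makes sums and products with bounded operators immediate.\<close>

lemma compact_cop_iff: "compact_cop K \<longleftrightarrow> blinfun_of_cop K \<in> compact_ops"
proof
  assume K: "compact_cop K"
  define S where "S = app K ` cball 0 1"
  have "\<exists>l\<in>closure S. \<exists>r. strict_mono r \<and> (y \<circ> r) \<longlonglongrightarrow> l" if y: "\<forall>n. y n \<in> closure S" for y :: "nat \<Rightarrow> 'a"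
  proof -
    \<comment> \<open>Points of the closure are replaced by images of points of the ball at distance
      below 1/(n+1), which does not affect limits.\<close>
    have "\<exists>x\<in>cball 0 1. dist (app K x) (y n) < inverse (real (Suc n))" for n
      using y closure_approachable[of "y n" S] inverse_Suc by (fastforce simp: S_def)
    then obtain x where x: "\<And>n. x n \<in> cball 0 1" "\<And>n. dist (app K (x n)) (y n) < inverse (real (Suc n))"
      by metis
    have "bounded (range x)" using x(1) by (meson bounded_cball bounded_subset image_subsetI)
    then obtain l r where r: "strict_mono r" and l: "(\<lambda>n. app K (x (r n))) \<longlonglongrightarrow> l"
      by (rule compact_copE[OF K])
    have "(\<lambda>n. dist (app K (x n)) (y n)) \<longlonglongrightarrow> 0"
      by (rule tendsto_sandwich[OF _ _ tendsto_const LIMSEQ_inverse_real_of_nat])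
        (auto intro!: always_eventually less_imp_le[OF x(2)] simp del: of_nat_Suc)
    from LIMSEQ_subseq_LIMSEQ[OF this r] have "(\<lambda>n. dist (app K (x (r n))) (y (r n))) \<longlonglongrightarrow> 0"
      by (simp add: comp_def)
    then have "(\<lambda>n. app K (x (r n)) - y (r n)) \<longlonglongrightarrow> 0"
      unfolding dist_norm by (rule tendsto_norm_zero_cancel)
    from tendsto_diff[OF l this] have "(\<lambda>n. y (r n)) \<longlonglongrightarrow> l" by simp
    then have "(y \<circ> r) \<longlonglongrightarrow> l" by (simp add: comp_def)
    moreover have "l \<in> closure S"
      using y by (intro closed_sequentially[OF closed_closure _ \<open>(y \<circ> r) \<longlonglongrightarrow> l\<close>]) auto
    ultimately show ?thesis using r by blast
  qed
  then have "compact (closure S)"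
    unfolding compact_eq_seq_compact_metric seq_compact_def by blast
  then show "blinfun_of_cop K \<in> compact_ops"
    by (simp add: compact_ops_def blinfun_of_cop S_def app.rep_eq)
next
  assume "blinfun_of_cop K \<in> compact_ops"
  then have "compact (closure (app K ` cball 0 1))"
    by (simp add: compact_ops_def app.rep_eq)
  then have sc: "seq_compact (closure (app K ` cball 0 1))"
    by (simp add: compact_eq_seq_compact_metric)
  show "compact_cop K"
    unfolding compact_cop_def
  proof (intro allI impI)
    fix x :: "nat \<Rightarrow> 'a" assume "bounded (range x)"
    then obtain b where b: "b > 0" "\<And>n. norm (x n) \<le> b"
      by (auto simp: bounded_pos)
    define y where "y n = K ((1 / b) *\<^sub>R x n)" for n
    have "y n \<in> closure (app K ` cball 0 1)" for n
      using b by (intro subsetD[OF closure_subset]) (auto simp: y_def field_simps simp del: app_scaleR)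
    then obtain l r where "strict_mono r" "(y \<circ> r) \<longlonglongrightarrow> l"
      using seq_compactE[OF sc, of y] by metis
    then have "(\<lambda>n. b *\<^sub>R y (r n)) \<longlonglongrightarrow> b *\<^sub>R l"
      by (intro tendsto_intros) (simp add: comp_def)
    then have "(\<lambda>n. K (x (r n))) \<longlonglongrightarrow> b *\<^sub>R l"
      using b by (simp add: y_def)
    then show "\<exists>l r. strict_mono r \<and> (\<lambda>n. K (x (r n))) \<longlonglongrightarrow> l"
      using \<open>strict_mono r\<close> by blast
  qed
qed

lemma compact_cop_0 [simp]: "compact_cop 0"
  unfolding compact_cop_def by (auto intro!: exI[of _ 0] exI[of _ id] simp: strict_mono_def)

lemma compact_cop_add:
  assumes "compact_cop S" "compact_cop T"
  shows "compact_cop (S + T)"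
  unfolding compact_cop_def
proof (intro allI impI)
  fix x :: "nat \<Rightarrow> 'a" assume x: "bounded (range x)"
  obtain l r where r: "strict_mono r" and l: "(\<lambda>n. app S (x (r n))) \<longlonglongrightarrow> l"
    by (rule compact_copE[OF assms(1) x])
  have "bounded (range (x \<circ> r))" using x by (rule bounded_subset) auto
  then obtain m q where q: "strict_mono q" and m: "(\<lambda>n. app T ((x \<circ> r) (q n))) \<longlonglongrightarrow> m"
    by (rule compact_copE[OF assms(2)])
  have "(\<lambda>n. app S (x (r (q n)))) \<longlonglongrightarrow> l"
    using LIMSEQ_subseq_LIMSEQ[OF l q] by (simp add: comp_def)
  from tendsto_add[OF this m] have "(\<lambda>n. app (S + T) (x ((r \<circ> q) n))) \<longlonglongrightarrow> l + m" by simp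
  then show "\<exists>l r. strict_mono r \<and> (\<lambda>n. app (S + T) (x (r n))) \<longlonglongrightarrow> l"
    using strict_mono_o[OF r q] by blast
qed

lemma compact_cop_mult_left:
  assumes "compact_cop K"
  shows "compact_cop (T * K)"
  unfolding compact_cop_def
proof (intro allI impI)
  fix x :: "nat \<Rightarrow> 'a" assume x: "bounded (range x)"
  obtain l r where r: "strict_mono r" and l: "(\<lambda>n. app K (x (r n))) \<longlonglongrightarrow> l"
    by (rule compact_copE[OF assms x])
  have "(\<lambda>n. (T * K) (x (r n))) \<longlonglongrightarrow> T l"
    using tendsto_app[OF tendsto_const l] by simp
  then show "\<exists>l r. strict_mono r \<and> (\<lambda>n. (T * K) (x (r n))) \<longlonglongrightarrow> l"
    using r by blast
qed

lemma compact_cop_mult_right: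
  assumes "compact_cop K"
  shows "compact_cop (K * T)"
  unfolding compact_cop_def
proof (intro allI impI)
  fix x :: "nat \<Rightarrow> 'a" assume "bounded (range x)"
  then obtain b where b: "\<And>n. norm (x n) \<le> b" by (auto simp: bounded_iff)
  have "norm (app T (x n)) \<le> norm T * b" for n
    using norm_app_le[of T "x n"] b[of n] by (meson mult_left_mono norm_ge_zero order_trans)
  then have "bounded (range (\<lambda>n. app T (x n)))" by (auto simp: bounded_iff)
  then obtain l r where "strict_mono r" "(\<lambda>n. app K (T (x (r n)))) \<longlonglongrightarrow> l"
    by (rule compact_copE[OF assms])
  then show "\<exists>l r. strict_mono r \<and> (\<lambda>n. (K * T) (x (r n))) \<longlonglongrightarrow> l" by auto
qed

lemma compact_cop_scaleR: "compact_cop K \<Longrightarrow> compact_cop (r *\<^sub>R K)"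
  using compact_cop_mult_left[of K "r *\<^sub>R 1"] by simp

lemma compact_cop_minus: "compact_cop K \<Longrightarrow> compact_cop (- K)"
  using compact_cop_scaleR[of K "-1"] by simp

lemma compact_cop_diff: "compact_cop S \<Longrightarrow> compact_cop T \<Longrightarrow> compact_cop (S - T)"
  using compact_cop_add[of S "- T"] by (simp add: compact_cop_minus)

lemmas compact_cop_intros = compact_cop_0 compact_cop_add compact_cop_diff compact_cop_minus
  compact_cop_scaleR compact_cop_mult_left compact_cop_mult_right

text \<open>The eigenvalue 1 of a compact contraction \<open>D\<^sup>2\<close> is isolated from the rest of its spectrum.\<close>

lemma compact_square_gap:
  fixes D Q :: "'a::chilbert_space cop"
  assumes D: "selfadj D" "norm D \<le> 1" "compact_cop (D * D)" and Q: "proj Q"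
    and ker: "\<And>x. app D (D x) = x \<Longrightarrow> Q x = x"
  shows "norm (D * D * (1 - Q)) < 1"
proof (rule ccontr)
  assume ge: "\<not> norm (D * D * (1 - Q)) < 1"
  have contr: "norm (app D x) \<le> norm x" for x
    using norm_app_le[of D x] D(2) by (meson mult_left_le_one_le norm_ge_zero order_trans)
  \<comment> \<open>Vectors on which the square of \<open>D\<close> nearly attains norm 1, moved
    into the kernel of \<open>Q\<close>.\<close>
  have "\<exists>y. norm y \<le> 1 \<and> app Q y = 0 \<and> norm (app D (D y)) \<ge> 1 - inverse (real (Suc n))" for n
  proof -
    define c where "c = 1 - inverse (real (Suc n))"
    have c: "0 \<le> c" "c < 1" by (auto simp: c_def field_simps)
    obtain x where x: "\<not> norm ((D * D * (1 - Q)) x) \<le> c * norm x"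
      using norm_cop_bound[of c "D * D * (1 - Q)"] c ge by force
    then have nz: "norm x > 0" by (metis app_zero norm_zero mult_zero_right order_refl zero_less_norm_iff)
    define y where "y = (1 - Q) ((1 / norm x) *\<^sub>R x)"
    have "norm y \<le> 1"
      using norm_proj_le[OF proj_compl[OF Q], of "(1 / norm x) *\<^sub>R x"] nz by (simp add: y_def)
    moreover have "Q y = 0" using Q by (simp add: y_def proj_idem)
    moreover have "norm (D (D y)) = norm ((D * D * (1 - Q)) ((1 / norm x) *\<^sub>R x))"
      by (simp add: y_def)
    then have "norm (D (D y)) = norm ((D * D * (1 - Q)) x) / norm x"
      by (simp only: app_scaleR) simp
    then have "norm (D (D y)) \<ge> c"
      using x nz by (simp add: pos_le_divide_eq del: app_simps)
    ultimately show ?thesis unfolding c_def by blast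
  qed
  then obtain y where y: "\<And>n. norm (y n) \<le> 1" "\<And>n. app Q (y n) = 0"
      "\<And>n. norm (app D (D (y n))) \<ge> 1 - inverse (real (Suc n))" by metis
  have "bounded (range y)" using y(1) by (auto simp: bounded_iff)
  then obtain z r where r: "strict_mono r" and z0: "(\<lambda>n. app (D * D) (y (r n))) \<longlonglongrightarrow> z"
    by (rule compact_copE[OF D(3)])
  then have z: "(\<lambda>n. app D (D (y (r n)))) \<longlonglongrightarrow> z" by simp
  have inv: "(\<lambda>n. inverse (real (Suc (r n)))) \<longlonglongrightarrow> 0"
    using LIMSEQ_subseq_LIMSEQ[OF LIMSEQ_inverse_real_of_nat r] by (simp add: comp_def)
  \<comment> \<open>Such vectors are approximate eigenvectors: the cross term is twice
    \<open>(norm (D (y n)))\<^sup>2\<close>, which dominates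
    \<open>(norm (D (D (y n))))\<^sup>2\<close>.\<close>
  have dist: "(norm (app D (D (y n)) - y n))\<^sup>2 \<le> 1 - (1 - inverse (real (Suc n)))\<^sup>2" for n
  proof -
    have "(norm (app D (D (y n)) - y n))\<^sup>2
        = (norm (D (D (y n))))\<^sup>2 - 2 * (norm (D (y n)))\<^sup>2 + (norm (y n))\<^sup>2"
      using selfadjD[OF D(1), of "D (y n)" "y n"]
      by (simp add: power2_norm_eq_inner inner_diff_left inner_diff_right inner_commute)
    moreover have "(norm (D (D (y n))))\<^sup>2 \<le> (norm (D (y n)))\<^sup>2" using contr by (simp add: power_mono)
    moreover have "(norm (y n))\<^sup>2 \<le> 1" using y(1) by (simp add: power_le_one)
    moreover have "(1 - inverse (real (Suc n)))\<^sup>2 \<le> (norm (app D (D (y n))))\<^sup>2"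
      using y(3) by (intro power_mono) (auto simp: field_simps)
    ultimately show ?thesis by linarith
  qed
  have "(\<lambda>n. (norm (app D (D (y (r n))) - y (r n)))\<^sup>2) \<longlonglongrightarrow> 0"
  proof (rule tendsto_sandwich[OF _ _ tendsto_const])
    show "(\<lambda>n. 1 - (1 - inverse (real (Suc (r n))))\<^sup>2) \<longlonglongrightarrow> 0"
      by (rule tendsto_eq_intros inv refl | simp)+
  qed (use dist in auto)
  then have "(\<lambda>n. app D (D (y (r n))) - y (r n)) \<longlonglongrightarrow> 0"
    using tendsto_real_sqrt tendsto_norm_zero_cancel by fastforce
  from tendsto_diff[OF z this] have y_lim: "(\<lambda>n. y (r n)) \<longlonglongrightarrow> z" by simp
  have "(\<lambda>n. app D (D (y (r n)))) \<longlonglongrightarrow> D (D z)"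
    by (intro tendsto_intros y_lim)
  then have "D (D z) = z" using z LIMSEQ_unique by blast
  \<comment> \<open>The limit is fixed by \<open>Q\<close> as an eigenvector and killed by
    \<open>Q\<close> as a limit of the \<open>y n\<close>, yet its norm is at least 1.\<close>
  then have "Q z = z" by (rule ker)
  moreover have "(\<lambda>n. app Q (y (r n))) \<longlonglongrightarrow> Q z"
    by (intro tendsto_intros y_lim)
  then have "Q z = 0" using y(2) LIMSEQ_unique[OF _ tendsto_const] by simp
  ultimately have "z = 0" by simp
  moreover have "1 \<le> norm z"
  proof (rule LIMSEQ_le[OF _ tendsto_norm[OF z]])
    show "(\<lambda>n. 1 - inverse (real (Suc (r n)))) \<longlonglongrightarrow> 1"
      by (rule tendsto_eq_intros inv refl | simp)+
  qed (use y(3) in auto)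
  ultimately show False by simp
qed

section \<open>Self-adjoint unitaries anti-commuting with an anti-unitary\<close>

text \<open>The square being at most 2, the norm is at most \<open>sqrt 2\<close>. In each use
  \<open>T\<close> is a difference of two self-adjoint unitaries of the same range whose
  anticommutator is nonnegative.\<close>

lemma norm_less_2I:
  assumes "selfadj T" "\<And>x. inner (app (T * T) x) x \<le> 2 * (norm x)\<^sup>2"
  shows "norm T < 2"
proof -
  have "norm (app T x) \<le> sqrt 2 * norm x" for x
  proof (rule power2_le_imp_le)
    show "(norm (app T x))\<^sup>2 \<le> (sqrt 2 * norm x)\<^sup>2"
      using norm_square_selfadj[OF assms(1)] assms(2) by (simp add: power_mult_distrib)
  qed simp
  then have "norm T \<le> sqrt 2" by (intro norm_cop_bound) auto
  also have "sqrt 2 < 2" by (simp add: real_less_lsqrt)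
  finally show ?thesis .
qed

lemma path_component_sum_set:
  fixes S T :: "'b::real_normed_vector set"
  assumes "path_component S a b" "path_component T c d"
  shows "path_component {u + v |u v. u \<in> S \<and> v \<in> T} (a + c) (b + d)"
proof -
  from assms(1) obtain g where g: "path g" "path_image g \<subseteq> S" "pathstart g = a" "pathfinish g = b"
    unfolding path_component_def by blast
  from assms(2) obtain h where h: "path h" "path_image h \<subseteq> T" "pathstart h = c" "pathfinish h = d"
    unfolding path_component_def by blast
  show ?thesis
    unfolding path_component_def
  proof (intro exI conjI)
    show "path (\<lambda>t. g t + h t)"
      using g(1) h(1) unfolding path_def by (intro continuous_intros)
    show "path_image (\<lambda>t. g t + h t) \<subseteq> {u + v |u v. u \<in> S \<and> v \<in> T}"
    proof
      fix w assume "w \<in> path_image (\<lambda>t. g t + h t)"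
      then obtain t where t: "t \<in> {0..1}" "w = g t + h t" by (auto simp: path_image_def)
      moreover have "g t \<in> S" "h t \<in> T" using g(2) h(2) t(1) by (auto simp: path_image_def)
      ultimately show "w \<in> {u + v |u v. u \<in> S \<and> v \<in> T}" by blast
    qed
  qed (use g h in \<open>auto simp: pathstart_def pathfinish_def\<close>)
qed

text \<open>The sign \<open>eps\<close> of the square distinguishes \<open>C\<close> from
  \<open>J\<close>; whatever is uniform in it is proved once.\<close>

locale antiunitary_root =
  fixes A :: "'a::chilbert_space \<Rightarrow> 'a" and eps :: real
  assumes antiunitary: "antiunitary A"
    and A_A [simp]: "A (A x) = eps *\<^sub>R x"
    and eps: "eps = 1 \<or> eps = - 1"
begin

lemma eps_eps [simp]: "eps * eps = 1" "eps * (eps * r) = r"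
  using eps by auto

lemma A_add: "A (x + y) = A x + A y"
  and A_scaleC: "A (c *\<^sub>C x) = cnj c *\<^sub>C A x"
  and cinner_A: "cinner (A x) (A y) = cinner y x"
  using antiunitary unfolding antiunitary_def by auto

lemma A_scaleR: "A (r *\<^sub>R x) = r *\<^sub>R A x"
  by (simp add: scaleR_eq_scaleC A_scaleC)

lemma A_0 [simp]: "A 0 = 0"
  using A_scaleR[of 0 0] by simp

lemma A_minus: "A (- x) = - A x"
  using A_scaleR[of "- 1" x] by simp

lemma A_diff: "A (x - y) = A x - A y"
  using A_add[of x "- y"] by (simp add: A_minus)

lemmas A_linear = A_add A_diff A_minus A_scaleR

lemma inner_A: "inner (A x) (A y) = inner x y"
  by (simp add: inner_eq_Re_cinner cinner_A) (metis cinner_commute cnj.simps(1))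

lemma norm_A [simp]: "norm (A x) = norm x"
  by (simp add: norm_eq_sqrt_inner inner_A)

lemma A_eq_0_iff [simp]: "A x = 0 \<longleftrightarrow> x = 0"
  by (metis norm_A norm_eq_zero)

lemma bounded_linear_A: "bounded_linear A"
  by (rule bounded_linear_intro[of _ 1]) (simp_all add: A_add A_scaleR)

lemma cinner_A_left: "cinner (A x) y = complex_of_real eps * cinner (A y) x"
proof -
  have "y = eps *\<^sub>R A (A y)" by simp
  then have "cinner (A x) y = cinner (A x) (eps *\<^sub>R A (A y))" by (rule arg_cong)
  also have "\<dots> = complex_of_real eps * cinner (A x) (A (A y))"
    by (rule cinner_scaleR_right)
  finally show ?thesis by (simp only: cinner_A)
qed

section \<open>Operators that commute or anti-commute with the anti-unitary\<close>

definition comm :: "'a cop \<Rightarrow> bool"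
  where "comm T \<longleftrightarrow> (\<forall>x. T (A x) = A (T x))"

definition anticomm :: "'a cop \<Rightarrow> bool"
  where "anticomm T \<longleftrightarrow> (\<forall>x. T (A x) = - A (T x))"

lemma commD: "comm T \<Longrightarrow> app T (A x) = A (T x)"
  and anticommD: "anticomm T \<Longrightarrow> app T (A x) = - A (T x)"
  by (simp_all add: comm_def anticomm_def)

lemma comm_0 [simp]: "comm 0" and comm_1 [simp]: "comm 1"
  by (simp_all add: comm_def)

lemma comm_add: "comm S \<Longrightarrow> comm T \<Longrightarrow> comm (S + T)"
  and comm_diff: "comm S \<Longrightarrow> comm T \<Longrightarrow> comm (S - T)"
  and comm_scaleR: "comm S \<Longrightarrow> comm (r *\<^sub>R S)"
  and comm_mult: "comm S \<Longrightarrow> comm T \<Longrightarrow> comm (S * T)"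
  and comm_mult_anti: "anticomm S \<Longrightarrow> anticomm T \<Longrightarrow> comm (S * T)"
  and anticomm_add: "anticomm S \<Longrightarrow> anticomm T \<Longrightarrow> anticomm (S + T)"
  and anticomm_diff: "anticomm S \<Longrightarrow> anticomm T \<Longrightarrow> anticomm (S - T)"
  and anticomm_minus: "anticomm S \<Longrightarrow> anticomm (- S)"
  and anticomm_scaleR: "anticomm S \<Longrightarrow> anticomm (r *\<^sub>R S)"
  and anticomm_mult_left: "comm S \<Longrightarrow> anticomm T \<Longrightarrow> anticomm (S * T)"
  and anticomm_mult_right: "anticomm S \<Longrightarrow> comm T \<Longrightarrow> anticomm (S * T)"
  by (simp_all add: comm_def anticomm_def A_linear)

lemma comm_power: "comm T \<Longrightarrow> comm (T ^ n)"
  by (induction n) (auto intro: comm_mult)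

lemma comm_closed: "closed {T. comm T}" and comm_subspace: "subspace {T. comm T}"
proof -
  have eq: "{T. comm T} = (\<Inter>x. {T. app T (A x) = A (T x)})" by (auto simp: comm_def)
  show "closed {T. comm T}"
    unfolding eq
    by (intro closed_INT ballI closed_Collect_eq continuous_intros
        bounded_linear.continuous_on[OF bounded_linear_A])
qed (simp add: subspace_def comm_add comm_scaleR)

lemma isqrt_compl_comm: "norm X < 1 \<Longrightarrow> comm X \<Longrightarrow> comm (isqrt_compl X)"
  using isqrt_compl_closed[OF _ comm_closed comm_subspace, of X] comm_power by simp

text \<open>Self-adjoint unitaries of the range of \<open>P\<close>, extended by 0. Those of
  orthogonal ranges can then be joined by addition, and if the set is nonempty, \<open>P\<close> is
  a projection commuting with \<open>A\<close>.\<close>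

definition saus :: "'a cop \<Rightarrow> 'a cop set"
  where "saus P = {U. U * U = P \<and> P * U = U \<and> selfadj U \<and> anticomm U}"

lemma sausD:
  assumes "U \<in> saus P"
  shows "U * U = P" "P * U = U" "U * P = U" "selfadj U" "anticomm U" "proj P" "comm P"
    "U * (U * T) = P * T" "P * (U * T) = U * T" "U * (P * T) = U * T" "P * (P * T) = P * T"
proof -
  show U: "U * U = P" "P * U = U" "selfadj U" "anticomm U" using assms by (auto simp: saus_def)
  show UP: "U * P = U" using U(1,2) by (metis mult.assoc)
  show P: "proj P" unfolding proj_def using U UP by (metis mult.assoc selfadj_square)
  show "comm P" using U by (metis comm_mult_anti)
  show "U * (U * T) = P * T" "P * (U * T) = U * T" "U * (P * T) = U * T" "P * (P * T) = P * T"
    using U UP proj_idem(1)[OF P] by (simp_all flip: mult.assoc)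
qed

lemma norm_saus_le:
  assumes U: "U \<in> saus P"
  shows "norm U \<le> 1"
proof (rule norm_cop_bound)
  fix x
  note u = sausD[OF U]
  have "(norm (U x))\<^sup>2 = (norm (P x))\<^sup>2"
    using norm_square_selfadj[OF u(4)] norm_square_selfadj[OF proj_selfadj[OF u(6)]]
    by (simp only: u(1) proj_idem(1)[OF u(6)])
  then show "norm (U x) \<le> 1 * norm x"
    using norm_proj_le[OF u(6), of x] by (simp add: power2_eq_iff_nonneg)
qed simp

lemma sausI: "U * U = P \<Longrightarrow> P * U = U \<Longrightarrow> selfadj U \<Longrightarrow> anticomm U \<Longrightarrow> U \<in> saus P"
  by (simp add: saus_def)

lemma saus_uminus: "U \<in> saus P \<Longrightarrow> - U \<in> saus P"
  by (simp add: saus_def selfadj_minus anticomm_minus)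

lemma saus_add:
  assumes "U \<in> saus P" "V \<in> saus Q" "P * Q = 0"
  shows "U + V \<in> saus (P + Q)"
proof -
  note U = sausD[OF assms(1)] and V = sausD[OF assms(2)]
  have QP: "Q * P = 0"
    using selfadj_mult_swap[of P Q 0] U V assms(3) by (simp add: proj_selfadj)
  have "U * V = U * (P * Q) * V" "V * U = V * (Q * P) * U"
    "P * V = P * Q * V" "Q * U = Q * P * U"
    by (simp_all add: mult.assoc U V)
  then have 0: "U * V = 0" "V * U = 0" "P * V = 0" "Q * U = 0" by (simp_all add: assms(3) QP)
  show ?thesis
    by (rule sausI) (simp_all add: U V 0 algebra_simps selfadj_add anticomm_add)
qed

lemma saus_restrict:
  assumes U: "U \<in> saus P" and Q: "proj Q" "comm Q" "Q * U = U * Q"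
  shows "Q * U \<in> saus (Q * P)"
proof (rule sausI)
  note U' = sausD[OF U]
  have QQU: "Q * (Q * U) = Q * U" using proj_idem(1)[OF Q(1)] by (simp flip: mult.assoc)
  then have QUQ: "Q * (U * Q) = Q * U" by (simp only: Q(3)[symmetric])
  have "(Q * U) * (Q * U) = (Q * (U * Q)) * U" by (simp add: mult.assoc)
  then show "(Q * U) * (Q * U) = Q * P" by (simp add: QUQ mult.assoc U')
  have PQ: "P * Q = Q * P" using Q by (metis U'(1) mult.assoc)
  have "(Q * P) * (Q * U) = Q * ((P * Q) * U)" by (simp add: mult.assoc)
  also have "\<dots> = Q * (Q * U)" by (simp only: PQ mult.assoc U')
  finally show "(Q * P) * (Q * U) = Q * U" by (simp only: QQU)
  show "selfadj (Q * U)" by (rule selfadj_mult[OF proj_selfadj[OF Q(1)] U'(4) Q(3)])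
  show "anticomm (Q * U)" using Q U' by (intro anticomm_mult_left)
qed

text \<open>\<open>U - t (U - V)\<close> squares to \<open>P - t (1 - t) (U - V)\<^sup>2\<close> and commutes with \<open>(U - V)\<^sup>2\<close>, so it can be
  normalised.\<close>

lemma saus_path:
  assumes U: "U \<in> saus P" and V: "V \<in> saus P" and less: "norm (U - V) < 2"
  obtains g :: "real \<Rightarrow> 'a cop"
  where "continuous_on {0..1} g" "g 0 = U" "g 1 = V" "\<And>t. t \<in> {0..1} \<Longrightarrow> g t \<in> saus P"
    "\<And>t. t \<in> {0..1} \<Longrightarrow> compact_cop (U - V) \<Longrightarrow> compact_cop (g t - U)"
    "\<And>S. S * S = 1 \<Longrightarrow> S * U * S = V \<Longrightarrow> S * g (1/2) = g (1/2) * S"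
proof -
  note U' = sausD[OF U] and V' = sausD[OF V]
  define D where "D = U - V"
  define X where "X t = (t * (1 - t)) *\<^sub>R (D * D)" for t
  define W where "W t = U - t *\<^sub>R D" for t
  define g where "g t = W t * isqrt_compl (X t)" for t
  have D: "selfadj D" "anticomm D"
    using U' V' by (simp_all add: D_def selfadj_diff anticomm_diff)
  have PD: "P * D = D" "D * P = D" "P * (D * T) = D * T" for T
    by (simp_all add: D_def U' V' algebra_simps)
  have UD: "U * D + D * U = D * D" by (simp add: D_def U' V' algebra_simps)
  have UD2: "U * (D * D) = (D * D) * U"
    by (simp add: D_def U' V' algebra_simps)
  \<comment> \<open>This is where the bound 2 is needed: \<open>t * (1 - t)\<close> is at most 1/4,
    so \<open>X t\<close> has norm below 1 and the inverse square root of \<open>1 - X t\<close>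
    exists.\<close>
  have n2: "norm (D * D) < 4"
  proof -
    have "norm (D * D) \<le> norm D * norm D" by (rule norm_mult_ineq)
    also have "\<dots> < 2 * 2" using less by (intro mult_strict_mono') (auto simp: D_def)
    finally show ?thesis by simp
  qed
  have t4: "0 \<le> t * (1 - t) \<and> t * (1 - t) \<le> 1/4" if "t \<in> {0..1}" for t :: real
  proof -
    have "0 \<le> (t - 1/2)\<^sup>2" by simp
    also have "(t - 1/2)\<^sup>2 = 1/4 - t * (1 - t)" by (simp add: power2_eq_square algebra_simps)
    finally show ?thesis using that by simp
  qed
  have nX: "norm (X t) \<le> norm (D * D) / 4" if "t \<in> {0..1}" for t
    using t4[OF that] mult_right_mono[of "t * (1 - t)" "1/4" "norm (D * D)"]
    by (simp add: X_def)
  then have nX1: "norm (X t) < 1" if "t \<in> {0..1}" for t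
    using n2 that by fastforce
  have sX: "selfadj (X t)" "comm (X t)" for t
    using D by (simp_all add: X_def selfadj_scaleR selfadj_square comm_scaleR comm_mult_anti)
  have sW: "selfadj (W t)" "anticomm (W t)" for t
    using D U' by (simp_all add: W_def selfadj_intros anticomm_diff anticomm_scaleR)
  have WX: "W t * X t = X t * W t" for t
    using UD2 by (simp add: W_def X_def algebra_simps)
  have WW: "W t * W t = P * (1 - X t)" for t
  proof -
    have "W t * W t = P - t *\<^sub>R (U * D + D * U) + (t * t) *\<^sub>R (D * D)"
      by (simp add: W_def U' algebra_simps)
    also have "\<dots> = P * (1 - X t)"
      unfolding UD by (simp add: X_def PD algebra_simps)
    finally show ?thesis .
  qed
  have cont: "continuous_on {0..1} g"
    unfolding g_def
  proof (rule continuous_on_mult)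
    show "continuous_on {0..1} W" unfolding W_def by (intro continuous_intros)
    show "continuous_on {0..1} (\<lambda>t. isqrt_compl (X t))"
    proof (rule continuous_on_compose2[OF continuous_on_isqrt_compl[of "norm (D * D) / 4"]])
      show "continuous_on {0..1} X" unfolding X_def by (intro continuous_intros)
    qed (use nX n2 in auto)
  qed
  have 0: "isqrt_compl (0 :: 'a cop) = 1"
    using isqrt_compl_expand[of "0 :: 'a cop"] by auto
  have saus: "g t \<in> saus P" if t: "t \<in> {0..1}" for t
  proof -
    let ?I = "isqrt_compl (X t)"
    have WI: "W t * ?I = ?I * W t"
      using isqrt_compl_commute[OF nX1[OF t] WX] .
    have "g t * g t = W t * (?I * W t) * ?I" by (simp add: g_def mult.assoc)
    also have "\<dots> = (W t * W t) * (?I * ?I)" by (simp add: WI[symmetric] mult.assoc)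
    also have "\<dots> = P * ((1 - X t) * (?I * ?I))" by (simp only: WW mult.assoc)
    finally have "g t * g t = P" by (simp only: isqrt_compl_square[OF nX1[OF t]] mult_1_right)
    moreover have "P * W t = W t" by (simp add: W_def algebra_simps U' PD)
    then have "P * g t = g t" by (simp add: g_def flip: mult.assoc)
    moreover have "selfadj (g t)"
      unfolding g_def using WI sW isqrt_compl_selfadj[OF nX1[OF t] sX(1)] by (intro selfadj_mult)
    moreover have "anticomm (g t)"
      unfolding g_def using sW isqrt_compl_comm[OF nX1[OF t] sX(2)] by (intro anticomm_mult_right)
    ultimately show ?thesis by (rule sausI)
  qed
  \<comment> \<open>Every term of \<open>g t - U\<close> contains the factor
    \<open>D\<close>.\<close>
  have comp: "compact_cop (g t - U)" if t: "t \<in> {0..1}" and K: "compact_cop (U - V)" for t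
  proof -
    obtain y where y: "isqrt_compl (X t) = 1 + X t * y"
      using isqrt_compl_expand[OF nX1[OF t]] by blast
    have "g t = W t + W t * (X t * y)" by (simp add: g_def y distrib_left)
    moreover have "W t * (X t * y) = (t * (1 - t)) *\<^sub>R (W t * (D * (D * y)))"
      by (simp add: X_def mult.assoc)
    ultimately have "g t - U = (t * (1 - t)) *\<^sub>R (W t * (D * (D * y))) - t *\<^sub>R D"
      by (simp add: W_def)
    moreover have "compact_cop D" using K by (simp add: D_def)
    ultimately show ?thesis by (simp add: compact_cop_intros)
  qed
  \<comment> \<open>Conjugation by \<open>S\<close> exchanges \<open>U\<close> and \<open>V\<close>.
    It fixes \<open>U + V\<close>, hence \<open>W (1/2)\<close>, and negates \<open>D\<close>, hence
    fixes its square.\<close>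
  have mid: "S * g (1/2) = g (1/2) * S" if S: "S * S = 1" and SUS: "S * U * S = V" for S
  proof -
    have SU: "S * U = V * S"
      unfolding SUS[symmetric] by (simp add: mult.assoc S)
    have SV: "S * V = U * S"
      unfolding SUS[symmetric] using S by (simp flip: mult.assoc)
    have "(1/2) *\<^sub>R U + (1/2) *\<^sub>R U = U" by (simp flip: scaleR_left_distrib)
    then have "W (1/2) = (1/2) *\<^sub>R U + (1/2) *\<^sub>R U - (1/2) *\<^sub>R (U - V)"
      by (simp only: W_def D_def)
    then have W2: "W (1/2) = (1/2) *\<^sub>R (U + V)" by (simp add: algebra_simps)
    have SW: "S * W (1/2) = W (1/2) * S"
      by (simp add: W2 algebra_simps SU SV)
    have SD: "S * D = - (D * S)" by (simp add: D_def algebra_simps SU SV)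
    have "S * (D * D) = (S * D) * D" by (simp add: mult.assoc)
    also have "\<dots> = D * - (S * D)" by (simp add: SD mult.assoc)
    also have "\<dots> = (D * D) * S" by (simp add: SD mult.assoc)
    finally have "S * X (1/2) = X (1/2) * S" by (simp add: X_def)
    then have SI: "S * isqrt_compl (X (1/2)) = isqrt_compl (X (1/2)) * S"
      by (intro isqrt_compl_commute nX1) auto
    have "S * g (1/2) = (S * W (1/2)) * isqrt_compl (X (1/2))" by (simp add: g_def mult.assoc)
    also have "\<dots> = W (1/2) * (S * isqrt_compl (X (1/2)))" by (simp add: SW mult.assoc)
    finally show ?thesis by (simp add: SI g_def mult.assoc)
  qed
  show ?thesis
    by (rule that[OF cont _ _ saus comp mid]) (auto simp: g_def W_def X_def D_def 0)
qed

lemma saus_path_component: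
  assumes "U \<in> saus P" "V \<in> saus P" "norm (U - V) < 2"
  shows "path_component (saus P) U V"
proof (rule saus_path[OF assms])
  fix g :: "real \<Rightarrow> 'a cop"
  assume "continuous_on {0..1} g" "g 0 = U" "g 1 = V" "\<And>t. t \<in> {0..1} \<Longrightarrow> g t \<in> saus P"
  then show ?thesis
    unfolding path_component_def
    by (intro exI[of _ g]) (auto simp: path_def path_image_def pathstart_def pathfinish_def)
qed

text \<open>The cross terms cancel, so the square of \<open>U - V\<close> is
  \<open>P + P\<close>.\<close>

lemma saus_path_component_anticommuting:
  assumes U: "U \<in> saus P" and V: "V \<in> saus P" and "U * V = - (V * U)"
  shows "path_component (saus P) U V"
proof (rule saus_path_component[OF U V norm_less_2I])
  note U' = sausD[OF U] and V' = sausD[OF V]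
  show "selfadj (U - V)" using U' V' by (intro selfadj_diff)
  have "(U - V) * (U - V) = P + P"
    using assms(3) U' V' by (simp add: algebra_simps)
  then show "inner (((U - V) * (U - V)) x) x \<le> 2 * (norm x)\<^sup>2" for x
    using norm_cauchy_schwarz[of "P x" x] norm_proj_le[OF U'(6), of x]
      mult_right_mono[of "norm (app P x)" "norm x" "norm x"]
    by (simp add: inner_add_left power2_eq_square)
qed

lemma saus_path_component_add:
  assumes PQ: "P * Q = 0" and U: "path_component (saus P) U U'" and V: "path_component (saus Q) V V'"
  shows "path_component (saus (P + Q)) (U + V) (U' + V')"
proof (rule path_component_of_subset[OF _ path_component_sum_set[OF U V]])
  show "{u + v |u v. u \<in> saus P \<and> v \<in> saus Q} \<subseteq> saus (P + Q)"
    using saus_add[OF _ _ PQ] by auto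
qed

end

section \<open>Orthonormal sequences and projections\<close>

text \<open>Zero entries are allowed, so that finite orthonormal sets are covered too.\<close>

definition onseq :: "(nat \<Rightarrow> 'a::complex_inner) \<Rightarrow> bool"
  where "onseq e \<longleftrightarrow> (\<forall>m n. m \<noteq> n \<longrightarrow> cinner (e m) (e n) = 0) \<and> (\<forall>n. e n = 0 \<or> norm (e n) = 1)"

lemma onseq_cinner: "onseq e \<Longrightarrow> cinner (e m) (e n) = (if m = n \<and> e n \<noteq> 0 then 1 else 0)"
  by (auto simp: onseq_def cinner_self)

lemma onseq_norm_sum:
  assumes "onseq e" "finite I"
  shows "(norm (\<Sum>n\<in>I. c n *\<^sub>C e n))\<^sup>2 \<le> (\<Sum>n\<in>I. (cmod (c n))\<^sup>2)"
proof -
  have "complex_of_real ((norm (\<Sum>n\<in>I. c n *\<^sub>C e n))\<^sup>2)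
      = (\<Sum>n\<in>I. \<Sum>m\<in>I. cnj (c m) * c n * cinner (e m) (e n))"
    unfolding cinner_self[symmetric]
    by (simp add: cinner_sum_left cinner_sum_right cinner_scaleC_left cinner_scaleC_right mult_ac
        sum_distrib_left)
  also have "\<dots> = (\<Sum>n\<in>I. if e n = 0 then 0 else complex_of_real ((cmod (c n))\<^sup>2))"
    using assms(2)
    by (intro sum.cong refl) (simp add: onseq_cinner[OF assms(1)] complex_norm_square[symmetric] mult_ac
        if_distrib[of "\<lambda>x. _ * x"] conj_commute[of "_ = _"] mult.commute[of "cnj _"] cong: if_cong)
  also have "\<dots> = complex_of_real (\<Sum>n\<in>I. if e n = 0 then 0 else (cmod (c n))\<^sup>2)"
    by (simp add: if_distrib[of complex_of_real] cong: if_cong)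
  finally have "(norm (\<Sum>n\<in>I. c n *\<^sub>C e n))\<^sup>2 = (\<Sum>n\<in>I. if e n = 0 then 0 else (cmod (c n))\<^sup>2)"
    unfolding of_real_eq_iff .
  also have "\<dots> \<le> (\<Sum>n\<in>I. (cmod (c n))\<^sup>2)" by (intro sum_mono) auto
  finally show ?thesis .
qed

lemma bessel:
  assumes "onseq e" "finite I"
  shows "(\<Sum>n\<in>I. (cmod (cinner (e n) x))\<^sup>2) \<le> (norm x)\<^sup>2"
proof -
  define s where "s = (\<Sum>n\<in>I. cinner (e n) x *\<^sub>C e n)"
  define b where "b = (\<Sum>n\<in>I. (cmod (cinner (e n) x))\<^sup>2)"
  have "cinner s x = complex_of_real b"
    by (simp add: s_def b_def cinner_sum_left cinner_scaleC_left complex_norm_square mult.commute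
        flip: of_real_power)
  then have "inner s x = b" by (simp add: inner_eq_Re_cinner)
  moreover have "(norm s)\<^sup>2 \<le> b" unfolding s_def b_def by (rule onseq_norm_sum[OF assms])
  moreover have "0 \<le> (norm (x - s))\<^sup>2" by simp
  ultimately show ?thesis
    unfolding b_def[symmetric]
    by (simp add: power2_norm_eq_inner inner_diff_left inner_diff_right inner_commute)
qed

lemma onseq_summable:
  fixes f :: "nat \<Rightarrow> 'a::chilbert_space"
  assumes e: "onseq e" and f: "onseq f"
  shows "summable (\<lambda>n. cinner (e n) x *\<^sub>C f n)"
  unfolding summable_Cauchy
proof (intro allI impI)
  fix d :: real assume d: "d > 0"
  have "summable (\<lambda>n. (cmod (cinner (e n) x))\<^sup>2)"
    by (rule bounded_imp_summable[of _ "(norm x)\<^sup>2"]) (auto intro: bessel[OF e])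
  then obtain N where N: "\<And>m n. m \<ge> N \<Longrightarrow> norm (\<Sum>n=m..<n. (cmod (cinner (e n) x))\<^sup>2) < d\<^sup>2"
    using d unfolding summable_Cauchy by (metis zero_less_power)
  show "\<exists>N. \<forall>m\<ge>N. \<forall>n. norm (\<Sum>n=m..<n. cinner (e n) x *\<^sub>C f n) < d"
  proof (intro exI allI impI)
    fix m n assume "m \<ge> N"
    have "(norm (\<Sum>n=m..<n. cinner (e n) x *\<^sub>C f n))\<^sup>2 \<le> (\<Sum>n=m..<n. (cmod (cinner (e n) x))\<^sup>2)"
      by (rule onseq_norm_sum[OF f]) simp
    also have "\<dots> < d\<^sup>2" using N[OF \<open>m \<ge> N\<close>, of n] by (simp add: sum_nonneg)
    finally show "norm (\<Sum>n=m..<n. cinner (e n) x *\<^sub>C f n) < d"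
      using d by (simp add: power2_less_imp_less)
  qed
qed

text \<open>For orthonormal sequences without zero entries, the partial isometry that takes
  \<open>e n\<close> to \<open>f n\<close> and vanishes on the orthogonal complement of all
  \<open>e n\<close>. With \<open>f = e\<close> it is the projection onto the closed span.\<close>

definition transfer_op :: "(nat \<Rightarrow> 'a::chilbert_space) \<Rightarrow> (nat \<Rightarrow> 'a) \<Rightarrow> 'a cop"
  where "transfer_op e f = cop_of_blinfun (Blinfun (\<lambda>x. \<Sum>n. cinner (e n) x *\<^sub>C f n))"

lemma transfer_op_sums:
  assumes e: "onseq e" and f: "onseq f"
  shows "(\<lambda>n. cinner (e n) x *\<^sub>C f n) sums transfer_op e f x"
proof -
  note s = onseq_summable[OF e f]
  let ?T = "\<lambda>x. \<Sum>n. cinner (e n) x *\<^sub>C f n"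
  have C: "?T (c *\<^sub>C x) = c *\<^sub>C ?T x" for c x
    using bounded_linear.suminf[OF bounded_bilinear.bounded_linear_right[OF bounded_bilinear_scaleC] s, of c x]
    by (simp add: cinner_scaleC_right scaleC_scaleC)
  have "bounded_linear ?T"
  proof (rule bounded_linear_intro[of _ 1])
    show "?T (x + y) = ?T x + ?T y" for x y
      using suminf_add[OF s s, of x y] by (simp add: cinner_add_right scaleC_add_left)
    show "?T (r *\<^sub>R x) = r *\<^sub>R ?T x" for r x
      using C[of "complex_of_real r" x] by (simp add: scaleR_eq_scaleC[where 'a='a])
    show "norm (?T x) \<le> norm x * 1" for x
    proof (rule LIMSEQ_le_const2[OF tendsto_norm[OF summable_LIMSEQ[OF s]]])
      have "norm (\<Sum>i<n. cinner (e i) x *\<^sub>C f i) \<le> norm x" for n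
        by (rule power2_le_imp_le[OF order_trans[OF onseq_norm_sum[OF f] bessel[OF e]]]) auto
      then show "\<exists>N. \<forall>n\<ge>N. norm (\<Sum>i<n. cinner (e i) x *\<^sub>C f i) \<le> norm x * 1" by simp
    qed
  qed
  then have "transfer_op e f x = ?T x"
    unfolding transfer_op_def using C
    by (simp add: app.rep_eq cop_of_blinfun_inverse bounded_ops_def bounded_linear_Blinfun_apply)
  then show ?thesis using s by (simp add: summable_sums)
qed

lemma cinner_transfer_op:
  assumes e: "onseq e" and f: "onseq f"
  shows "cinner (transfer_op e f x) y = cinner x (transfer_op f e y)"
proof (rule sums_unique2)
  have "(\<lambda>n. cinner (cinner (e n) x *\<^sub>C f n) y) sums cinner (transfer_op e f x) y"
    by (rule bounded_linear.sums[OF bounded_bilinear.bounded_linear_left[OF bounded_bilinear_cinner]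
          transfer_op_sums[OF e f]])
  then show "(\<lambda>n. cinner x (e n) * cinner (f n) y) sums cinner (transfer_op e f x) y"
    by (simp add: cinner_scaleC_left cinner_commute[of x])
  have "(\<lambda>n. cinner x (cinner (f n) y *\<^sub>C e n)) sums cinner x (transfer_op f e y)"
    by (rule bounded_linear.sums[OF bounded_bilinear.bounded_linear_right[OF bounded_bilinear_cinner]
          transfer_op_sums[OF f e]])
  then show "(\<lambda>n. cinner x (e n) * cinner (f n) y) sums cinner x (transfer_op f e y)"
    by (simp add: cinner_scaleC_right mult.commute)
qed

lemma cinner_transfer_op_right:
  assumes e: "onseq e" and f: "onseq f"
  shows "(\<lambda>n. cinner (e n) x * cinner y (f n)) sums cinner y (transfer_op e f x)"
  using bounded_linear.sums[OF bounded_bilinear.bounded_linear_right[OF bounded_bilinear_cinner]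
      transfer_op_sums[OF e f], of y x] by (simp add: cinner_scaleC_right)

lemma cinner_transfer_op_basis:
  assumes e: "onseq e" and f: "onseq f"
  shows "cinner (f m) (transfer_op e f x) = (if f m = 0 then 0 else cinner (e m) x)"
proof (rule sums_unique2[OF cinner_transfer_op_right[OF e f]])
  show "(\<lambda>n. cinner (e n) x * cinner (f m) (f n)) sums (if f m = 0 then 0 else cinner (e m) x)"
    by (rule back_subst[of "\<lambda>g. g sums _",
          OF sums_single[of m "\<lambda>n. if f n = 0 then 0 else cinner (e n) x"]])
      (auto simp: onseq_cinner[OF f] fun_eq_iff)
qed

lemma cinner_transfer_op_orth:
  assumes e: "onseq e" and f: "onseq f" and "\<And>n. cinner y (f n) = 0"
  shows "cinner y (transfer_op e f x) = 0"
  using sums_unique2[OF cinner_transfer_op_right[OF e f]] assms(3) by fastforce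

lemma transfer_op_eqI:
  assumes "onseq e" "onseq f" "(\<lambda>n. cinner (e n) x *\<^sub>C f n) sums y"
  shows "transfer_op e f x = y"
  using sums_unique2[OF transfer_op_sums[OF assms(1,2)] assms(3)] .

text \<open>A zero entry \<open>f n\<close> loses the coefficient along \<open>e n\<close>, unless
  \<open>e n\<close> is zero as well.\<close>

lemma transfer_op_mult:
  assumes e: "onseq e" and f: "onseq f" and g: "onseq g" and "\<And>n. f n = 0 \<Longrightarrow> e n = 0"
  shows "transfer_op f g * transfer_op e f = transfer_op e g"
proof (rule cop_eqI)
  fix x
  have "cinner (f n) (transfer_op e f x) = cinner (e n) x" for n
    using assms(4)[of n] by (auto simp: cinner_transfer_op_basis[OF e f])
  with transfer_op_sums[OF e g, of x] show "(transfer_op f g * transfer_op e f) x = transfer_op e g x"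
    by (simp add: transfer_op_eqI[OF f g])
qed

lemma transfer_op_mult_orth:
  assumes e: "onseq e" and f: "onseq f" and g: "onseq g" and h: "onseq h"
    and "\<And>m n. cinner (g m) (f n) = 0"
  shows "transfer_op g h * transfer_op e f = 0"
proof (rule cop_eqI)
  fix x
  have "cinner (g n) (transfer_op e f x) = 0" for n
    using assms(5) by (rule cinner_transfer_op_orth[OF e f])
  then show "(transfer_op g h * transfer_op e f) x = app 0 x"
    by (simp add: transfer_op_eqI[OF g h])
qed

lemma proj_transfer_op: "onseq e \<Longrightarrow> proj (transfer_op e e)"
  by (simp add: proj_def transfer_op_mult selfadj_iff_cinner cinner_transfer_op)

lemma transfer_op_left:
  assumes e: "onseq e" and f: "onseq f" and "\<And>n. app T (f n) = r *\<^sub>R f n"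
  shows "T * transfer_op e f = r *\<^sub>R transfer_op e f"
proof (rule cop_eqI)
  fix x
  have "(\<lambda>n. app T (cinner (e n) x *\<^sub>C f n)) sums T (transfer_op e f x)"
    by (rule bounded_linear.sums[OF bounded_bilinear.bounded_linear_right[OF bounded_bilinear_app]
          transfer_op_sums[OF e f]])
  moreover have "(\<lambda>n. r *\<^sub>R (cinner (e n) x *\<^sub>C f n)) sums (r *\<^sub>R app (transfer_op e f) x)"
    by (rule sums_scaleR_right[OF transfer_op_sums[OF e f]])
  ultimately show "(T * transfer_op e f) x = (r *\<^sub>R transfer_op e f) x"
    using assms(3) by (simp add: scaleC_scaleR_commute sums_unique2)
qed

lemma transfer_op_right:
  assumes e: "onseq e" and f: "onseq f" and "selfadj T" "\<And>n. app T (e n) = r *\<^sub>R e n"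
  shows "transfer_op e f * T = r *\<^sub>R transfer_op e f"
proof (rule cop_eqI)
  fix x
  have "cinner (e n) (T x) = of_real r * cinner (e n) x" for n
    using selfadj_cinnerD[OF assms(3), of "e n" x] by (simp add: assms(4) cinner_scaleR_left)
  moreover have "(\<lambda>n. r *\<^sub>R (cinner (e n) x *\<^sub>C f n)) sums (r *\<^sub>R app (transfer_op e f) x)"
    by (rule sums_scaleR_right[OF transfer_op_sums[OF e f]])
  ultimately show "(transfer_op e f * T) x = (r *\<^sub>R transfer_op e f) x"
    by (simp add: transfer_op_eqI[OF e f] scaleR_eq_scaleC scaleC_scaleC)
qed

section \<open>Complete orthonormal sets\<close>

definition orthonormal :: "'a::complex_inner set \<Rightarrow> bool"
  where "orthonormal B \<longleftrightarrow> (\<forall>b\<in>B. norm b = 1) \<and> pairwise (\<lambda>x y. cinner x y = 0) B"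

text \<open>Zorn's lemma for an arbitrary relation: besides orthogonality it serves the relation
  that \<open>y\<close> is orthogonal to both \<open>x\<close> and \<open>A x\<close>.\<close>

lemma maximal_pairwise:
  obtains B where "B \<subseteq> K" "pairwise R B" "\<forall>x\<in>K. (\<forall>b\<in>B. R x b \<and> R b x) \<longrightarrow> x \<in> B"
proof -
  define F where "F = {B. B \<subseteq> K \<and> pairwise R B}"
  have "\<exists>M\<in>F. \<forall>X\<in>F. M \<subseteq> X \<longrightarrow> X = M"
  proof (rule subset_Zorn')
    fix c assume c: "subset.chain F c"
    then have cF: "c \<subseteq> F" and ch: "\<And>X Y. X \<in> c \<Longrightarrow> Y \<in> c \<Longrightarrow> X \<subseteq> Y \<or> Y \<subseteq> X"
      by (auto simp: subset_chain_def)
    have "pairwise R (\<Union>c)"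
    proof (rule pairwiseI)
      fix x y assume "x \<in> \<Union>c" "y \<in> \<Union>c" "x \<noteq> y"
      then obtain X Y where XY: "X \<in> c" "x \<in> X" "Y \<in> c" "y \<in> Y" by blast
      then have "\<exists>Z\<in>c. x \<in> Z \<and> y \<in> Z" using ch[OF XY(1,3)] by blast
      then show "R x y" using cF \<open>x \<noteq> y\<close> by (auto simp: F_def pairwise_def)
    qed
    then show "\<Union>c \<in> F" using cF by (auto simp: F_def)
  qed
  then obtain B where B: "B \<in> F" "\<And>X. X \<in> F \<Longrightarrow> B \<subseteq> X \<Longrightarrow> X = B" by blast
  show thesis
  proof (rule that[of B])
    show "B \<subseteq> K" "pairwise R B" using B(1) by (auto simp: F_def)
    show "\<forall>x\<in>K. (\<forall>b\<in>B. R x b \<and> R b x) \<longrightarrow> x \<in> B"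
    proof (intro ballI impI)
      fix x assume "x \<in> K" "\<forall>b\<in>B. R x b \<and> R b x"
      then have "insert x B \<in> F" using B(1) by (auto simp: F_def pairwise_insert)
      then show "x \<in> B" using B(2) by blast
    qed
  qed
qed

lemma orthonormal_dist:
  assumes "orthonormal B" "x \<in> B" "y \<in> B" "x \<noteq> y"
  shows "1 \<le> dist x y"
proof -
  have "inner x y = 0" "inner x x = 1" "inner y y = 1"
    using assms by (auto simp: orthonormal_def pairwise_def inner_eq_Re_cinner cinner_self)
  then have "1 \<le> (dist x y)\<^sup>2"
    by (simp add: dist_norm power2_norm_eq_inner inner_diff_left inner_diff_right inner_commute)
  then show ?thesis
    by (metis one_power2 power2_le_imp_le zero_le_dist)
qed

text \<open>Distinct elements are at least 1 apart, so points of a countable dense set chosen within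
  1/2 of them are distinct too.\<close>

lemma countable_orthonormal:
  assumes sep: "separable_space (euclidean :: 'a::complex_inner topology)" and B: "orthonormal (B :: 'a set)"
  shows "countable B"
proof -
  obtain D :: "'a set" where D: "countable D" "closure D = UNIV"
    using sep by (auto simp: separable_space_def)
  have "\<exists>d\<in>D. dist d b < 1/2" for b
    using closure_approachable[of b D] D(2) by (metis UNIV_I half_gt_zero_iff zero_less_one)
  then obtain d where d: "\<And>b. d b \<in> D" "\<And>b. dist (d b) b < 1/2" by metis
  have "inj_on d B"
  proof (rule inj_onI, rule ccontr)
    fix x y assume xy: "x \<in> B" "y \<in> B" "d x = d y" "x \<noteq> y"
    have "dist x y \<le> dist (d x) x + dist (d y) y"
      using xy(3) dist_triangle3[of x y "d x"] by simp
    also have "\<dots> < 1" using d(2)[of x] d(2)[of y] by simp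
    finally show False using orthonormal_dist[OF B xy(1,2,4)] by simp
  qed
  moreover have "countable (d ` B)"
    using D(1) d(1) by (meson countable_subset image_subsetI)
  ultimately show ?thesis by (rule countable_image_inj_on[rotated])
qed

lemma onseq_enumerate:
  assumes "countable B" "orthonormal B"
  obtains e where "onseq e" "B \<subseteq> range e" "range e \<subseteq> insert 0 B"
proof -
  define e where "e n = (if n \<in> to_nat_on B ` B then from_nat_into B n else 0)" for n
  have e: "e n = 0 \<or> e n \<in> B \<and> n = to_nat_on B (e n)" for n
    using assms(1) by (auto simp: e_def)
  show thesis
  proof (rule that[of e])
    show "onseq e"
      unfolding onseq_def
    proof (intro conjI allI impI)
      show "e n = 0 \<or> norm (e n) = 1" for n using e[of n] assms(2) by (auto simp: orthonormal_def)
      show "cinner (e m) (e n) = 0" if "m \<noteq> n" for m n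
        using e[of m] e[of n] that assms(2) unfolding orthonormal_def pairwise_def
        by (metis cinner_zero_left cinner_zero_right)
    qed
    show "B \<subseteq> range e"
    proof
      fix b assume "b \<in> B"
      then have "e (to_nat_on B b) = b" using assms(1) by (simp add: e_def)
      then show "b \<in> range e" by (metis rangeI)
    qed
    show "range e \<subseteq> insert 0 B" using e by auto
  qed
qed

lemma onseq_enumerate_infinite:
  assumes "countable B" "infinite B" "orthonormal B"
  obtains e where "onseq e" "range e = B" "\<forall>n. norm (e n) = 1"
proof (rule that[of "from_nat_into B"])
  have bij: "bij_betw (from_nat_into B) UNIV B"
    using assms by (rule_tac bij_betw_from_nat_into)
  then show "range (from_nat_into B) = B" by (simp add: bij_betw_def)
  then show "\<forall>n. norm (from_nat_into B n) = 1"
    using assms(3) by (auto simp: orthonormal_def)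
  moreover have "cinner (from_nat_into B m) (from_nat_into B n) = 0" if "m \<noteq> n" for m n
  proof -
    have "from_nat_into B m \<in> B" "from_nat_into B n \<in> B"
      using assms(2) by (auto intro: from_nat_into)
    moreover have "from_nat_into B m \<noteq> from_nat_into B n"
      using bij that by (auto simp: bij_betw_def inj_on_def)
    ultimately show ?thesis using assms(3) by (simp add: orthonormal_def pairwise_def)
  qed
  ultimately show "onseq (from_nat_into B)" by (simp add: onseq_def)
qed

definition complete_in :: "'a::complex_inner set \<Rightarrow> 'a set \<Rightarrow> bool"
  where "complete_in B E \<longleftrightarrow> (\<forall>x\<in>E. (\<forall>b\<in>B. cinner b x = 0) \<longrightarrow> x = 0)"

lemma complete_inD: "complete_in B E \<Longrightarrow> x \<in> E \<Longrightarrow> (\<And>b. b \<in> B \<Longrightarrow> cinner b x = 0) \<Longrightarrow> x = 0"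
  by (simp add: complete_in_def)

text \<open>A finite complete \<open>B\<close> would span \<open>E\<close>, since \<open>x\<close>
  minus its finite Fourier sum is orthogonal to \<open>B\<close>.\<close>

lemma complete_orthonormal_infinite:
  assumes E: "complex_vector.subspace E" "\<not> cfinite_dim E" and B: "orthonormal B" "B \<subseteq> E" "complete_in B E"
  shows "infinite B"
proof
  assume fin: "finite B"
  have "E \<subseteq> cspan B"
  proof
    fix x assume x: "x \<in> E"
    define s where "s = (\<Sum>b\<in>B. cinner b x *\<^sub>C b)"
    have sB: "s \<in> cspan B"
      unfolding s_def by (intro complex_vector.span_sum complex_vector.span_scale complex_vector.span_base)
    have "s \<in> E"
      unfolding s_def using E B(2) by (intro complex_vector.subspace_sum complex_vector.subspace_scale) auto
    then have "x - s \<in> E" using E x by (simp add: complex_vector.subspace_diff)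
    moreover have "cinner b (x - s) = 0" if "b \<in> B" for b
    proof -
      have "cinner b s = (\<Sum>c\<in>B. if c = b then cinner b x else 0)"
        unfolding s_def cinner_sum_right cinner_scaleC_right
        using B(1) that by (intro sum.cong) (auto simp: orthonormal_def pairwise_def cinner_self)
      then show ?thesis using fin that by (simp add: cinner_diff_right)
    qed
    ultimately have "x - s = 0" by (rule complete_inD[OF B(3)])
    then show "x \<in> cspan B" using sB by simp
  qed
  then show False using E(2) fin by (auto simp: cfinite_dim_def)
qed

lemma exists_complete_orthonormal:
  assumes "complex_vector.subspace E"
  obtains B where "orthonormal B" "B \<subseteq> E" "complete_in B E"
proof -
  obtain B where B: "B \<subseteq> {x\<in>E. norm x = 1}" "pairwise (\<lambda>x y. cinner x y = 0) B"
    and max: "\<forall>x\<in>{x\<in>E. norm x = 1}. (\<forall>b\<in>B. cinner x b = 0 \<and> cinner b x = 0) \<longrightarrow> x \<in> B"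
    using maximal_pairwise[of "{x\<in>E. norm x = 1}" "\<lambda>x y. cinner x y = 0"] .
  show thesis
  proof (rule that[of B])
    show "orthonormal B" "B \<subseteq> E" using B by (auto simp: orthonormal_def)
    show "complete_in B E"
      unfolding complete_in_def
    proof (intro ballI impI, rule ccontr)
      fix x assume x: "x \<in> E" "\<forall>b\<in>B. cinner b x = 0" "x \<noteq> 0"
      define y where "y = (1 / norm x) *\<^sub>R x"
      have y: "norm y = 1" "y \<in> E"
        using x assms complex_vector.subspace_scale[OF assms x(1), of "complex_of_real (1 / norm x)"]
        by (simp add: y_def, simp add: y_def scaleR_eq_scaleC[where 'a='a])
      have "\<forall>b\<in>B. cinner b y = 0" using x(2) by (simp add: y_def cinner_scaleR_right)
      with y max have "y \<in> B" by (auto simp: cinner_eq_0_commute)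
      with \<open>\<forall>b\<in>B. cinner b y = 0\<close> have "cinner y y = 0" by blast
      with y show False by (simp add: cinner_self)
    qed
  qed
qed

text \<open>Fourier expansion along a complete orthonormal set of \<open>E\<close>: closedness keeps
  the limits in \<open>E\<close>, and completeness makes the expansion reproduce the elements of
  \<open>E\<close>.\<close>

lemma exists_proj_onto:
  assumes sep: "separable_space (euclidean :: 'a::chilbert_space topology)"
    and E: "closed (E :: 'a set)" "complex_vector.subspace E"
  obtains Q where "proj Q" "\<And>x. app Q x = x \<longleftrightarrow> x \<in> E"
proof -
  obtain B where B: "orthonormal B" "B \<subseteq> E" "complete_in B E"
    using exists_complete_orthonormal[OF E(2)] .
  obtain e where e: "onseq e" "B \<subseteq> range e" "range e \<subseteq> insert 0 B"
    using onseq_enumerate[OF countable_orthonormal[OF sep B(1)] B(1)] .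
  define Q where "Q = transfer_op e e"
  have eE: "e n \<in> E" for n 
  proof -
    have "e n \<in> insert 0 B" using e(3) by auto
    then show ?thesis using B(2) complex_vector.subspace_0[OF E(2)] by auto
  qed
  have QE: "Q x \<in> E" for x
  proof (rule closed_sequentially[OF E(1)])
    show "(\<lambda>N. \<Sum>n<N. cinner (e n) x *\<^sub>C e n) \<longlonglongrightarrow> Q x"
      using transfer_op_sums[OF e(1) e(1)] by (simp add: sums_def Q_def)
    show "(\<Sum>n<N. cinner (e n) x *\<^sub>C e n) \<in> E" for N
      using E(2) eE by (intro complex_vector.subspace_sum complex_vector.subspace_scale) auto
  qed
  show thesis
  proof (rule that[of Q])
    show "proj Q" using e(1) by (simp add: Q_def proj_transfer_op)
    show "app Q x = x \<longleftrightarrow> x \<in> E" for x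
    proof
      assume x: "x \<in> E"
      have "x - Q x = 0"
      proof (rule complete_inD[OF B(3)])
        show "x - Q x \<in> E" using E(2) x QE by (simp add: complex_vector.subspace_diff)
        fix b assume "b \<in> B"
        then obtain n where "b = e n" using e(2) by blast
        then show "cinner b (x - Q x) = 0"
          by (auto simp: cinner_diff_right Q_def cinner_transfer_op_basis[OF e(1) e(1)])
      qed
      then show "Q x = x" by simp
    qed (use QE[of x] in simp)
  qed
qed

lemma exists_infinite_onseq:
  assumes sep: "separable_space (euclidean :: 'a::chilbert_space topology)"
    and B: "orthonormal B" "B \<subseteq> E" "complete_in B E"
    and E: "complex_vector.subspace (E :: 'a set)" "\<not> cfinite_dim E"
  obtains e where "onseq e" "range e = B" "\<forall>n. norm (e n) = 1"
  using onseq_enumerate_infinite[OF countable_orthonormal[OF sep B(1)]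
      complete_orthonormal_infinite[OF E B] B(1)] .

lemma subspace_fixed: "complex_vector.subspace {x. app T x = x}"
  by (simp add: complex_vector.subspace_def)

lemma closed_kernel: "closed {x. app T x = 0}" for T :: "'a::complex_inner cop"
  by (intro closed_Collect_eq continuous_intros)

lemma subspace_kernel: "complex_vector.subspace {x. app T x = 0}"
  by (simp add: complex_vector.subspace_def)

text \<open>An infinite orthonormal sequence of fixed vectors is its own image under
  \<open>K\<close>, but it has no Cauchy subsequence.\<close>

lemma compact_fixed_finite_dim:
  fixes K :: "'a::chilbert_space cop"
  assumes sep: "separable_space (euclidean :: 'a topology)" and K: "compact_cop K"
  shows "cfinite_dim {x. K x = x}"
proof (rule ccontr)
  assume inf: "\<not> ?thesis"
  obtain B where B: "orthonormal B" "B \<subseteq> {x. K x = x}" "complete_in B {x. K x = x}"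
    using exists_complete_orthonormal[OF subspace_fixed] .
  obtain e where e: "onseq e" "range e = B" "\<forall>n. norm (e n) = 1"
    using exists_infinite_onseq[OF sep B subspace_fixed inf] .
  have "bounded (range e)" using e(3) by (auto simp: bounded_iff)
  then obtain l r where r: "strict_mono r" "(\<lambda>n. app K (e (r n))) \<longlonglongrightarrow> l"
    by (rule compact_copE[OF K])
  have "K (e n) = e n" for n using B(2) e(2) by blast
  then have "Cauchy (\<lambda>n. e (r n))" using r(2) LIMSEQ_imp_Cauchy by simp
  then obtain N where N: "\<And>m n. m \<ge> N \<Longrightarrow> n \<ge> N \<Longrightarrow> dist (e (r m)) (e (r n)) < 1"
    unfolding Cauchy_def by (metis zero_less_one)
  have ne: "r N \<noteq> r (Suc N)" using r(1) by (metis lessI less_irrefl strict_mono_less)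
  then have "cinner (e (r N)) (e (r (Suc N))) = 0" using e(1) by (simp add: onseq_def)
  then have "e (r N) \<noteq> e (r (Suc N))" using e(3) by (auto simp: cinner_self)
  then have "1 \<le> dist (e (r N)) (e (r (Suc N)))"
    using e(2) by (intro orthonormal_dist[OF B(1)]) auto
  then show False using N[of N "Suc N"] by simp
qed

section \<open>Self-adjoint unitaries on an infinite-dimensional range form a path-connected space\<close>

lemma onseq_subseq: "onseq e \<Longrightarrow> inj h \<Longrightarrow> onseq (\<lambda>n. e (h n))"
  by (auto simp: onseq_def inj_def)

text \<open>For mutually orthogonal sequences of unit vectors, the self-adjoint exchange of
  \<open>e n\<close> with \<open>f n\<close>.\<close>

definition swap_op :: "(nat \<Rightarrow> 'a::chilbert_space) \<Rightarrow> (nat \<Rightarrow> 'a) \<Rightarrow> 'a cop"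
  where "swap_op e f = transfer_op e f + transfer_op f e"

lemma selfadj_swap_op: "onseq e \<Longrightarrow> onseq f \<Longrightarrow> selfadj (swap_op e f)"
  by (simp add: swap_op_def selfadj_iff_cinner cinner_transfer_op cinner_add_left cinner_add_right)

lemma swap_op_square:
  assumes "onseq e" "onseq f" "\<And>n. e n \<noteq> 0" "\<And>n. f n \<noteq> 0" "\<And>m n. cinner (e m) (f n) = 0"
  shows "swap_op e f * swap_op e f = transfer_op e e + transfer_op f f"
proof -
  have "\<And>m n. cinner (f m) (e n) = 0" using assms(5) by (simp add: cinner_eq_0_commute)
  with assms show ?thesis
    using transfer_op_mult[of e f e] transfer_op_mult[of f e f]
    by (simp add: swap_op_def distrib_left distrib_right transfer_op_mult_orth)
qed

lemma swap_op_mult_orth: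
  assumes "onseq e" "onseq f" "onseq g" "onseq h"
    "\<And>m n. cinner (g m) (e n) = 0" "\<And>m n. cinner (g m) (f n) = 0"
    "\<And>m n. cinner (h m) (e n) = 0" "\<And>m n. cinner (h m) (f n) = 0"
  shows "swap_op g h * swap_op e f = 0"
  using assms by (simp add: swap_op_def distrib_left distrib_right transfer_op_mult_orth)

lemma swap_op_left:
  assumes "onseq e" "onseq f" "\<And>n. app T (e n) = r *\<^sub>R e n" "\<And>n. app T (f n) = s *\<^sub>R f n"
  shows "T * swap_op e f = s *\<^sub>R transfer_op e f + r *\<^sub>R transfer_op f e"
  using assms by (simp add: swap_op_def distrib_left transfer_op_left[of e f T s] transfer_op_left[of f e T r])

lemma swap_op_right:
  assumes "onseq e" "onseq f" "selfadj T" "\<And>n. app T (e n) = r *\<^sub>R e n" "\<And>n. app T (f n) = s *\<^sub>R f n"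
  shows "swap_op e f * T = r *\<^sub>R transfer_op e f + s *\<^sub>R transfer_op f e"
  using assms by (simp add: swap_op_def distrib_right transfer_op_right[of e f T r] transfer_op_right[of f e T s])

lemma transfer_op_scale:
  assumes "onseq e" "onseq f" "\<bar>r\<bar> = 1" "\<bar>s\<bar> = 1"
  shows "transfer_op (\<lambda>n. r *\<^sub>R e n) (\<lambda>n. s *\<^sub>R f n) = (r * s) *\<^sub>R transfer_op e f"
proof (rule cop_eqI)
  fix x
  have *: "onseq (\<lambda>n. r *\<^sub>R e n)" "onseq (\<lambda>n. s *\<^sub>R f n)"
    using assms by (auto simp: onseq_def cinner_scaleR_left cinner_scaleR_right)
  have "(\<lambda>n. (r * s) *\<^sub>R (cinner (e n) x *\<^sub>C f n)) sums ((r * s) *\<^sub>R app (transfer_op e f) x)"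
    by (rule sums_scaleR_right[OF transfer_op_sums[OF assms(1,2)]])
  moreover have "cinner (r *\<^sub>R e n) x *\<^sub>C s *\<^sub>R f n = (r * s) *\<^sub>R (cinner (e n) x *\<^sub>C f n)" for n
    by (simp add: cinner_scaleC_left scaleR_eq_scaleC[where 'a='a] scaleC_scaleC mult_ac)
  ultimately have "(\<lambda>n. cinner (r *\<^sub>R e n) x *\<^sub>C s *\<^sub>R f n) sums ((r * s) *\<^sub>R app (transfer_op e f) x)"
    by (simp only:)
  from transfer_op_eqI[OF * this]
  show "transfer_op (\<lambda>n. r *\<^sub>R e n) (\<lambda>n. s *\<^sub>R f n) x = ((r * s) *\<^sub>R transfer_op e f) x"
    by simp
qed

lemma cfinite_dim_subset: "cfinite_dim T \<Longrightarrow> S \<subseteq> T \<Longrightarrow> cfinite_dim S"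
  by (auto simp: cfinite_dim_def)

lemma cfinite_dim_sum:
  assumes "cfinite_dim S" "cfinite_dim T" "\<And>x. x \<in> E \<Longrightarrow> \<exists>s\<in>S. \<exists>t\<in>T. x = s + t"
  shows "cfinite_dim E"
proof -
  obtain B C where BC: "finite B" "S \<subseteq> cspan B" "finite C" "T \<subseteq> cspan C"
    using assms by (auto simp: cfinite_dim_def)
  have "E \<subseteq> cspan (B \<union> C)"
  proof
    fix x assume "x \<in> E"
    then obtain s t where "s \<in> S" "t \<in> T" "x = s + t" using assms(3) by blast
    moreover have "cspan B \<subseteq> cspan (B \<union> C)" "cspan C \<subseteq> cspan (B \<union> C)"
      by (simp_all add: complex_vector.span_mono)
    ultimately show "x \<in> cspan (B \<union> C)" using BC by (blast intro: complex_vector.span_add)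
  qed
  then show ?thesis using BC by (auto simp: cfinite_dim_def intro!: exI[of _ "B \<union> C"])
qed

text \<open>\<open>H\<close> is the absolute value of \<open>B\<close>, the square root of
  \<open>1 - Y\<close> with \<open>Y = 1 - B * B\<close>. The norm of \<open>Y\<close> may equal 1,
  which calls for the boundary case of the series. The last clause lets \<open>H\<close> inherit the
  symmetries of \<open>B\<close>.\<close>

lemma selfadj_abs_exists:
  fixes B :: "'a::chilbert_space cop"
  assumes B: "selfadj B" "norm B \<le> 1"
  obtains H where "H * H = B * B" "selfadj H" "\<forall>x. 0 \<le> inner (app H x) x"
    "\<forall>S. closed S \<and> subspace S \<and> (\<forall>n. (1 - B * B) ^ n \<in> S) \<longrightarrow> H \<in> S"
proof -
  define Y where "Y = 1 - B * B"
  define H where "H = binom_series (1/2) Y"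
  have contr: "norm (app B x) \<le> norm x" for x
    using norm_app_le[of B x] B(2) by (meson mult_left_le_one_le norm_ge_zero order_trans)
  have Y: "norm Y \<le> 1"
  proof (rule norm_cop_bound)
    fix x
    have "(norm (Y x))\<^sup>2 = (norm x)\<^sup>2 - 2 * (norm (B x))\<^sup>2 + (norm (B (B x)))\<^sup>2"
      using selfadjD[OF B(1), of "B x" x]
      by (simp add: Y_def power2_norm_eq_inner inner_diff_left inner_diff_right inner_commute)
    moreover have "(norm (B (B x)))\<^sup>2 \<le> (norm (B x))\<^sup>2" using contr by (simp add: power_mono)
    moreover have "0 \<le> (norm (B x))\<^sup>2" by simp
    ultimately have "(norm (Y x))\<^sup>2 \<le> (norm x)\<^sup>2" by linarith
    then have "norm (Y x) \<le> norm x" by (rule power2_le_imp_le) simp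
    then show "norm (Y x) \<le> 1 * norm x" by simp
  qed simp
  have cl: "H \<in> S" if "closed S" "subspace S" "\<forall>n. Y ^ n \<in> S" for S
    unfolding H_def using that by (intro binom_series_closed[OF binom_abs_summable_half Y]) auto
  show thesis
  proof (rule that[of H])
    show "H * H = B * B" using sqrt_series_square[OF Y] by (simp add: H_def Y_def)
    have "selfadj Y" using B by (simp add: Y_def selfadj_diff selfadj_square)
    then have "\<forall>n. Y ^ n \<in> {T. selfadj T}" by (simp add: selfadj_power)
    from cl[OF closed_selfadj subspace_selfadj this] show "selfadj H" by simp
    show "\<forall>x. 0 \<le> inner (app H x) x"
    proof
      fix x
      have "inner ((1 - H) x) x \<le> norm ((1 - H) x) * norm x" by (rule norm_cauchy_schwarz)
      also have "\<dots> \<le> (norm (1 - H) * norm x) * norm x"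
        by (intro mult_right_mono norm_app_le) simp
      also have "\<dots> \<le> (1 * norm x) * norm x"
        using norm_sqrt_series_le[OF Y] by (intro mult_right_mono) (auto simp: H_def)
      also have "\<dots> = inner x x" by (simp add: power2_norm_eq_inner[symmetric] power2_eq_square)
      finally show "0 \<le> inner (H x) x" by (simp add: inner_diff_left)
    qed
    show "\<forall>S. closed S \<and> subspace S \<and> (\<forall>n. (1 - B * B) ^ n \<in> S) \<longrightarrow> H \<in> S"
      using cl by (simp add: Y_def)
  qed
qed

locale separable_antiunitary_root = antiunitary_root +
  assumes separable: "separable_space (euclidean :: 'a topology)"
begin

lemma onseq_A: "onseq e \<Longrightarrow> onseq (\<lambda>n. A (e n))"
  by (auto simp: onseq_def cinner_A)

lemma A_transfer_op:
  assumes e: "onseq e" and f: "onseq f"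
  shows "A (transfer_op e f x) = transfer_op (\<lambda>n. A (e n)) (\<lambda>n. A (f n)) (A x)"
proof -
  have "(\<lambda>n. A (cinner (e n) x *\<^sub>C f n)) sums A (transfer_op e f x)"
    by (rule bounded_linear.sums[OF bounded_linear_A transfer_op_sums[OF e f]])
  then have "(\<lambda>n. cinner (A (e n)) (A x) *\<^sub>C A (f n)) sums A (transfer_op e f x)"
    by (simp add: A_scaleC cinner_A cinner_commute[of x])
  then show ?thesis
    by (rule transfer_op_eqI[OF onseq_A[OF e] onseq_A[OF f], symmetric])
qed

lemma A_cspan: "x \<in> cspan B \<Longrightarrow> A x \<in> cspan (A ` B)"
proof (induction rule: complex_vector.span_induct_alt)
  case (step c b y)
  then show ?case
    by (simp add: A_add A_scaleC complex_vector.span_add complex_vector.span_scale complex_vector.span_base)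
qed (simp add: complex_vector.span_zero)

text \<open>\<open>A\<close> maps each eigenspace of \<open>V\<close> within the range of
  \<open>P\<close> into the other one, so if one had finite dimension, both would, and together they
  span that range.\<close>

lemma saus_eigenspace_infinite:
  assumes V: "V \<in> saus P" and P: "\<not> cfinite_dim {x. P x = x}"
  shows "\<not> cfinite_dim {x. V x = x}"
proof
  assume fin: "cfinite_dim {x. V x = x}"
  note V' = sausD[OF V]
  obtain B where B: "finite B" "{x. V x = x} \<subseteq> cspan B" using fin by (auto simp: cfinite_dim_def)
  have "{x. V x = - x} \<subseteq> cspan (A ` B)"
  proof
    fix x assume "x \<in> {x. V x = - x}"
    \<comment> \<open>The factor \<open>eps\<close> is chosen so that applying \<open>A\<close> once
      more returns \<open>x\<close>.\<close>
    then have "V (eps *\<^sub>R A x) = eps *\<^sub>R A x" by (simp add: anticommD[OF V'(5)] A_minus)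
    then have "eps *\<^sub>R A x \<in> cspan B" using B(2) by blast
    from A_cspan[OF this] show "x \<in> cspan (A ` B)" by (simp add: A_scaleR)
  qed
  then have fin': "cfinite_dim {x. V x = - x}" using B(1) by (auto simp: cfinite_dim_def)
  have "cfinite_dim {x. P x = x}"
  proof (rule cfinite_dim_sum[OF fin fin'])
    fix x assume "x \<in> {x. P x = x}"
    then have VV: "V (V x) = x" using arg_cong[OF V'(1), of "\<lambda>T. app T x"] by simp
    have "(1/2) *\<^sub>R (x + V x) + (1/2) *\<^sub>R (x - V x) = (1/2) *\<^sub>R (x + x)"
      by (simp only: scaleR_add_right[symmetric]) simp
    then have "x = (1/2) *\<^sub>R (x + V x) + (1/2) *\<^sub>R (x - V x)" by simp
    then show "\<exists>s\<in>{x. V x = x}. \<exists>t\<in>{x. V x = - x}. x = s + t"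
      using VV by (intro bexI[of _ "(1/2) *\<^sub>R (x + V x)"] bexI[of _ "(1/2) *\<^sub>R (x - V x)"])
        (simp_all add: add.commute flip: scaleR_minus_right)
  qed
  then show False using P by simp
qed

text \<open>With \<open>p\<close>, \<open>q\<close> the even and odd parts of an orthonormal basis of the eigenspace of \<open>V\<close> at 1, the
  operator exchanges \<open>p\<close> with \<open>A q\<close> and \<open>q\<close> with \<open>- eps A p\<close>.\<close>

lemma exists_anticommuting_saus:
  assumes V: "V \<in> saus P" and P: "\<not> cfinite_dim {x. P x = x}"
  obtains W where "W \<in> saus P" "V * W = - (W * V)"
proof -
  note V' = sausD[OF V]
  let ?F = "{x. V x = x}"
  obtain B where B: "orthonormal B" "B \<subseteq> ?F" "complete_in B ?F"
    using exists_complete_orthonormal[OF subspace_fixed] .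
  obtain e where e: "onseq e" "range e = B" "\<forall>n. norm (e n) = 1"
    using exists_infinite_onseq[OF separable B subspace_fixed saus_eigenspace_infinite[OF V P]] .
  \<comment> \<open>Exchanging \<open>e n\<close> with a multiple of \<open>A (e n)\<close> would
    anti-commute with \<open>A\<close> for \<open>eps = - 1\<close> only. Pairing each vector with
    the image of another one works for both signs.\<close>
  define p where "p n = e (2 * n)" for n
  define q where "q n = e (2 * n + 1)" for n
  define p' where "p' n = A (p n)" for n
  define q' where "q' n = A (q n)" for n
  have on: "onseq p" "onseq q" "onseq p'" "onseq q'"
    unfolding p'_def q'_def p_def q_def by (intro onseq_A onseq_subseq[OF e(1)] injI; simp)+
  have Ve: "V (e n) = e n" for n using B(2) e(2) by blast
  then have ev: "V (p n) = 1 *\<^sub>R p n" "V (q n) = 1 *\<^sub>R q n"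
    "V (p' n) = (- 1) *\<^sub>R p' n" "V (q' n) = (- 1) *\<^sub>R q' n" for n
    by (simp_all add: p_def q_def p'_def q'_def anticommD[OF V'(5)])
  have Pe: "P (p n) = 1 *\<^sub>R p n" "P (q n) = 1 *\<^sub>R q n" "P (p' n) = 1 *\<^sub>R p' n" "P (q' n) = 1 *\<^sub>R q' n" for n
    using ev[of n] by (simp_all flip: V'(1))
  have "e n \<noteq> 0" for n using spec[OF e(3), of n] by auto
  then have nz: "p n \<noteq> 0" "q n \<noteq> 0" "p' n \<noteq> 0" "q' n \<noteq> 0" for n
    by (simp_all add: p_def q_def p'_def q'_def)
  have eA: "cinner (e m) (A (e n)) = 0" for m n
  proof -
    have "cinner (e m) (A (e n)) = cinner (V (e m)) (A (e n))" by (simp add: Ve)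
    also have "\<dots> = - cinner (e m) (A (e n))"
      unfolding selfadj_cinnerD[OF V'(4)] by (simp add: anticommD[OF V'(5)] Ve)
    finally show ?thesis by simp
  qed
  have pq: "cinner (p m) (q n) = 0" for m n
  proof -
    have "2 * m \<noteq> 2 * n + 1" by presburger
    then show ?thesis using e(1) by (simp add: p_def q_def onseq_def)
  qed
  have orth: "cinner (p m) (q n) = 0" "cinner (p m) (p' n) = 0" "cinner (p m) (q' n) = 0"
    "cinner (q m) (p' n) = 0" "cinner (q m) (q' n) = 0" "cinner (p' m) (q' n) = 0" for m n
  proof -
    show "cinner (p m) (q n) = 0" by (rule pq)
    show "cinner (p' m) (q' n) = 0" using pq[of m n] by (simp add: p'_def q'_def cinner_A cinner_eq_0_commute)
  qed (simp_all add: p_def q_def p'_def q'_def eA)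
  then have orth': "cinner (q n) (p m) = 0" "cinner (p' n) (p m) = 0" "cinner (q' n) (p m) = 0"
    "cinner (p' n) (q m) = 0" "cinner (q' n) (q m) = 0" "cinner (q' n) (p' m) = 0" for m n
    by (simp_all add: cinner_eq_0_commute)
  define W where "W = swap_op p q' - eps *\<^sub>R swap_op q p'"
  define G where "G = transfer_op p p + transfer_op q' q' + transfer_op q q + transfer_op p' p'"
  have G: "G = P"
  proof (rule proj_eqI)
    show "proj G"
      unfolding G_def
      by (intro proj_add proj_transfer_op on) (simp_all add: distrib_right transfer_op_mult_orth on orth orth')
    show "proj P" by (rule V')
    show "P * G = G" by (simp add: G_def distrib_left transfer_op_left[OF _ _ Pe(1)] transfer_op_left[OF _ _ Pe(2)]
      transfer_op_left[OF _ _ Pe(3)] transfer_op_left[OF _ _ Pe(4)] on)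
    fix y assume y: "app P y = y" "app G y = 0"
    have "cinner (p n) (G y) = cinner (p n) y" "cinner (q n) (G y) = cinner (q n) y"
      "cinner (p' n) (G y) = cinner (p' n) y" "cinner (q' n) (G y) = cinner (q' n) y" for n
      using nz[of n] by (simp_all add: G_def cinner_add_right cinner_transfer_op_basis cinner_transfer_op_orth on orth orth')
    then have 0: "cinner (p n) y = 0" "cinner (q n) y = 0" "cinner (p' n) y = 0" "cinner (q' n) y = 0" for n
      using y(2) by simp_all
    have e0: "cinner (e n) y = 0" "cinner (A (e n)) y = 0" for n
    proof -
      have "n = 2 * (n div 2) \<or> n = 2 * (n div 2) + 1" by presburger
      then have "e n = p (n div 2) \<or> e n = q (n div 2)" unfolding p_def q_def by metis
      then show "cinner (e n) y = 0" "cinner (A (e n)) y = 0"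
        using 0[of "n div 2"] by (auto simp: p'_def q'_def)
    qed
    have VV: "V (V y) = y" using arg_cong[OF V'(1), of "\<lambda>T. app T y"] y(1) by simp
    \<comment> \<open>Both \<open>y + V y\<close> and \<open>A (y - V y)\<close> lie in the
      eigenspace at 1, in which \<open>B\<close> is complete.\<close>
    have "y + V y = 0"
    proof (rule complete_inD[OF B(3)])
      show "y + V y \<in> ?F" using VV by (simp add: add.commute)
      fix b assume "b \<in> B"
      then obtain n where "b = e n" using e(2) by blast
      then show "cinner b (y + V y) = 0"
        using selfadj_cinnerD[OF V'(4), of "e n" y] e0 by (simp add: cinner_add_right Ve)
    qed
    moreover have "A (y - V y) = 0"
    proof (rule complete_inD[OF B(3)])
      show "A (y - V y) \<in> ?F" using VV by (simp add: anticommD[OF V'(5)] A_diff)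
      fix b assume "b \<in> B"
      then obtain n where b: "b = e n" using e(2) by blast
      have "cinner (A (e n)) (y - V y) = 0"
        using selfadj_cinnerD[OF V'(4), of "A (e n)" y] e0
        by (simp add: cinner_diff_right anticommD[OF V'(5)] Ve)
      then show "cinner b (A (y - V y)) = 0"
        unfolding b cinner_eq_0_commute[of "e n"] by (simp add: cinner_A_left[of "y - V y"])
    qed
    then have "y - V y = 0" by (simp del: right_minus_eq)
    ultimately have "(y + V y) + (y - V y) = 0" by (simp only: add_0)
    then have "2 *\<^sub>R y = 0" by (simp add: scaleR_2)
    then show "y = 0" by simp
  qed
  show thesis
  proof (rule that[of W], rule sausI)
    have z: "swap_op p q' * swap_op q p' = 0" "swap_op q p' * swap_op p q' = 0"
      by (simp_all add: swap_op_mult_orth on orth orth')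
    have "W * W = swap_op p q' * swap_op p q' + swap_op q p' * swap_op q p'"
      by (simp add: W_def algebra_simps z)
    also have "\<dots> = G"
      by (simp add: swap_op_square on nz orth G_def)
    finally show "W * W = P" using G by simp
    show "P * W = W"
      by (simp add: W_def algebra_simps swap_op_left[OF _ _ Pe(1) Pe(4)] swap_op_left[OF _ _ Pe(2) Pe(3)] on)
        (simp add: swap_op_def algebra_simps)
    show "selfadj W" by (simp add: W_def selfadj_diff selfadj_scaleR selfadj_swap_op on)
    show "anticomm W"
      unfolding anticomm_def
    proof
      fix x
      have ab: "\<bar>1::real\<bar> = 1" "\<bar>eps\<bar> = 1" using eps by auto
      have AA: "(\<lambda>n. A (p n)) = p'" "(\<lambda>n. A (q n)) = q'"
        "(\<lambda>n. A (p' n)) = (\<lambda>n. eps *\<^sub>R p n)" "(\<lambda>n. A (q' n)) = (\<lambda>n. eps *\<^sub>R q n)"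
        by (simp_all add: p'_def q'_def fun_eq_iff)
      have "A (transfer_op p q' x) = (eps *\<^sub>R transfer_op p' q) (A x)"
        "A (transfer_op q' p x) = (eps *\<^sub>R transfer_op q p') (A x)"
        "A (transfer_op q p' x) = (eps *\<^sub>R transfer_op q' p) (A x)"
        "A (transfer_op p' q x) = (eps *\<^sub>R transfer_op p q') (A x)"
        using transfer_op_scale[OF on(3) on(2) ab] transfer_op_scale[OF on(2) on(3) ab(2,1)]
          transfer_op_scale[OF on(4) on(1) ab] transfer_op_scale[OF on(1) on(4) ab(2,1)]
        by (simp_all add: A_transfer_op on AA)
      then have "A (W x) = - W (A x)"
        by (simp add: W_def swap_op_def A_linear scaleR_add_right algebra_simps)
      then show "W (A x) = - A (W x)" by simp
    qed
    have "V * W = - transfer_op p q' + transfer_op q' p + eps *\<^sub>R transfer_op q p' - eps *\<^sub>R transfer_op p' q"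
      by (simp add: W_def algebra_simps swap_op_left[OF _ _ ev(1) ev(4)] swap_op_left[OF _ _ ev(2) ev(3)] on)
    moreover have "W * V = transfer_op p q' - transfer_op q' p - eps *\<^sub>R transfer_op q p' + eps *\<^sub>R transfer_op p' q"
      by (simp add: W_def algebra_simps swap_op_right[OF _ _ V'(4) ev(1) ev(4)]
          swap_op_right[OF _ _ V'(4) ev(2) ev(3)] on)
    ultimately show "V * W = - (W * V)" by simp
  qed
qed

lemma path_component_uminus:
  assumes V: "V \<in> saus P" and P: "\<not> cfinite_dim {x. P x = x}"
  shows "path_component (saus P) V (- V)"
proof -
  obtain W where W: "W \<in> saus P" "V * W = - (W * V)"
    using exists_anticommuting_saus[OF V P] .
  have "path_component (saus P) W (- V)"
    using W by (intro saus_path_component_anticommuting saus_uminus V) auto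
  with saus_path_component_anticommuting[OF V W] show ?thesis
    by (rule path_component_trans)
qed

text \<open>\<open>A\<close> preserves the real inner product and its inverse is \<open>eps\<close>
  times itself, so it leaves the orthogonal complement of the range invariant as well.\<close>

lemma comm_proj:
  assumes Q: "proj Q" and inv: "\<And>x. app Q x = x \<Longrightarrow> Q (A x) = A x"
  shows "comm Q"
  unfolding comm_def
proof
  fix x
  define y where "y = A (x - Q x)"
  have "inner (Q y) z = 0" for z
  proof -
    have "inner (Q y) z = inner (A y) (A (Q z))"
      using Q by (simp add: inner_A selfadjD proj_selfadj)
    also have "\<dots> = eps * inner (x - Q x) (Q (A (Q z)))"
      using inv[of "Q z"] Q by (simp add: y_def proj_idem)
    also have "\<dots> = eps * inner (Q (x - Q x)) (A (Q z))"
      using Q by (simp only: selfadjD[OF proj_selfadj[OF Q]])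
    also have "\<dots> = 0" using Q by (simp add: proj_idem)
    finally show ?thesis .
  qed
  from this[of "Q y"] have "Q y = 0" by simp
  then have "Q (A x) = Q (A (Q x))" by (simp add: y_def A_diff)
  also have "\<dots> = A (Q x)" using Q by (intro inv) (simp add: proj_idem)
  finally show "Q (A x) = A (Q x)" .
qed


text \<open>On the spectral subspace of \<open>V V' + V' V\<close> for the negative half-line, \<open>V\<close> is at distance less than
  2 from \<open>- V'\<close>, on the complementary one from \<open>V'\<close>.\<close>

lemma saus_path_connected:
  assumes V: "V \<in> saus P" and V': "V' \<in> saus P" and P: "\<not> cfinite_dim {x. P x = x}"
  shows "path_component (saus P) V V'"
proof -
  note v = sausD[OF V] and v' = sausD[OF V']
  \<comment> \<open>\<open>B\<close> commutes with \<open>V\<close> and \<open>V'\<close>, and the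
    squares of \<open>V + V'\<close> and \<open>V - V'\<close> are \<open>P + P\<close> plus and
    minus \<open>B + B\<close>. The sign of \<open>B\<close> decides which of the two is
    small.\<close>
  define B where "B = (1/2) *\<^sub>R (V * V' + V' * V)"
  have BB: "V * V' + V' * V = B + B" by (simp add: B_def flip: scaleR_add_left)
  have B: "selfadj B" "comm B" "norm B \<le> 1"
  proof -
    have "inner ((V * V' + V' * V) x) y = inner x ((V * V' + V' * V) y)" for x y
      by (simp add: selfadjD[OF v(4)] selfadjD[OF v'(4)] inner_add_left inner_add_right add.commute)
    then have "selfadj (V * V' + V' * V)" unfolding selfadj_def by blast
    then show "selfadj B" unfolding B_def by (rule selfadj_scaleR)
    show "comm B" using v v' by (simp add: B_def comm_scaleR comm_add comm_mult_anti)
    have "norm (V * V') \<le> 1" "norm (V' * V) \<le> 1"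
      using norm_saus_le[OF V] norm_saus_le[OF V'] by (auto intro!: order_trans[OF norm_mult_ineq] mult_le_one)
    then show "norm B \<le> 1" using norm_triangle_ineq[of "V * V'" "V' * V"] by (simp add: B_def)
  qed
  have BV: "B * V = V * B" "B * V' = V' * B"
    by (simp_all add: B_def v v' algebra_simps)
  obtain H where H: "H * H = B * B" "selfadj H" "\<forall>x. 0 \<le> inner (app H x) x"
    "\<forall>S. closed S \<and> subspace S \<and> (\<forall>n. (1 - B * B) ^ n \<in> S) \<longrightarrow> H \<in> S"
    using selfadj_abs_exists[OF B(1,3)] .
  have H_comm: "T * H = H * T" if "B * T = T * B" for T
  proof -
    have "T * (1 - B * B) = (1 - B * B) * T"
    proof -
      have "T * (B * B) = (T * B) * B" by (simp only: mult.assoc)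
      also have "\<dots> = B * (T * B)" by (simp only: that[symmetric] mult.assoc)
      also have "\<dots> = B * B * T" by (simp only: that[symmetric] mult.assoc)
      finally show ?thesis by (simp add: algebra_simps)
    qed
    then have "\<forall>n. (1 - B * B) ^ n \<in> {S. T * S = S * T}" by (simp add: commute_power)
    then have "H \<in> {S. T * S = S * T}"
      using H(4) closed_commuting[of T] subspace_commuting[of T] by blast
    then show ?thesis by simp
  qed
  have "comm (1 - B * B)" using B by (simp add: comm_diff comm_mult)
  then have "\<forall>n. (1 - B * B) ^ n \<in> {S. comm S}" by (simp add: comm_power)
  then have "H \<in> {S. comm S}"
    using H(4) comm_closed comm_subspace by blast
  then have cH: "comm H" by simp
  \<comment> \<open>\<open>R\<close> is twice the positive part of \<open>B\<close>, so its kernel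
    is the subspace on which \<open>B\<close> is at most 0.\<close>
  define R where "R = B + H"
  obtain Q where Q: "proj Q" "\<And>x. app Q x = x \<longleftrightarrow> x \<in> {x. R x = 0}"
    using exists_proj_onto[OF separable closed_kernel subspace_kernel, of R] by blast
  have RQ: "app R (Q x) = 0" for x
    using Q(2)[of "Q x"] Q(1) by (simp add: proj_idem)
  have Qcomm: "comm Q"
  proof (rule comm_proj[OF Q(1)])
    fix x assume "Q x = x"
    then have "R x = 0" using Q(2) by simp
    moreover have "R (A x) = A (R x)" using B cH by (simp add: R_def commD A_add)
    ultimately show "Q (A x) = A x" using Q(2) by simp
  qed
  have Qc: "Q * T = T * Q" if "selfadj T" "B * T = T * B" for T
  proof (rule proj_commuteI[OF Q(1) that(1)])
    fix x assume "Q x = x"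
    then have "R x = 0" using Q(2) by simp
    moreover have "R * T = T * R" using that(2) H_comm[OF that(2)] by (simp add: R_def algebra_simps)
    then have "R (T x) = T (R x)" by (metis app_simps(6))
    ultimately show "Q (T x) = T x" using Q(2) by simp
  qed
  have QV: "Q * V = V * Q" "Q * V' = V' * Q" "Q * B = B * Q"
    using Qc v v' BV B by blast+
  have Q': "proj (1 - Q)" "comm (1 - Q)" "(1 - Q) * V = V * (1 - Q)" "(1 - Q) * V' = V' * (1 - Q)"
    using Q(1) Qcomm QV by (simp_all add: proj_compl comm_diff algebra_simps)
  define P1 P2 where "P1 = Q * P" and "P2 = (1 - Q) * P"
  have s1: "Q * V \<in> saus P1" "Q * V' \<in> saus P1"
    unfolding P1_def by (intro saus_restrict V V' Q Qcomm QV)+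
  have s2: "(1 - Q) * V \<in> saus P2" "(1 - Q) * V' \<in> saus P2"
    unfolding P2_def by (intro saus_restrict V V' Q')+
  have PQ: "P * Q = Q * P" by (metis QV(1) v(1) mult.assoc)
  have P12: "P1 * P2 = 0" "P1 + P2 = P"
  proof -
    have "(Q * P) * (Q * P) = Q * (P * Q) * P" by (simp only: mult.assoc)
    also have "\<dots> = (Q * Q) * (P * P)" by (simp only: PQ mult.assoc)
    finally have "(Q * P) * (Q * P) = Q * P" by (simp only: proj_idem(1) Q(1) v(6))
    moreover have "P1 * P2 = Q * (P * P) - (Q * P) * (Q * P)"
      by (simp add: P1_def P2_def algebra_simps)
    ultimately show "P1 * P2 = 0" by (simp add: proj_idem(1)[OF v(6)])
  qed (simp add: P1_def P2_def algebra_simps)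
  have Vd: "V = Q * V + (1 - Q) * V" "V' = Q * V' + (1 - Q) * V'" by (simp_all add: algebra_simps)
  have le: "inner (app (Q' * (P + P)) x) x \<le> 2 * (norm x)\<^sup>2" if "proj Q'" for Q' x
  proof -
    have "norm (Q' (P x)) \<le> norm x" using norm_proj_le[OF that] norm_proj_le[OF v(6)] order_trans by blast
    then have "inner (Q' (P x)) x \<le> norm x * norm x"
      using norm_cauchy_schwarz[of "Q' (P x)" x] mult_right_mono[of "norm (app Q' (P x))" "norm x" "norm x"] by simp
    then show ?thesis by (simp add: inner_add_left power2_eq_square)
  qed
  have sq: "(Q' * T) * (Q' * T) = Q' * (T * T)" if "proj Q'" "Q' * T = T * Q'" for Q' T :: "'a cop"
  proof -
    have "(Q' * T) * (Q' * T) = Q' * (T * Q') * T" by (simp only: mult.assoc)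
    also have "\<dots> = (Q' * Q') * (T * T)" by (simp only: that(2)[symmetric] mult.assoc)
    finally show ?thesis by (simp only: proj_idem(1)[OF that(1)])
  qed
  have path1: "path_component (saus P1) (Q * V) (- (Q * V'))"
  proof (rule saus_path_component[OF s1(1) saus_uminus[OF s1(2)] norm_less_2I])
    have T: "selfadj (V + V')" "Q * (V + V') = (V + V') * Q"
      using v v' QV by (simp_all add: selfadj_add algebra_simps)
    have e: "Q * V - - (Q * V') = Q * (V + V')" by (simp add: algebra_simps)
    show "selfadj (Q * V - - (Q * V'))"
      unfolding e by (rule selfadj_mult[OF proj_selfadj[OF Q(1)] T])
    have TT: "(V + V') * (V + V') = P + P + (B + B)"
      unfolding BB[symmetric] by (simp add: v v' algebra_simps)
    fix x
    have "B (Q x) = - H (Q x)" using RQ[of x] by (simp add: R_def add_eq_0_iff)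
    moreover have "inner (Q (B x)) x = inner (B (Q x)) (Q x)"
    proof -
      have "app Q (B x) = B (Q x)" using QV(3) by (metis app_simps(6))
      moreover have "Q (B (Q x)) = B (Q x)"
        using arg_cong[OF QV(3), of "\<lambda>T. app T (Q x)"] Q(1) by (simp add: proj_idem)
      ultimately show ?thesis by (metis selfadjD[OF proj_selfadj[OF Q(1)]])
    qed
    ultimately have "inner (Q (B x)) x \<le> 0" using H(3) by simp
    then show "inner (((Q * V - - (Q * V')) * (Q * V - - (Q * V'))) x) x \<le> 2 * (norm x)\<^sup>2"
      unfolding e sq[OF Q(1) T(2)] TT
      using le[OF Q(1), of x] by (simp add: inner_add_left)
  qed
  have path2: "path_component (saus P2) ((1 - Q) * V) ((1 - Q) * V')"
  proof (rule saus_path_component[OF s2 norm_less_2I])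
    have T: "selfadj (V - V')" "(1 - Q) * (V - V') = (V - V') * (1 - Q)"
      using v v' QV by (simp_all add: selfadj_diff algebra_simps)
    have e: "(1 - Q) * V - (1 - Q) * V' = (1 - Q) * (V - V')" by (simp add: algebra_simps)
    show "selfadj ((1 - Q) * V - (1 - Q) * V')"
      unfolding e by (rule selfadj_mult[OF proj_selfadj[OF Q'(1)] T])
    have TT: "(V - V') * (V - V') = P + P - (B + B)"
      unfolding BB[symmetric] by (simp add: v v' algebra_simps)
    fix x
    define y where "y = x - Q x"
    have Qy: "Q y = 0" using Q(1) by (simp add: y_def proj_idem)
    \<comment> \<open>\<open>R * (H - B)\<close> is the difference of the squares of
      \<open>H\<close> and \<open>B\<close>, which is 0. Hence the range of \<open>H - B\<close>
      lies in the kernel of \<open>R\<close>, and by self-adjointness \<open>H - B\<close> vanishes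
      on the orthogonal complement, where \<open>y\<close> lies.\<close>
    have "inner ((H - B) y) z = 0" for z
    proof -
      have BH: "B * H = H * B" using H_comm[of B] by simp
      have "R * (H - B) = 0" using H(1) BH by (simp add: R_def algebra_simps)
      then have "R ((H - B) z) = 0" by (metis app_simps(4) app_simps(6))
      then have "Q ((H - B) z) = (H - B) z" using Q(2) by blast
      then have "inner y ((H - B) z) = inner y (Q ((H - B) z))" by simp
      also have "\<dots> = inner (Q y) ((H - B) z)" by (rule selfadjD[OF proj_selfadj[OF Q(1)], symmetric])
      finally have "inner y ((H - B) z) = 0" by (simp add: Qy del: app_simps)
      then show ?thesis by (simp only: selfadjD[OF selfadj_diff[OF H(2) B(1)]])
    qed
    from this[of "(H - B) y"] have "B y = H y" by simp
    then have pos: "0 \<le> inner (B y) y" using H(3) by simp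
    have "inner ((1 - Q) (B x)) x = inner (B y) y"
    proof -
      have "app Q (B z) = B (Q z)" for z using QV(3) by (metis app_simps(6))
      then have "(1 - Q) (B x) = B y" "Q (B y) = 0" by (simp_all add: y_def proj_idem(2)[OF Q(1)])
      then show ?thesis
        using selfadjD[OF proj_selfadj[OF Q(1)], of "B y" x] by (simp add: y_def inner_diff_right)
    qed
    then show "inner ((((1 - Q) * V - (1 - Q) * V') * ((1 - Q) * V - (1 - Q) * V')) x) x \<le> 2 * (norm x)\<^sup>2"
      unfolding e sq[OF Q'(1) T(2)] TT
      using le[OF Q'(1), of x] pos by (simp add: inner_add_left inner_diff_left)
  qed
  show ?thesis
  \<comment> \<open>The sign can be reversed on an infinite-dimensional piece. If the first piece is
    one, its end point is corrected there. Otherwise the second piece is moved to the negative end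
    point too, and the sign is reversed on the whole range.\<close>
  proof (cases "cfinite_dim {x. P1 x = x}")
    case False
    have "path_component (saus P1) (- (Q * V')) (Q * V')"
      by (rule path_component_sym[OF path_component_uminus[OF s1(2) False]])
    with path1 have "path_component (saus P1) (Q * V) (Q * V')" by (rule path_component_trans)
    from saus_path_component_add[OF P12(1) this path2] show ?thesis
      by (simp only: Vd[symmetric] P12(2))
  next
    case True
    have "\<not> cfinite_dim {x. P2 x = x}"
    proof
      assume fin2: "cfinite_dim {x. P2 x = x}"
      have "cfinite_dim {x. P x = x}"
      proof (rule cfinite_dim_sum[OF True fin2])
        fix x assume x: "x \<in> {x. P x = x}"
        have "app P (Q x) = Q x" using arg_cong[OF PQ, of "\<lambda>T. app T x"] x by simp
        then have "P1 (Q x) = Q x" "P2 (x - Q x) = x - Q x"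
          using x Q(1) by (simp_all add: P1_def P2_def proj_idem)
        then show "\<exists>s\<in>{x. P1 x = x}. \<exists>t\<in>{x. P2 x = x}. x = s + t"
          by (intro bexI[of _ "Q x"] bexI[of _ "x - Q x"]) auto
      qed
      then show False using P by simp
    qed
    from path_component_trans[OF path2 path_component_uminus[OF s2(2) this]]
    have "path_component (saus P2) ((1 - Q) * V) (- ((1 - Q) * V'))" .
    from saus_path_component_add[OF P12(1) path1 this]
    have "path_component (saus P) (Q * V + (1 - Q) * V) (- (Q * V') + - ((1 - Q) * V'))"
      by (simp only: P12(2))
    moreover have "- (Q * V') + - ((1 - Q) * V') = - V'" by (simp add: algebra_simps)
    ultimately have "path_component (saus P) V (- V')" by (simp only: Vd(1)[symmetric])
    then show ?thesis
      using path_component_sym[OF path_component_uminus[OF V' P]] by (rule path_component_trans)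
  qed
qed

section \<open>Existence of self-adjoint unitaries on a given range\<close>

lemma exists_unit_multiple:
  assumes "x \<noteq> 0"
  obtains r where "norm (r *\<^sub>R x) = 1" "r *\<^sub>R x \<noteq> (0::'a)"
  using assms by (intro that[of "1 / norm x"]) simp_all

text \<open>A maximal orthonormal family of real vectors is complete over the complex numbers,
  because \<open>y + A y\<close> and \<open>\<i> *\<^sub>C (y - A y)\<close> are both real.\<close>

lemma exists_complete_real_orthonormal:
  assumes eps: "eps = 1" and P: "comm P"
  obtains B where "orthonormal B" "B \<subseteq> {x. P x = x \<and> A x = x}" "complete_in B {x. P x = x}"
proof -
  define K where "K = {x. P x = x \<and> A x = x \<and> norm x = 1}"
  obtain B where B: "B \<subseteq> K" "pairwise (\<lambda>x y. cinner x y = 0) B"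
    and max: "\<forall>x\<in>K. (\<forall>b\<in>B. cinner x b = 0 \<and> cinner b x = 0) \<longrightarrow> x \<in> B"
    using maximal_pairwise[of K "\<lambda>x y. cinner x y = 0"] .
  have z: "x = 0" if x: "P x = x" "A x = x" "\<And>b. b \<in> B \<Longrightarrow> cinner b x = 0" for x
  proof (rule ccontr)
    assume "x \<noteq> 0"
    then obtain r where r: "norm (r *\<^sub>R x) = 1" "r *\<^sub>R x \<noteq> 0" by (rule exists_unit_multiple)
    have 0: "\<forall>b\<in>B. cinner b (r *\<^sub>R x) = 0" using x(3) by (simp add: cinner_scaleR_right)
    moreover have "r *\<^sub>R x \<in> K" using x r by (simp add: K_def A_scaleR)
    ultimately have "r *\<^sub>R x \<in> B" using max by (auto simp: cinner_eq_0_commute)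
    then have "cinner (r *\<^sub>R x) (r *\<^sub>R x) = 0" using 0 by blast
    then show False using r by simp
  qed
  show thesis
  proof (rule that[of B])
    show "orthonormal B" "B \<subseteq> {x. P x = x \<and> A x = x}" using B by (auto simp: orthonormal_def K_def)
    show "complete_in B {x. P x = x}"
      unfolding complete_in_def
    proof (intro ballI impI)
      fix y assume y: "y \<in> {x. P x = x}" "\<forall>b\<in>B. cinner b y = 0"
      have bA: "cinner b (A y) = 0" if "b \<in> B" for b
      proof -
        have "A b = b" using that B(1) by (auto simp: K_def)
        then have "cinner b (A y) = cinner (A b) (A y)" by simp
        also have "\<dots> = cinner y b" by (rule cinner_A)
        finally show ?thesis using y(2) that by (simp add: cinner_eq_0_commute)
      qed
      have 1: "y + A y = 0"
        using y P bA by (intro z) (auto simp: commD A_add eps cinner_add_right)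
      have "\<i> *\<^sub>C (y - A y) = 0"
        using y P bA
        by (intro z) (auto simp: commD A_diff A_scaleC eps cinner_diff_right cinner_scaleC_right scaleC_diff_right)
      then have "y - A y = 0" by (simp del: right_minus_eq)
      with 1 have "(y + A y) + (y - A y) = 0" by (simp only: add_0)
      then have "2 *\<^sub>R y = 0" by (simp add: scaleR_2)
      then show "y = 0" by simp
    qed
  qed
qed

lemma exists_saus_real:
  assumes eps: "eps = 1" and P: "proj P" "comm P" "\<not> cfinite_dim {x. P x = x}"
  shows "saus P \<noteq> {}"
proof -
  obtain B where B: "orthonormal B" "B \<subseteq> {x. P x = x \<and> A x = x}" "complete_in B {x. P x = x}"
    using exists_complete_real_orthonormal[OF eps P(2)] .
  then have BP: "B \<subseteq> {x. P x = x}" by blast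
  obtain e where e: "onseq e" "range e = B" "\<forall>n. norm (e n) = 1"
    using exists_infinite_onseq[OF separable B(1) BP B(3) subspace_fixed P(3)] .
  define a where "a n = e (2 * n)" for n
  \<comment> \<open>\<open>A\<close> fixes \<open>a n\<close> and, because of the factor
    \<open>\<i>\<close>, negates \<open>b n\<close>. An operator exchanging them therefore
    anti-commutes with \<open>A\<close>.\<close>
  define b where "b n = \<i> *\<^sub>C e (2 * n + 1)" for n
  have Pe: "P (e n) = e n" "A (e n) = e n" for n using B(2) e(2) by blast+
  have on: "onseq a" "onseq b"
    using e(1) by (auto simp: onseq_def a_def b_def cinner_scaleC_left cinner_scaleC_right norm_scaleC)
  have ab: "cinner (a m) (b n) = 0" for m n
  proof -
    have "2 * m \<noteq> 2 * n + 1" by presburger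
    then show ?thesis using e(1) by (simp add: a_def b_def onseq_def cinner_scaleC_right)
  qed
  then have ba: "cinner (b m) (a n) = 0" for m n by (simp add: cinner_eq_0_commute)
  have "e n \<noteq> 0" for n using spec[OF e(3), of n] by auto
  then have nz: "a n \<noteq> 0" "b n \<noteq> 0" for n by (simp_all add: a_def b_def)
  have Pab: "P (a n) = 1 *\<^sub>R a n" "P (b n) = 1 *\<^sub>R b n" for n by (simp_all add: a_def b_def Pe)
  define G where "G = transfer_op a a + transfer_op b b"
  have "G = P"
  proof (rule proj_eqI)
    show "proj G"
      unfolding G_def by (intro proj_add proj_transfer_op on transfer_op_mult_orth ab)
    show "P * G = G"
      by (simp add: G_def distrib_left transfer_op_left[OF _ _ Pab(1)] transfer_op_left[OF _ _ Pab(2)] on)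
    fix y assume y: "app P y = y" "app G y = 0"
    have "cinner (a n) (G y) = cinner (a n) y" "cinner (b n) (G y) = cinner (b n) y" for n
      using nz[of n] by (simp_all add: G_def cinner_add_right cinner_transfer_op_basis cinner_transfer_op_orth on ab ba)
    then have 0: "cinner (a n) y = 0" "cinner (b n) y = 0" for n using y(2) by simp_all
    show "y = 0"
    proof (rule complete_inD[OF B(3)])
      fix c assume "c \<in> B"
      then obtain n where n: "c = e n" using e(2) by blast
      have "n = 2 * (n div 2) \<or> n = 2 * (n div 2) + 1" by presburger
      then show "cinner c y = 0"
      proof
        assume "n = 2 * (n div 2)"
        then have "c = a (n div 2)" using n by (simp add: a_def)
        then show ?thesis using 0 by simp
      next
        assume "n = 2 * (n div 2) + 1"
        then have "b (n div 2) = \<i> *\<^sub>C c" using n by (simp add: b_def)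
        with 0(2)[of "n div 2"] show ?thesis by (simp add: cinner_scaleC_left)
      qed
    qed (use y in simp)
  qed (rule P(1))
  have "swap_op a b \<in> saus P"
  proof (rule sausI)
    show "swap_op a b * swap_op a b = P"
      unfolding \<open>G = P\<close>[symmetric] G_def by (rule swap_op_square[OF on nz ab])
    show "P * swap_op a b = swap_op a b"
      using swap_op_left[OF on Pab] by (simp add: swap_op_def)
    show "selfadj (swap_op a b)" by (rule selfadj_swap_op[OF on])
    show "anticomm (swap_op a b)"
      unfolding anticomm_def
    proof
      fix x
      have AA: "(\<lambda>n. A (a n)) = (\<lambda>n. 1 *\<^sub>R a n)" "(\<lambda>n. A (b n)) = (\<lambda>n. (- 1) *\<^sub>R b n)"
        by (simp_all add: fun_eq_iff a_def b_def Pe A_scaleC)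
      have "A (swap_op a b x) = - swap_op a b (A x)"
        using transfer_op_scale[OF on, of 1 "- 1"] transfer_op_scale[OF on(2,1), of "- 1" 1]
        by (simp add: swap_op_def A_add A_transfer_op on AA)
      then show "swap_op a b (A x) = - A (swap_op a b x)" by simp
    qed
  qed
  then show ?thesis by blast
qed

text \<open>For \<open>eps = - 1\<close> the symmetry in \<open>cinner_A_left\<close> becomes
  antisymmetry: the orthogonality of a Kramers pair.\<close>

lemma cinner_A_self:
  assumes "eps = - 1"
  shows "cinner (A x) x = 0"
  using cinner_A_left[of x x] assms by simp

text \<open>A maximal family for the relation \<open>R\<close> below splits the range of
  \<open>P\<close> into its closed span and the image of that span under \<open>A\<close>. The two
  are orthogonal and exchanged by \<open>A\<close>; the operator is 1 on one and -1 on the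
  other.\<close>

lemma exists_saus_quaternionic:
  assumes eps: "eps = - 1" and P: "proj P" "comm P"
  shows "saus P \<noteq> {}"
proof -
  define K where "K = {x. P x = x \<and> norm x = 1}"
  define R where "R x y \<longleftrightarrow> cinner x y = 0 \<and> cinner (A x) y = 0" for x y
  have R_sym: "R x y \<longleftrightarrow> R y x" for x y
    unfolding R_def by (subst cinner_A_left, subst cinner_eq_0_commute) (simp add: eps)
  obtain B where B: "B \<subseteq> K" "pairwise R B" and max: "\<forall>x\<in>K. (\<forall>b\<in>B. R x b \<and> R b x) \<longrightarrow> x \<in> B"
    using maximal_pairwise[of K R] .
  have orth: "orthonormal B"
    using B by (auto simp: orthonormal_def K_def pairwise_def R_def)
  obtain e where e: "onseq e" "B \<subseteq> range e" "range e \<subseteq> insert 0 B"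
    using onseq_enumerate[OF countable_orthonormal[OF separable orth] orth] .
  define f where "f n = A (e n)" for n
  have on: "onseq e" "onseq f" unfolding f_def by (intro onseq_A e(1))+
  have eB: "e n = 0 \<or> e n \<in> B" for n using e(3) by blast
  have fe: "cinner (f m) (e n) = 0" for m n
  proof (cases "m = n")
    case True
    then show ?thesis by (simp add: f_def cinner_A_self[OF eps])
  next
    case False
    show ?thesis
    proof (cases "e m = e n")
      case True
      then show ?thesis by (simp add: f_def cinner_A_self[OF eps])
    next
      case False
      then show ?thesis using eB[of m] eB[of n] B(2) by (auto simp: f_def pairwise_def R_def)
    qed
  qed
  then have ef: "cinner (e m) (f n) = 0" for m n by (simp add: cinner_eq_0_commute)
  have "P (e n) = e n" for n using eB[of n] B(1) by (auto simp: K_def)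
  then have Pef: "P (e n) = 1 *\<^sub>R e n" "P (f n) = 1 *\<^sub>R f n" for n
    using P(2) by (simp_all add: f_def commD)
  define Q where "Q = transfer_op e e"
  define Q' where "Q' = transfer_op f f"
  have QQ: "Q * Q' = 0" "Q' * Q = 0" "proj Q" "proj Q'" "P * Q = Q" "P * Q' = Q'"
    by (simp_all add: Q_def Q'_def on transfer_op_mult_orth ef fe proj_transfer_op
        transfer_op_left[OF _ _ Pef(1)] transfer_op_left[OF _ _ Pef(2)])
  have "Q + Q' = P"
  proof (rule proj_eqI)
    fix y assume y: "app P y = y" "app (Q + Q') y = 0"
    have nz: "cinner (e n) (app (Q + Q') y) = cinner (e n) y" "cinner (f n) (app (Q + Q') y) = cinner (f n) y" for n
      by (auto simp: Q_def Q'_def cinner_add_right cinner_transfer_op_basis cinner_transfer_op_orth on ef fe)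
    then have 0: "cinner (e n) y = 0" "cinner (f n) y = 0" for n using y(2) by simp_all
    show "y = 0"
    proof (rule ccontr)
      assume "y \<noteq> 0"
      then obtain r where r: "norm (r *\<^sub>R y) = 1" "r *\<^sub>R y \<noteq> 0" by (rule exists_unit_multiple)
      have Rb: "R b (r *\<^sub>R y)" if bB: "b \<in> B" for b
      proof -
        obtain n where "b = e n" using e(2) bB by blast
        then show ?thesis using 0[of n] by (simp add: R_def f_def cinner_scaleR_right)
      qed
      moreover have "r *\<^sub>R y \<in> K" using y r by (simp add: K_def)
      ultimately have "r *\<^sub>R y \<in> B" using max R_sym by blast
      from Rb[OF this] r show False by (simp add: R_def)
    qed
  qed (simp_all add: P proj_add QQ distrib_left)
  have "Q - Q' \<in> saus P"
  proof (rule sausI)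
    show "(Q - Q') * (Q - Q') = P"
      using QQ \<open>Q + Q' = P\<close> by (simp add: algebra_simps proj_idem)
    show "P * (Q - Q') = Q - Q'" by (simp add: right_diff_distrib QQ)
    show "selfadj (Q - Q')" using QQ by (intro selfadj_diff proj_selfadj)
    show "anticomm (Q - Q')"
      unfolding anticomm_def
    proof
      fix x
      have AA: "(\<lambda>n. A (e n)) = f" "(\<lambda>n. A (f n)) = (\<lambda>n. (- 1) *\<^sub>R e n)"
        by (simp_all add: fun_eq_iff f_def eps)
      have "A ((Q - Q') x) = (Q' - Q) (A x)"
        using transfer_op_scale[OF on(1) on(1), of "- 1" "- 1"]
        by (simp add: Q_def Q'_def A_diff A_transfer_op on AA)
      then show "(Q - Q') (A x) = - A ((Q - Q') x)" by simp
    qed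
  qed
  then show ?thesis by blast
qed

end

section \<open>Self-adjoint unitaries commuting with a projection up to compact operators\<close>

text \<open>One half of the C*-identity. It turns a bound on the square of
  \<open>off_diag L U\<close> into a bound on the operator itself.\<close>

lemma norm_selfadj_square_le:
  assumes "selfadj D"
  shows "(norm D)\<^sup>2 \<le> norm (D * D)"
proof -
  have "norm (app D x) \<le> sqrt (norm (D * D)) * norm x" for x
  proof (rule power2_le_imp_le)
    have "(norm (D x))\<^sup>2 \<le> norm ((D * D) x) * norm x"
      using norm_square_selfadj[OF assms, of x] norm_cauchy_schwarz[of "(D * D) x" x] by simp
    also have "\<dots> \<le> (norm (D * D) * norm x) * norm x"
      by (intro mult_right_mono norm_app_le) simp
    finally show "(norm (D x))\<^sup>2 \<le> (sqrt (norm (D * D)) * norm x)\<^sup>2"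
      by (simp add: power_mult_distrib power2_eq_square[of "norm x"] mult.assoc)
  qed simp
  then have "norm D \<le> sqrt (norm (D * D))" by (intro norm_cop_bound) auto
  from power_mono[OF this norm_ge_zero, of 2] show ?thesis by simp
qed

definition reflection :: "'a::complex_inner cop \<Rightarrow> 'a cop"
  where "reflection L = L + L - 1"

text \<open>For a projection \<open>L\<close>, conjugation by the reflection negates the two blocks
  of \<open>U\<close> between the range and the kernel of \<open>L\<close> and keeps the others. So
  this is \<open>L * U * (1 - L) + (1 - L) * U * L\<close>, and \<open>diag_part\<close> is the
  block diagonal rest.\<close>

definition off_diag :: "'a::complex_inner cop \<Rightarrow> 'a cop \<Rightarrow> 'a cop"
  where "off_diag L U = (1/2) *\<^sub>R (U - reflection L * U * reflection L)"

definition diag_part :: "'a::complex_inner cop \<Rightarrow> 'a cop \<Rightarrow> 'a cop"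
  where "diag_part L U = (1/2) *\<^sub>R (U + reflection L * U * reflection L)"

text \<open>For a projection \<open>L\<close>, the kernel of the Fredholm operator
  \<open>L * U * L + 1 - L\<close> that defines the index.\<close>

definition compression_kernel :: "'a::complex_inner cop \<Rightarrow> 'a cop \<Rightarrow> 'a set"
  where "compression_kernel L U = {x. L x = x \<and> L (U x) = 0}"

lemma compression_kernelD:
  "x \<in> compression_kernel L U \<Longrightarrow> app L x = x" "x \<in> compression_kernel L U \<Longrightarrow> app L (app U x) = 0"
  by (simp_all add: compression_kernel_def)

lemma subspace_compression_kernel: "complex_vector.subspace (compression_kernel L U)"
  by (simp add: complex_vector.subspace_def compression_kernel_def)

lemma reflection_square: "proj L \<Longrightarrow> reflection L * reflection L = 1"
  by (simp add: reflection_def proj_idem algebra_simps)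

lemma selfadj_reflection: "proj L \<Longrightarrow> selfadj (reflection L)"
  by (simp add: reflection_def proj_selfadj selfadj_intros)

lemma reflection_commute_iff: "reflection L * T = T * reflection L \<longleftrightarrow> L * T = T * L"
proof
  assume "reflection L * T = T * reflection L"
  then have "L * T + L * T = T * L + T * L" by (simp add: reflection_def algebra_simps)
  then have "2 *\<^sub>R (L * T) = 2 *\<^sub>R (T * L)" by (simp only: scaleR_2)
  then show "L * T = T * L" by simp
qed (simp add: reflection_def algebra_simps)

context separable_antiunitary_root
begin

definition nsaus :: "'a cop \<Rightarrow> 'a cop set"
  where "nsaus L = {U \<in> saus 1. compact_cop (U * L - L * U)}"

lemma nsausD: "U \<in> nsaus L \<Longrightarrow> U \<in> saus 1" "U \<in> nsaus L \<Longrightarrow> compact_cop (U * L - L * U)"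
  by (simp_all add: nsaus_def)

lemma nsaus_perturb:
  assumes "U \<in> nsaus L" "W \<in> saus 1" "compact_cop (W - U)"
  shows "W \<in> nsaus L"
proof -
  have "W * L - L * W = (U * L - L * U) + ((W - U) * L - L * (W - U))" by (simp add: algebra_simps)
  also have "compact_cop \<dots>" 
    using assms(3) by (intro compact_cop_add[OF nsausD(2)[OF assms(1)]] compact_cop_diff
        compact_cop_mult_right[OF assms(3)] compact_cop_mult_left[OF assms(3)])
  finally show ?thesis using assms(2) by (simp add: nsaus_def)
qed

lemma nsausI_commute: "U \<in> saus 1 \<Longrightarrow> L * U = U * L \<Longrightarrow> U \<in> nsaus L"
  by (simp add: nsaus_def)

lemma nsaus_path_component:
  assumes U: "U \<in> nsaus L" and V: "V \<in> nsaus L" and "norm (U - V) < 2" and K: "compact_cop (U - V)"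
  shows "path_component (nsaus L) U V"
proof (rule saus_path[OF nsausD(1)[OF U] nsausD(1)[OF V] assms(3)])
  fix g :: "real \<Rightarrow> 'a cop"
  assume g: "continuous_on {0..1} g" "g 0 = U" "g 1 = V" "\<And>t. t \<in> {0..1} \<Longrightarrow> g t \<in> saus 1"
    "\<And>t. t \<in> {0..1} \<Longrightarrow> compact_cop (U - V) \<Longrightarrow> compact_cop (g t - U)"
  then have "g t \<in> nsaus L" if "t \<in> {0..1}" for t using that K by (intro nsaus_perturb[OF U])
  then show ?thesis
    unfolding path_component_def using g
    by (intro exI[of _ g]) (auto simp: path_def path_image_def pathstart_def pathfinish_def)
qed

text \<open>Write T and D for the diagonal and the off-diagonal part. Both T + D and its reflection
  T - D square to 1, so T and D anti-commute, T^2 + D^2 = 1, and D^2 commutes with \<open>U\<close>.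
  Compactness of D comes from that of the commutator: \<open>U * S - S * U\<close>, with S the
  reflection, is twice \<open>U * L - L * U\<close>.\<close>

lemma
  assumes L: "proj L" "comm L" and U: "U \<in> nsaus L"
  shows reflected_saus: "reflection L * U * reflection L \<in> saus 1"
    and reflected_compact: "compact_cop (U - reflection L * U * reflection L)"
    and off_diag_selfadj: "selfadj (off_diag L U)"
    and off_diag_norm: "norm (off_diag L U) \<le> 1"
    and off_diag_compact: "compact_cop (off_diag L U)"
    and diag_selfadj: "selfadj (diag_part L U)"
    and diag_commute: "L * diag_part L U = diag_part L U * L"
    and diag_anticomm: "anticomm (diag_part L U)"
    and diag_off_diag_square: "diag_part L U * diag_part L U = 1 - off_diag L U * off_diag L U"
    and off_diag_square_commute: "U * (off_diag L U * off_diag L U) = (off_diag L U * off_diag L U) * U"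
    and reflected_diff: "U - reflection L * U * reflection L = off_diag L U + off_diag L U"
proof -
  let ?S = "reflection L"
  note u = sausD[OF nsausD(1)[OF U]]
  have SS: "?S * ?S = 1" "?S * (?S * T) = T" for T
    using reflection_square[OF L(1)] by (simp_all flip: mult.assoc)
  have cS: "comm ?S" using L(2) by (simp add: reflection_def comm_add comm_diff)
  define V where "V = ?S * U * ?S"
  have V: "V \<in> saus 1"
  proof (rule sausI)
    show "V * V = 1" using u(8) by (simp add: V_def mult.assoc SS)
    show "selfadj V" unfolding V_def using selfadj_reflection[OF L(1)] u by (intro selfadj_conj)
    show "anticomm V" unfolding V_def using cS u by (intro anticomm_mult_left anticomm_mult_right)
  qed simp
  then show "?S * U * ?S \<in> saus 1" by (simp add: V_def)
  note v = sausD[OF V]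
  have "U - V = ((U * L - L * U) + (U * L - L * U)) * ?S"
  proof -
    have "(U * L - L * U) + (U * L - L * U) = U * ?S - ?S * U"
      by (simp add: reflection_def algebra_simps)
    then show ?thesis by (simp only: V_def left_diff_distrib mult.assoc SS mult_1_right)
  qed
  also have "compact_cop \<dots>" using nsausD(2)[OF U] by (intro compact_cop_mult_right compact_cop_add)
  finally show comp: "compact_cop (U - ?S * U * ?S)" by (simp add: V_def)
  have o: "off_diag L U = (1/2) *\<^sub>R (U - V)" and d: "diag_part L U = (1/2) *\<^sub>R (U + V)"
    by (simp_all add: off_diag_def diag_part_def V_def)
  show "selfadj (off_diag L U)" "selfadj (diag_part L U)" "anticomm (diag_part L U)"
    using u v by (simp_all add: o d selfadj_intros anticomm_add anticomm_scaleR)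
  show "compact_cop (off_diag L U)" using comp by (simp add: off_diag_def compact_cop_scaleR)
  show "norm (off_diag L U) \<le> 1"
    using norm_triangle_ineq4[of U V] norm_saus_le[OF V] norm_saus_le[OF nsausD(1)[OF U]] by (simp add: o)
  have "?S * (U + V) = (U + V) * ?S" by (simp add: V_def algebra_simps SS)
  then have "?S * diag_part L U = diag_part L U * ?S" by (simp add: d)
  then show "L * diag_part L U = diag_part L U * L" by (simp add: reflection_commute_iff)
  have four: "(4::real) *\<^sub>R (X::'a cop) = X + X + X + X" for X
    using scaleR_add_left[of 2 2 X] by (simp add: scaleR_2)
  have "(U + V) * (U + V) + (U - V) * (U - V) = 4 *\<^sub>R 1"
    by (simp add: u v four algebra_simps)
  then have "(1/4) *\<^sub>R ((U + V) * (U + V) + (U - V) * (U - V)) = 1"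
    by simp
  moreover have "diag_part L U * diag_part L U = (1/4) *\<^sub>R ((U + V) * (U + V))"
    "off_diag L U * off_diag L U = (1/4) *\<^sub>R ((U - V) * (U - V))"
    by (simp_all add: o d)
  ultimately have "diag_part L U * diag_part L U + off_diag L U * off_diag L U = 1"
    by (simp only: scaleR_add_right)
  then show "diag_part L U * diag_part L U = 1 - off_diag L U * off_diag L U" by (simp add: eq_diff_eq)
  have "U * ((U - V) * (U - V)) = ((U - V) * (U - V)) * U"
    by (simp add: u v algebra_simps)
  then show "U * (off_diag L U * off_diag L U) = (off_diag L U * off_diag L U) * U" by (simp add: o)
  show "U - ?S * U * ?S = off_diag L U + off_diag L U"
    unfolding V_def[symmetric] by (simp add: o flip: scaleR_add_left)
qed

lemma diag_eq:
  assumes "proj L"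
  shows "app L x = x \<Longrightarrow> app (diag_part L U) x = L (U x)"
    and "app L x = 0 \<Longrightarrow> app (diag_part L U) x = U x - L (U x)"
proof -
  show "app (diag_part L U) x = L (U x)" if "app L x = x"
  proof -
    have "(U + reflection L * U * reflection L) x = L (U x) + L (U x)"
      by (simp add: reflection_def that)
    then show ?thesis unfolding diag_part_def by (simp only: app_simps(7) scaleR_half_double)
  qed
  show "app (diag_part L U) x = U x - L (U x)" if "app L x = 0"
  proof -
    have "(U + reflection L * U * reflection L) x = (U x - L (U x)) + (U x - L (U x))"
      by (simp add: reflection_def that)
    then show ?thesis unfolding diag_part_def by (simp only: app_simps(7) scaleR_half_double)
  qed
qed

context
  fixes L U :: "'a cop"
  assumes L: "proj L" "comm L" and U: "U \<in> nsaus L"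
begin

text \<open>The square of the diagonal part is 1 minus that of the off-diagonal part, and a
  self-adjoint operator has the same kernel as its square.\<close>

lemma diag_eq_0_iff: "diag_part L U x = 0 \<longleftrightarrow> off_diag L U (off_diag L U x) = x"
proof -
  have e: "diag_part L U (diag_part L U x) = x - off_diag L U (off_diag L U x)"
    using arg_cong[OF diag_off_diag_square[OF L U], of "\<lambda>T. app T x"] by simp
  show ?thesis
  proof
    assume "off_diag L U (off_diag L U x) = x"
    then have "inner (diag_part L U (diag_part L U x)) x = 0" by (simp add: e)
    then show "diag_part L U x = 0" using selfadjD[OF diag_selfadj[OF L U], of "diag_part L U x" x] by simp
  qed (use e in simp)
qed

lemma compression_kernel_eq: "compression_kernel L U = {x. L x = x \<and> diag_part L U x = 0}"
  using diag_eq(1)[OF L(1)] by (auto simp: compression_kernel_def)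

lemma compression_kernel_diag_kernel:
  assumes "diag_part L U x = 0"
  shows "app L x \<in> compression_kernel L U"
  using arg_cong[OF diag_commute[OF L U], of "\<lambda>T. app T x"] assms L(1)
  by (simp add: compression_kernel_eq proj_idem)

lemma cfinite_dim_compression_kernel: "cfinite_dim (compression_kernel L U)"
proof (rule cfinite_dim_subset)
  show "cfinite_dim {x. app (off_diag L U * off_diag L U) x = x}"
    using off_diag_compact[OF L U] by (intro compact_fixed_finite_dim separable compact_cop_mult_left)
  show "compression_kernel L U \<subseteq> {x. app (off_diag L U * off_diag L U) x = x}"
    by (auto simp: compression_kernel_eq diag_eq_0_iff)
qed

text \<open>\<open>Q\<close> is the spectral projection of the squared off-diagonal part at the
  eigenvalue 1. It commutes with all the data, so it can be cut off; the gap on the complement then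
  supplies inverses and short segments even if the compression kernel is not zero.\<close>

lemma exists_diag_kernel_proj:
  obtains Q where "proj Q" "\<forall>x. Q x = x \<longleftrightarrow> diag_part L U x = 0"
    "norm (off_diag L U * off_diag L U * (1 - Q)) < 1" "off_diag L U * off_diag L U * Q = Q"
    "Q * L = L * Q" "Q * U = U * Q" "comm Q" "Q * (off_diag L U * off_diag L U) = Q"
proof -
  let ?D = "off_diag L U"
  obtain Q where Q: "proj Q" "\<And>x. app Q x = x \<longleftrightarrow> x \<in> {x. diag_part L U x = 0}"
    using exists_proj_onto[OF separable closed_kernel subspace_kernel, of "diag_part L U"] by blast
  show thesis
  proof (rule that[OF Q(1)])
    show "\<forall>x. Q x = x \<longleftrightarrow> diag_part L U x = 0" using Q(2) by simp
    show "norm (?D * ?D * (1 - Q)) < 1"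
      using off_diag_selfadj[OF L U] off_diag_norm[OF L U] off_diag_compact[OF L U] Q
      by (intro compact_square_gap) (simp_all add: compact_cop_mult_left diag_eq_0_iff)
    show DQ: "?D * ?D * Q = Q"
    proof (rule cop_eqI)
      fix x
      have "Q (Q x) = Q x" by (simp add: proj_idem Q(1))
      then show "(?D * ?D * Q) x = Q x" using Q(2) by (simp add: diag_eq_0_iff)
    qed
    show "Q * (?D * ?D) = Q"
      using selfadj_mult_swap[OF selfadj_square[OF off_diag_selfadj[OF L U]] proj_selfadj[OF Q(1)] proj_selfadj[OF Q(1)] DQ] .
    show "Q * L = L * Q"
    proof (rule proj_commuteI[OF Q(1) proj_selfadj[OF L(1)]])
      fix x assume "Q x = x"
      then show "Q (L x) = L x"
        using Q(2) arg_cong[OF diag_commute[OF L U], of "\<lambda>T. app T x"] by simp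
    qed
    show "Q * U = U * Q"
    proof (rule proj_commuteI[OF Q(1) sausD(4)[OF nsausD(1)[OF U]]])
      fix x assume "Q x = x"
      then show "Q (U x) = U x"
        using Q(2) arg_cong[OF off_diag_square_commute[OF L U], of "\<lambda>T. app T x"] by (simp add: diag_eq_0_iff)
    qed
    show "comm Q"
    proof (rule comm_proj[OF Q(1)])
      fix x assume "Q x = x"
      then show "Q (A x) = A x"
        using Q(2) by (simp add: anticommD[OF diag_anticomm[OF L U]])
    qed
  qed
qed

text \<open>The kernel of the diagonal part is an eigenspace of an operator commuting with
  \<open>U\<close>, so it contains \<open>U x\<close>, and \<open>L\<close> maps it into the
  compression kernel. Hence \<open>L\<close> kills both \<open>x\<close> and \<open>U x\<close>; but
  then the diagonal part takes \<open>x\<close> to \<open>U x\<close>.\<close>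

lemma diag_kernel_trivial:
  assumes 0: "compression_kernel L U \<subseteq> {0}" and x: "diag_part L U x = 0"
  shows "x = 0"
proof -
  have Lx: "L y = 0" if "diag_part L U y = 0" for y
    using compression_kernel_diag_kernel[OF that] 0 by blast
  have "off_diag L U (off_diag L U (U x)) = U x"
    using x arg_cong[OF off_diag_square_commute[OF L U], of "\<lambda>T. app T x"] by (simp add: diag_eq_0_iff)
  then have "L (U x) = 0" by (intro Lx) (simp add: diag_eq_0_iff)
  moreover have "U x - L (U x) = 0" using diag_eq(2)[OF L(1) Lx[OF x], of U] x by simp
  ultimately have "U x = 0" by simp
  then have "(U * U) x = 0" by simp
  then show ?thesis using sausD(1)[OF nsausD(1)[OF U]] by simp
qed

lemma norm_off_diag_less:
  assumes "compression_kernel L U \<subseteq> {0}"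
  shows "norm (off_diag L U * off_diag L U) < 1" "norm (off_diag L U) < 1"
proof -
  let ?D = "off_diag L U"
  show n: "norm (?D * ?D) < 1"
    using compact_square_gap[of ?D 0] off_diag_selfadj[OF L U] off_diag_norm[OF L U] off_diag_compact[OF L U]
      diag_kernel_trivial[OF assms] by (simp add: compact_cop_mult_left diag_eq_0_iff)
  have "(norm ?D)\<^sup>2 < 1" using norm_selfadj_square_le[OF off_diag_selfadj[OF L U]] n by simp
  then show "norm ?D < 1" by (simp add: abs_square_less_1)
qed

lemma path_to_commuting:
  assumes 0: "compression_kernel L U \<subseteq> {0}"
  obtains V where "V \<in> saus 1" "L * V = V * L" "path_component (nsaus L) U V"
proof -
  let ?S = "reflection L" and ?D = "off_diag L U"
  have "norm (U - ?S * U * ?S) \<le> norm ?D + norm ?D"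
    unfolding reflected_diff[OF L U] by (rule norm_triangle_ineq)
  also have "\<dots> < 2" using norm_off_diag_less(2)[OF 0] by simp
  finally have less: "norm (U - ?S * U * ?S) < 2" .
  show thesis
  proof (rule saus_path[OF nsausD(1)[OF U] reflected_saus[OF L U] less])
    fix g :: "real \<Rightarrow> 'a cop"
    assume g: "continuous_on {0..1} g" "g 0 = U" "g 1 = ?S * U * ?S" "\<And>t. t \<in> {0..1} \<Longrightarrow> g t \<in> saus 1"
      "\<And>t. t \<in> {0..1} \<Longrightarrow> compact_cop (U - ?S * U * ?S) \<Longrightarrow> compact_cop (g t - U)"
      "\<And>S. S * S = 1 \<Longrightarrow> S * U * S = ?S * U * ?S \<Longrightarrow> S * g (1/2) = g (1/2) * S"
    have n: "g t \<in> nsaus L" if "t \<in> {0..1}" for t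
      using that g reflected_compact[OF L U] by (intro nsaus_perturb[OF U])
    have "path_component (nsaus L) U (g (1/2))"
      unfolding path_component_def
    proof (intro exI conjI)
      show "path (\<lambda>t. g (t / 2))"
        unfolding path_def
        by (rule continuous_on_compose2[OF g(1)]) (auto intro!: continuous_intros)
      show "path_image (\<lambda>t. g (t / 2)) \<subseteq> nsaus L" using n by (auto simp: path_image_def)
    qed (simp_all add: pathstart_def pathfinish_def g)
    moreover have "L * g (1/2) = g (1/2) * L"
      using g(6)[OF reflection_square[OF L(1)] refl] by (simp add: reflection_commute_iff)
    ultimately show thesis by (intro that[of "g (1/2)"] g(4)) auto
  qed
qed

text \<open>\<open>U\<close> is altered only on the sum of the range of \<open>P\<close> and its
  image under \<open>U\<close>. There the compression of the new operator is \<open>Z\<close>, which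
  is invertible on the range of \<open>P\<close>, so this range leaves the kernel. Old and new
  operator anti-commute on that sum, which keeps the segment short.\<close>

lemma shrink_compression_kernel:
  assumes Z: "Z \<in> saus P" and range: "\<And>x. P x \<in> compression_kernel L U"
  obtains U' where "U' \<in> nsaus L" "path_component (nsaus L) U U'"
    "compression_kernel L U' = {x \<in> compression_kernel L U. P x = 0}"
proof -
  note u = sausD[OF nsausD(1)[OF U]] and z = sausD[OF Z]
  have LP: "L * P = P" and LUP: "L * (U * P) = 0"
    using range by (auto intro!: cop_eqI simp: compression_kernel_def)
  have PL: "P * L = P"
    using selfadj_mult_swap[OF proj_selfadj[OF L(1)] proj_selfadj[OF z(6)] proj_selfadj[OF z(6)] LP] .
  have PUP: "P * (U * P) = 0"
  proof -
    have "P * (U * P) = P * (L * (U * P))" by (simp only: PL mult.assoc[symmetric])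
    then show ?thesis by (simp add: LUP)
  qed
  have ZUP: "Z * (U * P) = 0" and PUZ: "P * (U * Z) = 0" and ZUZ: "Z * (U * Z) = 0" and LUZ: "L * (U * Z) = 0"
  proof -
    have "Z * (U * P) = Z * (P * (U * P))" by (simp only: z(3) mult.assoc[symmetric])
    then show ZUP: "Z * (U * P) = 0" by (simp add: PUP)
    have "P * (U * Z) = (P * (U * P)) * Z" by (simp add: mult.assoc z)
    then show "P * (U * Z) = 0" by (simp add: PUP)
    have "Z * (U * Z) = (Z * (U * P)) * Z" by (simp add: mult.assoc z)
    then show "Z * (U * Z) = 0" by (simp add: ZUP)
    have "L * (U * Z) = (L * (U * P)) * Z" by (simp add: mult.assoc z)
    then show "L * (U * Z) = 0" by (simp add: LUP)
  qed
  have 0: "P * (U * (P * T)) = 0" "Z * (U * (P * T)) = 0" "P * (U * (Z * T)) = 0" "Z * (U * (Z * T)) = 0"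
    "L * (U * (P * T)) = 0" "L * (U * (Z * T)) = 0" "L * (P * T) = P * T" for T
    using PUP ZUP PUZ ZUZ LUP LUZ LP by (metis mult.assoc mult_zero_left)+
  have LZ: "L * Z = Z" using 0(7)[of Z] z by simp
  \<comment> \<open>\<open>M\<close> is \<open>U\<close> restricted to the sum of the ranges of
    \<open>P\<close> and \<open>U * P * U\<close>, which are orthogonal because
    \<open>P * (U * P)\<close> vanishes. \<open>W\<close> lives on the same sum, and its minus sign
    makes it anti-commute with \<open>U\<close>, hence with \<open>M\<close>.\<close>
  define M where "M = U * P + P * U"
  define W where "W = Z - U * Z * U"
  define U' where "U' = U - M + W"
  define PL where "PL = P + U * P * U"
  note rules = u z proj_idem(1)[OF z(6)] 0 PUP ZUP PUZ ZUZ
  have MM: "M * M = PL" "W * W = PL" "M * W = - (W * M)"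
    by (simp_all add: M_def W_def PL_def algebra_simps rules)
  have UU: "U * M = PL" "M * U = PL" "U * W = - (W * U)"
    by (simp_all add: M_def W_def PL_def algebra_simps rules)
  have aM: "selfadj M" "anticomm M"
  proof -
    have "inner (M x) y = inner x (M y)" for x y
      using u(4) proj_selfadj[OF z(6)] by (simp add: M_def inner_add_left inner_add_right selfadj_def add.commute)
    then show "selfadj M" unfolding selfadj_def by blast
    show "anticomm M" unfolding M_def
      using u z by (intro anticomm_add anticomm_mult_left[of P U] anticomm_mult_right[of U P])
  qed
  have aW: "selfadj W" "anticomm W"
  proof -
    show "selfadj W" unfolding W_def using u z by (intro selfadj_diff selfadj_conj)
    have "anticomm (U * (Z * U))" using u z by (intro anticomm_mult_right comm_mult_anti)
    then show "anticomm W" unfolding W_def using z by (simp add: anticomm_diff mult.assoc)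
  qed
  have proj_PL: "proj PL"
    unfolding MM(1)[symmetric] proj_def
  proof
    have "PL * PL = PL" by (simp add: PL_def algebra_simps rules)
    then show "M * M * (M * M) = M * M" by (simp only: MM(1))
  qed (rule selfadj_square[OF aM(1)])
  have U': "U' \<in> saus 1"
  proof (rule sausI)
    have "U' * U' = (U * U - U * M - M * U + M * M) + W * W + (U * W + W * U) - (M * W + W * M)"
      by (simp add: U'_def algebra_simps)
    also have "\<dots> = 1" by (simp only: MM UU u(1)) simp
    finally show "U' * U' = 1" .
    show "selfadj U'" unfolding U'_def using u aM aW by (intro selfadj_add selfadj_diff)
    show "anticomm U'" unfolding U'_def using u aM aW by (intro anticomm_add anticomm_diff)
  qed simp
  have diff: "U - U' = M - W" by (simp add: U'_def)
  \<comment> \<open>Reproduced by a compact operator, \<open>P\<close> is compact, and so are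
    \<open>Z\<close>, \<open>M\<close> and \<open>W\<close>.\<close>
  have "off_diag L U * off_diag L U * P = P"
  proof (rule cop_eqI)
    fix x
    have "diag_part L U (P x) = 0" using range[of x] by (simp add: compression_kernel_eq)
    then show "(off_diag L U * off_diag L U * P) x = P x" by (simp add: diag_eq_0_iff)
  qed
  moreover have "compact_cop (off_diag L U * off_diag L U * P)"
    using off_diag_compact[OF L U] by (intro compact_cop_mult_right)
  ultimately have cP: "compact_cop P" by simp
  have cZ: "compact_cop Z" using compact_cop_mult_right[OF cP, of Z] z by simp
  have comp: "compact_cop (U - U')"
    unfolding diff M_def W_def using cP cZ by (intro compact_cop_intros)
  then have "compact_cop (U' - U)" using compact_cop_minus[of "U - U'"] by simp
  then have nU': "U' \<in> nsaus L" by (rule nsaus_perturb[OF U U'])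
  have less: "norm (U - U') < 2"
    unfolding diff
  proof (rule norm_less_2I)
    show "selfadj (M - W)" using aM aW by (intro selfadj_diff)
    fix x
    have "(M - W) * (M - W) = M * M + W * W - (M * W + W * M)" by (simp add: algebra_simps)
    also have "\<dots> = PL + PL" by (simp only: MM) simp
    finally have "inner (((M - W) * (M - W)) x) x = 2 * inner (PL x) x" by (simp only:) (simp add: inner_add_left)
    moreover have "inner (PL x) x \<le> norm x * norm x"
      using norm_cauchy_schwarz[of "PL x" x] norm_proj_le[OF proj_PL, of x]
        mult_right_mono[of "norm (app PL x)" "norm x" "norm x"] by simp
    ultimately show "inner (((M - W) * (M - W)) x) x \<le> 2 * (norm x)\<^sup>2" by (simp add: power2_eq_square)
  qed
  have LU': "L * U' = L * U - P * U + Z"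
    by (simp add: U'_def M_def W_def algebra_simps 0 LUP LUZ LP LZ)
  have PUL: "P * (U * L) = 0"
  proof -
    have 0: "inner (P (U (L x))) y = 0" for x y
    proof -
      have "inner (P (U (L x))) y = inner x (L (U (P y)))"
        using u(4) proj_selfadj[OF z(6)] proj_selfadj[OF L(1)] by (simp add: selfadj_def)
      also have "\<dots> = 0" using arg_cong[OF LUP, of "\<lambda>T. app T y"] by simp
      finally show ?thesis .
    qed
    show ?thesis
    proof (rule cop_eqI)
      show "(P * (U * L)) x = app 0 x" for x using 0[of x "P (U (L x))"] by simp
    qed
  qed
  have ker: "compression_kernel L U' = {x \<in> compression_kernel L U. P x = 0}"
  proof (intro set_eqI iffI)
    fix x assume "x \<in> compression_kernel L U'"
    then have x: "L x = x" "L (U' x) = 0" by (auto simp: compression_kernel_def)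
    have PU: "P (U x) = 0" using arg_cong[OF PUL, of "\<lambda>T. app T x"] x(1) by simp
    have e: "L (U x) + Z x = 0" using arg_cong[OF LU', of "\<lambda>T. app T x"] x(2) PU by simp
    then have "P (L (U x)) + P (Z x) = 0" by (metis app_add app_zero)
    moreover have "P (L (U x)) = 0" using arg_cong[OF PL, of "\<lambda>T. app T (app U x)"] PU by simp
    moreover have "P (Z x) = Z x" using arg_cong[OF z(2), of "\<lambda>T. app T x"] by simp
    ultimately have Zx: "Z x = 0" by simp
    then have "P x = 0" using arg_cong[OF z(1), of "\<lambda>T. app T x"] by simp
    then show "x \<in> {x \<in> compression_kernel L U. P x = 0}"
      using e Zx x(1) by (simp add: compression_kernel_def)
  next
    fix x assume x: "x \<in> {x \<in> compression_kernel L U. P x = 0}"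
    then have x': "L x = x" "L (U x) = 0" "P x = 0" by (auto simp: compression_kernel_def)
    have PU: "P (U x) = 0" using arg_cong[OF PUL, of "\<lambda>T. app T x"] x'(1) by simp
    have "Z x = 0" using arg_cong[OF z(3), of "\<lambda>T. app T x"] x'(3) by simp
    then have "L (U' x) = 0" using arg_cong[OF LU', of "\<lambda>T. app T x"] x' PU by simp
    then show "x \<in> compression_kernel L U'" using x' by (simp add: compression_kernel_def)
  qed
  show thesis
    by (rule that[OF nU' nsaus_path_component[OF U nU' less comp] ker])
qed

end

lemma saus_add_complement:
  assumes L: "proj L" and u: "u \<in> saus L" and v: "v \<in> saus (1 - L)"
  shows "u + v \<in> saus 1" "L * (u + v) = (u + v) * L"
proof -
  have LL: "L * (1 - L) = 0" "(1 - L) * L = 0" using L by (simp_all add: algebra_simps proj_idem)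
  have "L * v = L * (1 - L) * v" "v * L = v * ((1 - L) * L)"
    using sausD(2,3)[OF v] by (simp_all only: mult.assoc[symmetric]) (simp_all only: mult.assoc)
  then have "L * v = 0" "v * L = 0" by (simp_all add: LL)
  then show "L * (u + v) = (u + v) * L" using sausD(2,3)[OF u] by (simp add: distrib_left distrib_right)
  show "u + v \<in> saus 1" using saus_add[OF u v LL(1)] by simp
qed

text \<open>The ranges of \<open>L\<close> and \<open>1 - L\<close> give two independent instances
  of \<open>saus_path_connected\<close>, and every sum of the two pieces commutes with
  \<open>L\<close>.\<close>

lemma commuting_path_component:
  assumes L: "proj L" "comm L" and inf: "\<not> cfinite_dim {x. L x = x}" "\<not> cfinite_dim {x. (1 - L) x = x}"
    and V: "V \<in> saus 1" "L * V = V * L" and W: "W \<in> saus 1" "L * W = W * L"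
  shows "path_component (nsaus L) V W"
proof -
  have r: "L * X \<in> saus L" "(1 - L) * X \<in> saus (1 - L)" if "X \<in> saus 1" "L * X = X * L" for X
  proof -
    show "L * X \<in> saus L" using saus_restrict[OF that(1) L that(2)] by simp
    have "(1 - L) * X = X * (1 - L)" using that(2) by (simp add: algebra_simps)
    then show "(1 - L) * X \<in> saus (1 - L)"
      using saus_restrict[OF that(1) proj_compl[OF L(1)]] L(2) by (simp add: comm_diff)
  qed
  have "path_component {u + v |u v. u \<in> saus L \<and> v \<in> saus (1 - L)} (L * V + (1 - L) * V) (L * W + (1 - L) * W)"
    by (intro path_component_sum_set saus_path_connected r V W inf)
  moreover have "L * X + (1 - L) * X = X" for X by (simp add: algebra_simps)
  ultimately have "path_component {u + v |u v. u \<in> saus L \<and> v \<in> saus (1 - L)} V W" by simp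
  moreover have "{u + v |u v. u \<in> saus L \<and> v \<in> saus (1 - L)} \<subseteq> nsaus L"
  proof clarify
    fix u v assume u: "u \<in> saus L" and v: "v \<in> saus (1 - L)"
    from saus_add_complement[OF L(1) u v] show "u + v \<in> nsaus L" by (intro nsausI_commute)
  qed
  ultimately show ?thesis by (rule path_component_of_subset[rotated])
qed

lemma exists_commuting:
  assumes L: "proj L" "comm L" and ne: "saus L \<noteq> {}" "saus (1 - L) \<noteq> {}"
  obtains V where "V \<in> saus 1" "L * V = V * L"
proof -
  obtain u v where u: "u \<in> saus L" and v: "v \<in> saus (1 - L)" using ne by blast
  from saus_add_complement[OF L(1) u v] show thesis by (rule that)
qed

end

section \<open>The mod 2 index\<close>

lemma cfinite_dim_basis:
  assumes "cfinite_dim A"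
  obtains B where "finite B" "B \<subseteq> A" "\<not> complex_vector.dependent B" "A \<subseteq> cspan B" "card B = cdim A"
proof -
  obtain B where B: "B \<subseteq> A" "\<not> complex_vector.dependent B" "A \<subseteq> cspan B" "card B = cdim A"
    using complex_vector.basis_exists[of A] by blast
  obtain F where F: "finite F" "A \<subseteq> cspan F" using assms by (auto simp: cfinite_dim_def)
  have "finite B" using complex_vector.independent_span_bound[OF F(1) B(2)] B(1) F(2) by blast
  then show thesis using B by (intro that)
qed

lemma cdim_Suc:
  assumes A: "complex_vector.subspace A" "cfinite_dim A" and B: "complex_vector.subspace B" "B \<subseteq> A"
    and y: "y \<in> A" "y \<notin> B" and dec: "\<And>x. x \<in> A \<Longrightarrow> \<exists>c. x - c *\<^sub>C y \<in> B"
  shows "cdim A = Suc (cdim B)"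
proof -
  obtain F where F: "finite F" "F \<subseteq> B" "\<not> complex_vector.dependent F" "B \<subseteq> cspan F" "card F = cdim B"
    using cfinite_dim_basis[OF cfinite_dim_subset[OF A(2) B(2)]] .
  have span: "cspan F = B"
    using F(2,4) complex_vector.span_minimal[OF F(2) B(1)] by blast
  show ?thesis
  proof (rule complex_vector.dim_unique)
    show "insert y F \<subseteq> A" using F(2) B(2) y(1) by blast
    show "A \<subseteq> cspan (insert y F)"
      using dec by (auto simp: complex_vector.span_insert span)
    show "\<not> complex_vector.dependent (insert y F)"
      using F(3) y(2) by (simp add: complex_vector.independent_insert span)
    show "card (insert y F) = Suc (cdim B)"
      using F y(2) by (simp add: card_insert_if) blast
  qed
qed

lemma cdim_less:
  assumes A: "cfinite_dim A" and B: "complex_vector.subspace B" "B \<subseteq> A" and y: "y \<in> A" "y \<notin> B"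
  shows "cdim B < cdim A"
proof -
  obtain F where F: "finite F" "F \<subseteq> B" "\<not> complex_vector.dependent F" "B \<subseteq> cspan F" "card F = cdim B"
    using cfinite_dim_basis[OF cfinite_dim_subset[OF A(1) B(2)]] .
  obtain G where G: "finite G" "G \<subseteq> A" "\<not> complex_vector.dependent G" "A \<subseteq> cspan G" "card G = cdim A"
    using cfinite_dim_basis[OF A] .
  have "y \<notin> cspan F" using complex_vector.span_minimal[OF F(2) B(1)] y(2) by blast
  then have "\<not> complex_vector.dependent (insert y F)"
    using F(3) by (simp add: complex_vector.independent_insert)
  moreover have "insert y F \<subseteq> cspan G" using F(2) B(2) y(1) G(4) by blast
  ultimately have "card (insert y F) \<le> card G"
    using complex_vector.independent_span_bound[OF G(1)] by blast
  moreover have "y \<notin> F" using F(2) y(2) by blast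
  ultimately show ?thesis using F G by simp
qed

lemma cdim_eq_0_iff:
  assumes "cfinite_dim A"
  shows "cdim A = 0 \<longleftrightarrow> A \<subseteq> {0}"
proof
  assume 0: "cdim A = 0"
  obtain G where G: "finite G" "G \<subseteq> A" "\<not> complex_vector.dependent G" "A \<subseteq> cspan G" "card G = cdim A"
    using cfinite_dim_basis[OF assms] .
  with 0 have "G = {}" by simp
  then show "A \<subseteq> {0}" using G(4) complex_vector.span_empty by simp
next
  assume "A \<subseteq> {0}"
  then show "cdim A = 0"
    by (intro complex_vector.dim_unique[of "{}"]) (auto simp: complex_vector.independent_empty)
qed

section \<open>Rank-one operators and their removal from the projection\<close>

definition rank_one :: "'a::complex_inner \<Rightarrow> 'a \<Rightarrow> 'a cop"
  where "rank_one f e = cop_of_blinfun (Blinfun (\<lambda>x. cinner e x *\<^sub>C f))"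

lemma app_rank_one [simp]: "app (rank_one f e) x = cinner e x *\<^sub>C f"
proof -
  have "bounded_linear (\<lambda>x. cinner e x *\<^sub>C f)"
    by (rule bounded_linear_compose[OF bounded_bilinear.bounded_linear_left[OF bounded_bilinear_scaleC]
          bounded_bilinear.bounded_linear_right[OF bounded_bilinear_cinner]])
  then show ?thesis
    by (simp add: rank_one_def app.rep_eq cop_of_blinfun_inverse bounded_ops_def
        bounded_linear_Blinfun_apply cinner_scaleC_right scaleC_scaleC)
qed

lemma compact_rank_one: "compact_cop (rank_one f e)"
  unfolding compact_cop_def
proof (intro allI impI)
  fix x :: "nat \<Rightarrow> 'a" assume "bounded (range x)"
  then obtain b where b: "\<And>n. norm (x n) \<le> b" by (auto simp: bounded_iff)
  have "cmod (cinner e (x n)) \<le> norm e * b" for n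
    using norm_cinner_le[of e "x n"] mult_left_mono[OF b[of n], of "norm e"] by simp
  then have "bounded (range (\<lambda>n. cinner e (x n)))" by (auto simp: bounded_iff)
  then obtain l r where r: "strict_mono r" and "((\<lambda>n. cinner e (x n)) \<circ> r) \<longlonglongrightarrow> l"
    using bounded_imp_convergent_subsequence by blast
  then have "(\<lambda>n. rank_one f e (x (r n))) \<longlonglongrightarrow> l *\<^sub>C f"
    by (simp add: comp_def tendsto_scaleC)
  then show "\<exists>l r. strict_mono r \<and> (\<lambda>n. rank_one f e (x (r n))) \<longlonglongrightarrow> l"
    using r by blast
qed

lemma proj_rank_one: "norm e = 1 \<Longrightarrow> proj (rank_one e e)"
  by (auto simp: proj_def selfadj_iff_cinner cinner_scaleC_left cinner_scaleC_right cinner_self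
      cinner_commute[of _ e] intro!: cop_eqI)

context separable_antiunitary_root
begin

text \<open>The vector \<open>x + A x\<close> is real; if it vanishes, then
  \<open>\<i> *\<^sub>C x\<close> is real.\<close>

lemma exists_real_unit:
  assumes "eps = 1" and E: "complex_vector.subspace E" "\<And>x. x \<in> E \<Longrightarrow> A x \<in> E" "\<not> E \<subseteq> {0}"
  obtains e where "e \<in> E" "norm e = 1" "A e = e"
proof -
  obtain x where x: "x \<in> E" "x \<noteq> 0" using E(3) by blast
  have "\<exists>y\<in>E. A y = y \<and> y \<noteq> 0"
  proof (cases "x + A x = 0")
    case False
    then show ?thesis using E x assms(1)
      by (intro bexI[of _ "x + A x"]) (auto simp: A_add add.commute complex_vector.subspace_add)
  next
    case True
    then have "A x = - x" by (simp add: add_eq_0_iff)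
    then show ?thesis using E x
      by (intro bexI[of _ "\<i> *\<^sub>C x"]) (auto simp: A_scaleC complex_vector.subspace_scale)
  qed
  then obtain y where y: "y \<in> E" "A y = y" "y \<noteq> 0" by blast
  then obtain r where r: "norm (r *\<^sub>R y) = 1" using exists_unit_multiple by blast
  have "r *\<^sub>R y \<in> E" using complex_vector.subspace_scale[OF E(1) y(1), of r] by (simp add: scaleR_eq_scaleC)
  then show thesis using r y by (intro that[of "r *\<^sub>R y"]) (simp_all add: A_scaleR)
qed

lemma compression_kernel_A:
  assumes "comm L" "anticomm U" "x \<in> compression_kernel L U"
  shows "A x \<in> compression_kernel L U"
  using assms by (simp add: compression_kernel_def anticommD flip: commD[of L])
    (simp add: commD)

definition parity :: "'a cop \<Rightarrow> 'a cop \<Rightarrow> bit"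
  where "parity L U = of_nat (cdim (compression_kernel L U))"

text \<open>Removing a real unit vector \<open>e\<close> from the range of \<open>L\<close> changes the compression kernel by one
  dimension: it becomes smaller if \<open>e\<close> is not orthogonal to it, and it acquires a solution of
  \<open>diag_part L U y = e\<close> otherwise.\<close>

context
  fixes L :: "'a cop" and e :: 'a
  assumes L: "proj L" "comm L" and e: "L e = e" "norm e = 1" "A e = e" and eps1: "eps = 1"
begin

lemma proj_remove: "proj (L - rank_one e e)"
proof (rule proj_diff[OF L(1) proj_rank_one[OF e(2)]])
  show "L * rank_one e e = rank_one e e" by (rule cop_eqI) (simp add: e)
qed

lemma cinner_e_A: "cinner e (A x) = cnj (cinner e x)"
  using cinner_A[of e x] e(3) by (simp add: cinner_commute[of x])

lemma cinner_e_L: "cinner e (app L x) = cinner e x"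
  using selfadj_cinnerD[OF proj_selfadj[OF L(1)], of e x] e(1) by simp

lemma cinner_e_e: "cinner e e = 1"
  using e(2) by (simp add: cinner_self)

lemma comm_remove: "comm (L - rank_one e e)"
proof -
  have "comm (rank_one e e)" by (simp add: comm_def cinner_e_A A_scaleC e)
  then show ?thesis using L(2) by (rule comm_diff[rotated])
qed

lemma nsaus_remove: "nsaus (L - rank_one e e) = nsaus L"
proof -
  let ?P = "rank_one e e"
  have K: "compact_cop (U * ?P - ?P * U)" for U
    using compact_rank_one[of e e] by (intro compact_cop_diff compact_cop_mult_left compact_cop_mult_right)
  have 1: "U * (L - ?P) - (L - ?P) * U = (U * L - L * U) - (U * ?P - ?P * U)"
    "U * L - L * U = (U * (L - ?P) - (L - ?P) * U) + (U * ?P - ?P * U)" for U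
    by (simp_all add: algebra_simps)
  show ?thesis
    unfolding nsaus_def using compact_cop_diff[OF _ K] compact_cop_add[OF _ K] 1 by (metis (no_types, lifting))
qed

lemma mem_compression_kernel_remove:
  "x \<in> compression_kernel (L - rank_one e e) U
    \<longleftrightarrow> L x = x \<and> cinner e x = 0 \<and> L (U x) = cinner e (U x) *\<^sub>C e"
proof -
  have "L x - cinner e x *\<^sub>C e = x \<longleftrightarrow> L x = x \<and> cinner e x = 0"
  proof
    assume x: "L x - cinner e x *\<^sub>C e = x"
    have "cinner e (L x - cinner e x *\<^sub>C e) = 0"
      by (simp add: cinner_diff_right cinner_scaleC_right cinner_e_L cinner_e_e)
    then have "cinner e x = 0" by (simp add: x)
    with x show "L x = x \<and> cinner e x = 0" by simp
  qed simp
  then show ?thesis by (auto simp: compression_kernel_def)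
qed

text \<open>For \<open>x\<close> in the kernel of the smaller compression, \<open>L (U x)\<close> is
  a multiple of \<open>e\<close>. Its inner product with \<open>z\<close> vanishes because
  \<open>L (U z) = 0\<close>, and \<open>z\<close> is not orthogonal to \<open>e\<close>, so the
  multiple is 0.\<close>

lemma cdim_remove:
  assumes U: "U \<in> nsaus L" and z: "z \<in> compression_kernel L U" "cinner e z \<noteq> 0"
  shows "compression_kernel (L - rank_one e e) U \<subseteq> compression_kernel L U"
    and "cdim (compression_kernel L U) = Suc (cdim (compression_kernel (L - rank_one e e) U))"
proof -
  have s: "selfadj U" using sausD(4)[OF nsausD(1)[OF U]] .
  show sub: "compression_kernel (L - rank_one e e) U \<subseteq> compression_kernel L U"
  proof
    fix x assume "x \<in> compression_kernel (L - rank_one e e) U"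
    then have x: "L x = x" "L (U x) = cinner e (U x) *\<^sub>C e" by (simp_all add: mem_compression_kernel_remove)
    have "cnj (cinner e (U x)) * cinner e z = cinner (L (U x)) z"
      by (simp add: x cinner_scaleC_left)
    also have "\<dots> = cinner (L x) (U z)"
      using z(1) by (simp add: selfadj_cinnerD[OF proj_selfadj[OF L(1)]] selfadj_cinnerD[OF s] compression_kernel_def x(1))
    also have "\<dots> = 0"
      using z(1) by (simp only: selfadj_cinnerD[OF proj_selfadj[OF L(1)]]) (simp add: compression_kernel_def)
    finally have "cinner e (U x) = 0" using z(2) by simp
    then show "x \<in> compression_kernel L U" using x by (simp add: compression_kernel_def)
  qed
  show "cdim (compression_kernel L U) = Suc (cdim (compression_kernel (L - rank_one e e) U))"
  proof (rule cdim_Suc[OF subspace_compression_kernel cfinite_dim_compression_kernel[OF L U]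
        subspace_compression_kernel sub z(1)])
    show "z \<notin> compression_kernel (L - rank_one e e) U" using z(2) by (simp add: mem_compression_kernel_remove)
    fix x assume x: "x \<in> compression_kernel L U"
    define w where "w = x - (cinner e x / cinner e z) *\<^sub>C z"
    have w: "w \<in> compression_kernel L U"
      unfolding w_def using x z(1) subspace_compression_kernel
      by (intro complex_vector.subspace_diff complex_vector.subspace_scale)
    have "cinner e (U w) = cinner e (L (U w))" by (simp add: cinner_e_L)
    also have "\<dots> = 0" using w by (simp add: compression_kernel_def)
    finally have "w \<in> compression_kernel (L - rank_one e e) U"
      using w z(2) by (simp add: mem_compression_kernel_remove compression_kernel_def)
        (simp add: w_def cinner_diff_right cinner_scaleC_right)
    then show "\<exists>c. x - c *\<^sub>C z \<in> compression_kernel (L - rank_one e e) U"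
      unfolding w_def by blast
  qed
qed

text \<open>Off its kernel the diagonal part T has an invertible square, and \<open>y\<close> is T
  applied to the inverse of that square at \<open>e\<close>. Orthogonality to \<open>e\<close> rests
  on the symmetry: \<open>cinner e y\<close> is real since T is self-adjoint, and imaginary since T
  anti-commutes with \<open>A\<close>.\<close>

lemma exists_diag_preimage:
  assumes U: "U \<in> nsaus L" and orth: "\<And>z. z \<in> compression_kernel L U \<Longrightarrow> cinner e z = 0"
  obtains y where "L y = y" "diag_part L U y = e" "cinner e y = 0"
proof -
  let ?D = "off_diag L U" and ?T = "diag_part L U"
  obtain Q where Q: "proj Q" "\<forall>x. Q x = x \<longleftrightarrow> ?T x = 0" "norm (?D * ?D * (1 - Q)) < 1"
    "?D * ?D * Q = Q" "Q * L = L * Q" "Q * U = U * Q" "comm Q" "Q * (?D * ?D) = Q"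
    using exists_diag_kernel_proj[OF L U] .
  \<comment> \<open>With this choice \<open>1 - X\<close> is the square of the diagonal part plus
    \<open>Q\<close>, and the square of its inverse square root \<open>I\<close> inverts it.\<close>
  define X where "X = ?D * ?D * (1 - Q)"
  have X: "X = ?D * ?D - Q" unfolding X_def right_diff_distrib Q(4) by simp
  have QQ: "Q * Q = Q" using Q(1) by (rule proj_idem)
  have QX: "Q * X = X * Q" unfolding X right_diff_distrib left_diff_distrib Q(4,8) QQ by simp
  have LT: "L * (?T * ?T) = (?T * ?T) * L"
    by (simp add: mult.assoc diag_commute[OF L U] flip: mult.assoc[of L ?T])
  have D2: "?D * ?D = 1 - ?T * ?T" using diag_off_diag_square[OF L U] by simp
  have LX: "L * X = X * L" unfolding X D2 using LT Q(5) by (simp add: algebra_simps)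
  define I where "I = isqrt_compl X"
  have nX: "norm X < 1" using Q(3) by (simp add: X_def)
  have QI: "Q * I = I * Q" and LI: "L * I = I * L"
    unfolding I_def using isqrt_compl_commute[OF nX] QX LX by blast+
  define w where "w = I (I e)"
  have Qe: "Q e = 0"
  proof -
    have "?T (Q e) = 0" using Q(2)[rule_format, of "app Q e"] Q(1) by (simp add: proj_idem)
    then have "cinner e (L (Q e)) = 0" by (intro orth compression_kernel_diag_kernel[OF L U])
    then have "cinner e (Q e) = 0" by (simp add: cinner_e_L)
    then have "cinner (Q e) (Q e) = 0"
      using selfadj_cinnerD[OF proj_selfadj[OF Q(1)], of e "Q e"] Q(1) by (simp add: proj_idem)
    then show ?thesis by simp
  qed
  have II: "T * (I * I) = (I * I) * T" if "T * I = I * T" for T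
  proof -
    have "T * (I * I) = (T * I) * I" by (simp only: mult.assoc)
    also have "\<dots> = I * (T * I)" by (simp only: that mult.assoc)
    also have "\<dots> = (I * I) * T" by (simp only: that mult.assoc)
    finally show ?thesis .
  qed
  have Qw: "Q w = 0"
    using arg_cong[OF II[OF QI], of "\<lambda>T. app T e"] Qe by (simp add: w_def)
  have Lw: "L w = w"
    using arg_cong[OF II[OF LI], of "\<lambda>T. app T e"] e(1) by (simp add: w_def)
  have "(1 - X) * (I * I) = 1" unfolding I_def by (rule isqrt_compl_square[OF nX])
  from arg_cong[OF this, of "\<lambda>T. app T e"] have "w - X w = e" by (simp add: w_def)
  then have TTw: "?T (?T w) = e" unfolding X D2 by (simp add: Qw)
  define y where "y = ?T w"
  have Ty: "?T y = e" using TTw by (simp add: y_def)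
  have Ly: "L y = y" using arg_cong[OF diag_commute[OF L U], of "\<lambda>T. app T w"] Lw by (simp add: y_def)
  have "?T (y + A y) = 0"
    using Ty e(3) by (simp add: anticommD[OF diag_anticomm[OF L U]])
  then have "L (y + A y) \<in> compression_kernel L U" by (rule compression_kernel_diag_kernel[OF L U])
  then have "cinner e (y + A y) = 0" using orth cinner_e_L by metis
  moreover have "cinner e y = cnj (cinner e y)"
  proof -
    have "cinner e y = cinner (?T y) y" by (simp add: Ty)
    also have "\<dots> = cinner y (?T y)" by (rule selfadj_cinnerD[OF diag_selfadj[OF L U]])
    finally have "cinner e y = cinner y e" by (simp only: Ty)
    then show ?thesis by (simp add: cinner_commute[of y])
  qed
  ultimately have "2 * cinner e y = 0" by (simp add: cinner_add_right cinner_e_A)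
  then have "cinner e y = 0" by simp
  then show thesis by (intro that[of y] Ly Ty)
qed

lemma parity_remove:
  assumes U: "U \<in> nsaus L"
  shows "parity (L - rank_one e e) U = parity L U + 1"
proof (cases "\<forall>z\<in>compression_kernel L U. cinner e z = 0")
  case False
  then obtain z where "z \<in> compression_kernel L U" "cinner e z \<noteq> 0" by blast
  from cdim_remove(2)[OF U this] show ?thesis by (simp add: parity_def add.assoc)
next
  case True
  then obtain y where y: "L y = y" "diag_part L U y = e" "cinner e y = 0"
    using exists_diag_preimage[OF U] by blast
  have LU: "L (U y) = e" using diag_eq(1)[OF L(1) y(1), of U] y(2) by simp
  have U': "U \<in> nsaus (L - rank_one e e)" using U nsaus_remove by simp
  have "cdim (compression_kernel (L - rank_one e e) U) = Suc (cdim (compression_kernel L U))"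
  proof (rule cdim_Suc[OF subspace_compression_kernel
        cfinite_dim_compression_kernel[OF proj_remove comm_remove U'] subspace_compression_kernel])
    show "compression_kernel L U \<subseteq> compression_kernel (L - rank_one e e) U"
    proof
      fix x assume x: "x \<in> compression_kernel L U"
      have "cinner e (U x) = cinner e (L (U x))" by (simp add: cinner_e_L)
      then show "x \<in> compression_kernel (L - rank_one e e) U"
        using x True by (simp add: mem_compression_kernel_remove compression_kernel_def)
    qed
    have "cinner e (U y) = 1" using cinner_e_L[of "U y"] by (simp add: LU cinner_e_e)
    then show "y \<in> compression_kernel (L - rank_one e e) U"
      using y LU by (simp add: mem_compression_kernel_remove)
    have "e \<noteq> 0" using e(2) by auto
    then show "y \<notin> compression_kernel L U" by (simp add: compression_kernel_def LU)
    fix x assume "x \<in> compression_kernel (L - rank_one e e) U"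
    then have "L x = x" "L (U x) = cinner e (U x) *\<^sub>C e" by (simp_all add: mem_compression_kernel_remove)
    then have "x - cinner e (U x) *\<^sub>C y \<in> compression_kernel L U"
      using y LU by (simp add: compression_kernel_def)
    then show "\<exists>c. x - c *\<^sub>C y \<in> compression_kernel L U" by blast
  qed
  then show ?thesis by (simp add: parity_def add.commute)
qed

lemma infinite_dim_remove:
  "\<not> cfinite_dim {x. L x = x} \<Longrightarrow> \<not> cfinite_dim {x. (L - rank_one e e) x = x}"
  "\<not> cfinite_dim {x. (1 - L) x = x} \<Longrightarrow> \<not> cfinite_dim {x. (1 - (L - rank_one e e)) x = x}"
proof -
  show "\<not> cfinite_dim {x. (L - rank_one e e) x = x}" if "\<not> cfinite_dim {x. L x = x}"
  proof
    assume fin: "cfinite_dim {x. (L - rank_one e e) x = x}"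
    have "cfinite_dim (cspan {e})" by (auto simp: cfinite_dim_def intro!: exI[of _ "{e}"])
    from fin this have "cfinite_dim {x. L x = x}"
    proof (rule cfinite_dim_sum)
      fix x assume "x \<in> {x. L x = x}"
      then show "\<exists>s\<in>{x. (L - rank_one e e) x = x}. \<exists>t\<in>cspan {e}. x = s + t"
        by (intro bexI[of _ "x - cinner e x *\<^sub>C e"] bexI[of _ "cinner e x *\<^sub>C e"])
          (auto simp: e cinner_diff_right cinner_scaleC_right cinner_e_e
            intro: complex_vector.span_scale complex_vector.span_base)
    qed
    with that show False by simp
  qed
  show "\<not> cfinite_dim {x. (1 - (L - rank_one e e)) x = x}" if "\<not> cfinite_dim {x. (1 - L) x = x}"
  proof -
    have "{x. (1 - L) x = x} \<subseteq> {x. (1 - (L - rank_one e e)) x = x}"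
    proof
      fix x assume "x \<in> {x. (1 - L) x = x}"
      then have "L x = 0" by simp
      then have "cinner e x = 0" using cinner_e_L[of x] by simp
      then show "x \<in> {x. (1 - (L - rank_one e e)) x = x}" using \<open>L x = 0\<close> by simp
    qed
    then show ?thesis using that cfinite_dim_subset by blast
  qed
qed

end

text \<open>Induction with \<open>U\<close> fixed and \<open>L\<close> varying. Removing a real
  \<open>e\<close> in the compression kernel from \<open>L\<close> lowers the dimension by one,
  leaves the space unchanged and flips the parity of all its elements, so one radius
  \<open>d\<close> serves both projections.\<close>

lemma parity_locally_constant:
  assumes eps1: "eps = 1" and "proj L" "comm L" "U \<in> nsaus L"
  shows "\<exists>d>0. \<forall>U'\<in>nsaus L. norm (U - U') < d \<longrightarrow> parity L U' = parity L U"
  using assms(2-)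
proof (induction "cdim (compression_kernel L U)" arbitrary: L)
  case 0
  note L = 0(2,3) and U = 0(4)
  have triv: "compression_kernel L U \<subseteq> {0}"
    using 0(1) cdim_eq_0_iff[OF cfinite_dim_compression_kernel[OF L U]] by simp
  let ?D = "off_diag L U"
  \<comment> \<open>\<open>d\<close> bounds the diagonal part of \<open>U\<close> from below, whose
    square is 1 minus that of the off-diagonal part. A perturbation smaller than \<open>d\<close>
    keeps the compression injective.\<close>
  define d where "d = sqrt (1 - norm (?D * ?D))"
  have d: "d > 0" using norm_off_diag_less(1)[OF L U triv] by (simp add: d_def)
  have "parity L U' = parity L U" if U': "U' \<in> nsaus L" and less: "norm (U - U') < d" for U'
  proof -
    have "compression_kernel L U' \<subseteq> {0}"
    proof
      fix x assume "x \<in> compression_kernel L U'"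
      then have x: "L x = x" "L (U' x) = 0" by (simp_all add: compression_kernel_def)
      have T: "diag_part L U x = L ((U - U') x)" using diag_eq(1)[OF L(1) x(1), of U] x(2) by simp
      have "norm (diag_part L U x) \<le> norm ((U - U') x)" unfolding T by (rule norm_proj_le[OF L(1)])
      also have "\<dots> \<le> norm (U - U') * norm x" by (rule norm_app_le)
      finally have "(norm (diag_part L U x))\<^sup>2 \<le> (norm (U - U') * norm x)\<^sup>2" by (simp add: power_mono)
      moreover have "(norm (diag_part L U x))\<^sup>2 \<ge> (d * norm x)\<^sup>2"
      proof -
        have "inner ((?D * ?D) x) x \<le> norm ((?D * ?D) x) * norm x" by (rule norm_cauchy_schwarz)
        also have "\<dots> \<le> norm (?D * ?D) * norm x * norm x"
          by (intro mult_right_mono norm_app_le) simp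
        finally have "inner ((?D * ?D) x) x \<le> norm (?D * ?D) * (norm x)\<^sup>2"
          by (simp add: power2_eq_square mult.assoc)
        moreover have "(norm (diag_part L U x))\<^sup>2 = (norm x)\<^sup>2 - inner ((?D * ?D) x) x"
          unfolding norm_square_selfadj[OF diag_selfadj[OF L U]] diag_off_diag_square[OF L U]
          by (simp add: inner_diff_left power2_norm_eq_inner)
        moreover have "(d * norm x)\<^sup>2 = (norm x)\<^sup>2 - norm (?D * ?D) * (norm x)\<^sup>2"
          using norm_off_diag_less(1)[OF L U triv]
          by (simp add: d_def power_mult_distrib left_diff_distrib)
        ultimately show ?thesis by linarith
      qed
      ultimately have "(d * norm x)\<^sup>2 \<le> (norm (U - U') * norm x)\<^sup>2" by linarith
      then have "d * norm x \<le> norm (U - U') * norm x" by (rule power2_le_imp_le) simp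
      then show "x \<in> {0}" using less by (auto simp: mult_le_cancel_right)
    qed
    then show ?thesis
      using 0(1) cdim_eq_0_iff[OF cfinite_dim_compression_kernel[OF L U']] by (simp add: parity_def)
  qed
  then show ?case using d by blast
next
  case (Suc n)
  note L = Suc(3,4) and U = Suc(5)
  have "\<not> compression_kernel L U \<subseteq> {0}"
    using Suc(2) cdim_eq_0_iff[OF cfinite_dim_compression_kernel[OF L U]] by simp
  then obtain e where e: "e \<in> compression_kernel L U" "norm e = 1" "A e = e"
    using exists_real_unit[OF eps1 subspace_compression_kernel]
      compression_kernel_A[OF L(2) sausD(5)[OF nsausD(1)[OF U]]] by blast
  have Le: "L e = e" using e(1) by (simp add: compression_kernel_def)
  note r = L Le e(2,3) eps1
  let ?L = "L - rank_one e e"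
  have "cdim (compression_kernel L U) = Suc (cdim (compression_kernel ?L U))"
    using e(2) by (intro cdim_remove(2)[OF r U e(1)]) (simp add: cinner_self)
  then have n: "n = cdim (compression_kernel ?L U)" using Suc(2) by simp
  have U': "U \<in> nsaus ?L" using U nsaus_remove[OF r] by simp
  obtain d where d: "d > 0" "\<forall>U'\<in>nsaus ?L. norm (U - U') < d \<longrightarrow> parity ?L U' = parity ?L U"
    using Suc(1)[OF n proj_remove[OF r] comm_remove[OF r] U'] by blast
  then show ?case
    using parity_remove[OF r] nsaus_remove[OF r] U by (metis add_right_cancel)
qed

section \<open>Path components and parity\<close>

lemma parity_path_component:
  assumes eps1: "eps = 1" and L: "proj L" "comm L" and UV: "path_component (nsaus L) U V"
  shows "parity L U = parity L V"
proof -
  obtain g where g: "path g" "path_image g \<subseteq> nsaus L" "pathstart g = U" "pathfinish g = V"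
    using UV unfolding path_component_def by blast
  have cont: "continuous_on {0..1} g" using g(1) by (simp add: path_def)
  have "parity L (g 0) = parity L (g 1)"
  proof (rule connected_local_const[of "{0..1}" 0 1 "\<lambda>t. parity L (g t)"])
    show "\<forall>a\<in>{0..1}. \<forall>\<^sub>F b in at a within {0..1}. parity L (g a) = parity L (g b)"
    proof
      fix a :: real assume a: "a \<in> {0..1}"
      have gn: "g t \<in> nsaus L" if "t \<in> {0..1}" for t using g(2) that by (auto simp: path_image_def)
      obtain d where d: "d > 0" "\<forall>U'\<in>nsaus L. norm (g a - U') < d \<longrightarrow> parity L U' = parity L (g a)"
        using parity_locally_constant[OF eps1 L gn[OF a]] by blast
      have "(g \<longlongrightarrow> g a) (at a within {0..1})" using cont a by (simp add: continuous_on)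
      then have "\<forall>\<^sub>F b in at a within {0..1}. dist (g b) (g a) < d" using d(1) by (rule tendstoD)
      moreover have "\<forall>\<^sub>F b in at a within {0..1}. b \<in> {0..1::real}"
        by (simp add: eventually_at_filter)
      ultimately show "\<forall>\<^sub>F b in at a within {0..1}. parity L (g a) = parity L (g b)"
      proof eventually_elim
        case (elim b)
        then show ?case using d(2) gn[of b] by (metis dist_commute dist_norm)
      qed
    qed
  qed auto
  then show ?thesis using g(3,4) by (simp add: pathstart_def pathfinish_def)
qed

lemma path_to_commuting_real:
  assumes eps1: "eps = 1" and L: "proj L" "comm L" and "U \<in> nsaus L" "parity L U = 0"
  shows "\<exists>V. V \<in> saus 1 \<and> L * V = V * L \<and> path_component (nsaus L) U V"
  using assms(4,5)
proof (induction "cdim (compression_kernel L U)" arbitrary: U rule: less_induct)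
  case less
  note U = less(2)
  note fin = cfinite_dim_compression_kernel[OF L U]
  have aU: "anticomm U" using sausD(5)[OF nsausD(1)[OF U]] .
  show ?case
  proof (cases "compression_kernel L U \<subseteq> {0}")
    case True
    show ?thesis using path_to_commuting[OF L U True] by blast
  next
    case False
    then obtain e where e: "e \<in> compression_kernel L U" "norm e = 1" "A e = e"
      using exists_real_unit[OF eps1 subspace_compression_kernel] compression_kernel_A[OF L(2) aU] by blast
    have Le: "L e = e" using e(1) by (simp add: compression_kernel_def)
    note r = L Le e(2,3) eps1
    let ?L = "L - rank_one e e"
    have ee: "cinner e e = 1" using e(2) by (simp add: cinner_self)
    then have "cinner e e \<noteq> 0" by simp
    note rem = cdim_remove[OF r U e(1) this]
    have U': "U \<in> nsaus ?L" using U nsaus_remove[OF r] by simp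
    \<comment> \<open>The dimension is even and not zero, so something remains after the loss of one
      dimension.\<close>
    have "\<not> compression_kernel ?L U \<subseteq> {0}"
    proof
      assume "compression_kernel ?L U \<subseteq> {0}"
      then have "cdim (compression_kernel ?L U) = 0"
        using cdim_eq_0_iff[OF cfinite_dim_compression_kernel[OF proj_remove[OF r] comm_remove[OF r] U']] by simp
      then show False using rem(2) less(3) by (simp add: parity_def)
    qed
    then obtain f where f: "f \<in> compression_kernel ?L U" "norm f = 1" "A f = f"
      using exists_real_unit[OF eps1 subspace_compression_kernel] compression_kernel_A[OF comm_remove[OF r] aU] by blast
    have ef: "cinner e f = 0" using f(1) mem_compression_kernel_remove[OF r] by blast
    then have fe: "cinner f e = 0" by (simp add: cinner_eq_0_commute)
    have ff: "cinner f f = 1" using f(2) by (simp add: cinner_self)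
    have fk: "f \<in> compression_kernel L U" using f(1) rem(1) by blast
    define P where "P = rank_one e e + rank_one f f"
    \<comment> \<open>In the real basis \<open>e\<close>, \<open>f\<close> this is
      \<open>\<i>\<close> times a real antisymmetric matrix, hence self-adjoint and anti-commuting
      with \<open>A\<close>. A single real vector admits no such operator.\<close>
    define Z where "Z = rank_one (\<i> *\<^sub>C f) e - rank_one (\<i> *\<^sub>C e) f"
    note s = cinner_add_left cinner_add_right cinner_diff_left cinner_diff_right cinner_scaleC_left cinner_scaleC_right
    have Z: "Z \<in> saus P"
    proof (rule sausI)
      show "Z * Z = P" "P * Z = Z"
        by (rule cop_eqI; simp add: Z_def P_def s ee ff ef fe scaleC_scaleC mult.assoc)+
      show "selfadj Z"
        unfolding selfadj_iff_cinner
        by (simp add: Z_def s cinner_commute[of _ e] cinner_commute[of _ f])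
      show "anticomm Z"
        unfolding anticomm_def
        by (simp add: Z_def A_diff A_scaleC e f scaleC_scaleC cinner_e_A[OF r] cinner_e_A[OF L compression_kernelD(1)[OF fk] f(2,3) eps1])
    qed
    have P: "P x \<in> compression_kernel L U" for x
      unfolding P_def using e(1) fk
      by (simp add: complex_vector.subspace_add[OF subspace_compression_kernel]
          complex_vector.subspace_scale[OF subspace_compression_kernel])
    obtain U1 where U1: "U1 \<in> nsaus L" "path_component (nsaus L) U U1"
      "compression_kernel L U1 = {x \<in> compression_kernel L U. P x = 0}"
      using shrink_compression_kernel[OF L U Z P] .
    have "P e = e" by (simp add: P_def ee fe)
    then have "e \<notin> compression_kernel L U1" using U1(3) e(2) by auto
    then have "cdim (compression_kernel L U1) < cdim (compression_kernel L U)"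
      using U1(3) by (intro cdim_less[OF fin subspace_compression_kernel _ e(1)]) auto
    moreover have "parity L U1 = 0"
      using parity_path_component[OF eps1 L U1(2)] less(3) by simp
    ultimately show ?thesis
      using less(1)[OF _ U1(1)] path_component_trans[OF U1(2)] by blast
  qed
qed

lemma path_to_commuting_quaternionic:
  assumes eps: "eps = - 1" and L: "proj L" "comm L" and "U \<in> nsaus L"
  shows "\<exists>V. V \<in> saus 1 \<and> L * V = V * L \<and> path_component (nsaus L) U V"
  using assms(4)
proof (induction "cdim (compression_kernel L U)" arbitrary: U rule: less_induct)
  case less
  note U = less(2)
  note fin = cfinite_dim_compression_kernel[OF L U]
  have aU: "anticomm U" using sausD(5)[OF nsausD(1)[OF U]] .
  show ?case
  proof (cases "compression_kernel L U \<subseteq> {0}")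
    case True
    show ?thesis using path_to_commuting[OF L U True] by blast
  next
    case False
    then obtain x where x: "x \<in> compression_kernel L U" "x \<noteq> 0" by blast
    then obtain t where t: "norm (t *\<^sub>R x) = 1" using exists_unit_multiple by blast
    define e where "e = t *\<^sub>R x"
    have e: "e \<in> compression_kernel L U" "norm e = 1"
      using complex_vector.subspace_scale[OF subspace_compression_kernel x(1), of t] t
      by (simp_all add: e_def scaleR_eq_scaleC)
    \<comment> \<open>The kernel is invariant under \<open>A\<close>, so each vector brings its
      orthogonal Kramers partner along and no parity condition arises.\<close>
    define f where "f = A e"
    have fk: "f \<in> compression_kernel L U" unfolding f_def by (rule compression_kernel_A[OF L(2) aU e(1)])
    have fe: "cinner f e = 0" by (simp add: f_def cinner_A_self[OF eps])
    then have ef: "cinner e f = 0" by (simp add: cinner_eq_0_commute)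
    have ee: "cinner e e = 1" "cinner f f = 1" using e(2) by (simp_all add: cinner_self f_def)
    have Af: "A f = - e" by (simp add: f_def eps)
    have eA: "cinner e (A x) = - cnj (cinner f x)" "cinner f (A x) = cnj (cinner e x)" for x
    proof -
      show "cinner f (A x) = cnj (cinner e x)"
        by (simp add: f_def cinner_A cinner_commute[of x])
      have "cinner (A f) (A x) = cinner x f" by (rule cinner_A)
      then show "cinner e (A x) = - cnj (cinner f x)"
        by (simp add: Af cinner_commute[of x] minus_equation_iff[of "cinner e (A x)"])
    qed
    define P where "P = rank_one e e + rank_one f f"
    define Z where "Z = rank_one e e - rank_one f f"
    note s = cinner_add_left cinner_add_right cinner_diff_left cinner_diff_right cinner_scaleC_left cinner_scaleC_right
    have Z: "Z \<in> saus P"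
    proof (rule sausI)
      show "Z * Z = P" "P * Z = Z"
        by (rule cop_eqI; simp add: Z_def P_def s ee ef fe scaleC_scaleC)+
      show "selfadj Z"
        unfolding selfadj_iff_cinner
        by (simp add: Z_def s cinner_commute[of _ e] cinner_commute[of _ f])
      show "anticomm Z"
        unfolding anticomm_def
        by (simp add: Z_def A_diff A_scaleC eA Af f_def[symmetric])
    qed
    have P: "P x \<in> compression_kernel L U" for x
      unfolding P_def using e(1) fk
      by (simp add: complex_vector.subspace_add[OF subspace_compression_kernel]
          complex_vector.subspace_scale[OF subspace_compression_kernel])
    obtain U1 where U1: "U1 \<in> nsaus L" "path_component (nsaus L) U U1"
      "compression_kernel L U1 = {x \<in> compression_kernel L U. P x = 0}"
      using shrink_compression_kernel[OF L U Z P] .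
    have "P e = e" by (simp add: P_def ee fe)
    then have "e \<notin> compression_kernel L U1" using U1(3) e(2) by auto
    then have "cdim (compression_kernel L U1) < cdim (compression_kernel L U)"
      using U1(3) by (intro cdim_less[OF fin subspace_compression_kernel _ e(1)]) auto
    then show ?thesis
      using less(1)[OF _ U1(1)] path_component_trans[OF U1(2)] by blast
  qed
qed

lemma nsaus_path_connected_even:
  assumes eps1: "eps = 1" and L: "proj L" "comm L"
    and inf: "\<not> cfinite_dim {x. L x = x}" "\<not> cfinite_dim {x. (1 - L) x = x}"
    and U: "U \<in> nsaus L" "parity L U = 0" and V: "V \<in> nsaus L" "parity L V = 0"
  shows "path_component (nsaus L) U V"
proof -
  obtain U' where U': "U' \<in> saus 1" "L * U' = U' * L" "path_component (nsaus L) U U'"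
    using path_to_commuting_real[OF eps1 L U] by blast
  obtain V' where V': "V' \<in> saus 1" "L * V' = V' * L" "path_component (nsaus L) V V'"
    using path_to_commuting_real[OF eps1 L V] by blast
  show ?thesis
    using path_component_trans[OF path_component_trans[OF U'(3) commuting_path_component[OF L inf U'(1,2) V'(1,2)]]
        path_component_sym[OF V'(3)]] .
qed

lemma exists_even:
  assumes eps1: "eps = 1" and L: "proj L" "comm L"
    and inf: "\<not> cfinite_dim {x. L x = x}" "\<not> cfinite_dim {x. (1 - L) x = x}"
  shows "\<exists>U\<in>nsaus L. parity L U = 0"
proof -
  have "saus L \<noteq> {}" "saus (1 - L) \<noteq> {}"
    using exists_saus_real[OF eps1] L inf proj_compl comm_diff comm_1 by blast+
  then obtain V where V: "V \<in> saus 1" "L * V = V * L" using exists_commuting[OF L] by blast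
  have VN: "V \<in> nsaus L" using V by (rule nsausI_commute)
  \<comment> \<open>An operator commuting with \<open>L\<close> has an invertible
    compression.\<close>
  have "compression_kernel L V \<subseteq> {0}"
  proof
    fix x assume "x \<in> compression_kernel L V"
    then have "V x = 0" using arg_cong[OF V(2), of "\<lambda>T. app T x"] by (simp add: compression_kernel_def)
    then show "x \<in> {0}" using arg_cong[OF sausD(1)[OF V(1)], of "\<lambda>T. app T x"] by simp
  qed
  then have "parity L V = 0"
    using cdim_eq_0_iff[OF cfinite_dim_compression_kernel[OF L VN]] by (simp add: parity_def)
  with VN show ?thesis by blast
qed

lemma nsaus_parity:
  assumes eps1: "eps = 1" and L: "proj L" "comm L"
    and inf: "\<not> cfinite_dim {x. L x = x}" "\<not> cfinite_dim {x. (1 - L) x = x}"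
  shows "\<And>U V. U \<in> nsaus L \<Longrightarrow> V \<in> nsaus L \<Longrightarrow> path_component (nsaus L) U V \<longleftrightarrow> parity L U = parity L V"
    and "\<And>b. \<exists>U\<in>nsaus L. parity L U = b"
proof -
  have "A x \<in> {x. L x = x}" if "x \<in> {x. L x = x}" for x using that L(2) by (simp add: commD)
  moreover have "\<not> {x. L x = x} \<subseteq> {0}"
  proof
    assume "{x. L x = x} \<subseteq> {0}"
    then have "cfinite_dim {x. L x = x}" by (auto simp: cfinite_dim_def intro!: exI[of _ "{}"])
    then show False using inf(1) by simp
  qed
  ultimately obtain e where e: "L e = e" "norm e = 1" "A e = e"
    using exists_real_unit[OF eps1 subspace_fixed, of L] by blast
  note r = L e eps1
  let ?L = "L - rank_one e e"
  note inf' = infinite_dim_remove(1)[OF r inf(1)] infinite_dim_remove(2)[OF r inf(2)]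
  have odd: "parity ?L U = 0" if "U \<in> nsaus L" "parity L U \<noteq> 0" for U
    using parity_remove[OF r that(1)] that(2) by (cases "parity L U") auto
  show "path_component (nsaus L) U V \<longleftrightarrow> parity L U = parity L V" if U: "U \<in> nsaus L" and V: "V \<in> nsaus L" for U V
  proof
    assume eq: "parity L U = parity L V"
    show "path_component (nsaus L) U V"
    proof (cases "parity L U = 0")
      case True
      then show ?thesis using eq by (intro nsaus_path_connected_even[OF eps1 L inf U _ V]) auto
    next
      case False
      have "path_component (nsaus ?L) U V"
        using odd False eq U V nsaus_remove[OF r]
        by (intro nsaus_path_connected_even[OF eps1 proj_remove[OF r] comm_remove[OF r] inf']) auto
      then show ?thesis by (simp only: nsaus_remove[OF r])
    qed
  qed (rule parity_path_component[OF eps1 L])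
  show "\<exists>U\<in>nsaus L. parity L U = b" for b
  proof (cases "b = 0")
    case True
    then show ?thesis using exists_even[OF eps1 L inf] by simp
  next
    case False
    obtain U where U: "U \<in> nsaus L" "parity ?L U = 0"
      using exists_even[OF eps1 proj_remove[OF r] comm_remove[OF r] inf'] nsaus_remove[OF r] by blast
    then have "parity L U + 1 = 0" using parity_remove[OF r U(1)] by simp
    then have "parity L U = b" using False by (cases "parity L U"; cases b) auto
    then show ?thesis using U by blast
  qed
qed

lemma nsaus_quaternionic:
  assumes eps: "eps = - 1" and L: "proj L" "comm L"
    and inf: "\<not> cfinite_dim {x. L x = x}" "\<not> cfinite_dim {x. (1 - L) x = x}"
  shows "nsaus L \<noteq> {}" "\<And>U V. U \<in> nsaus L \<Longrightarrow> V \<in> nsaus L \<Longrightarrow> path_component (nsaus L) U V"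
proof -
  have "saus L \<noteq> {}" "saus (1 - L) \<noteq> {}"
    using exists_saus_quaternionic[OF eps] L proj_compl comm_diff comm_1 by blast+
  then obtain V where "V \<in> saus 1" "L * V = V * L" using exists_commuting[OF L] by blast
  then show "nsaus L \<noteq> {}" using nsausI_commute by blast
  fix U V assume U: "U \<in> nsaus L" and V: "V \<in> nsaus L"
  obtain U' where U': "U' \<in> saus 1" "L * U' = U' * L" "path_component (nsaus L) U U'"
    using path_to_commuting_quaternionic[OF eps L U] by blast
  obtain V' where V': "V' \<in> saus 1" "L * V' = V' * L" "path_component (nsaus L) V V'"
    using path_to_commuting_quaternionic[OF eps L V] by blast
  show "path_component (nsaus L) U V"
    using path_component_trans[OF path_component_trans[OF U'(3) commuting_path_component[OF L inf U'(1,2) V'(1,2)]]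
        path_component_sym[OF V'(3)]] .
qed

end

section \<open>The spaces of non-trivial self-adjoint unitaries\<close>

lemma cop_cases:
  assumes "T \<in> bounded_ops"
  obtains S where "T = blinfun_of_cop S"
  using cop_of_blinfun_inverse[OF assms] by metis

lemma sau_on_blinfun_of_cop:
  "sau_on M (blinfun_of_cop u) \<longleftrightarrow> app u ` M = M \<and>
    (\<forall>x\<in>M. \<forall>y\<in>M. cinner (u x) (u y) = cinner x y) \<and> (\<forall>x\<in>M. \<forall>y\<in>M. cinner (u x) y = cinner x (u y))"
  by (simp add: sau_on_def blinfun_of_cop app.rep_eq)

lemma sau_on_UNIV_iff: "sau_on UNIV (blinfun_of_cop u) \<longleftrightarrow> u * u = 1 \<and> selfadj u"
proof
  assume u: "sau_on UNIV (blinfun_of_cop u)"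
  then have s: "cinner (app u x) y = cinner x (u y)" and i: "cinner (app u x) (u y) = cinner x y" for x y
    unfolding sau_on_blinfun_of_cop by blast+
  have "u (u x) - x = 0" for x
  proof -
    have "cinner (u (u x) - x) y = 0" for y by (simp add: cinner_diff_left s[of "u x"] i)
    from this[of "u (u x) - x"] show ?thesis by (simp del: right_minus_eq)
  qed
  then have "u * u = 1" by (intro cop_eqI) simp
  then show "u * u = 1 \<and> selfadj u" using s by (simp add: selfadj_iff_cinner)
next
  assume u: "u * u = 1 \<and> selfadj u"
  have uu: "u (u x) = x" for x using arg_cong[OF conjunct1[OF u], of "\<lambda>T. app T x"] by simp
  then have "range (app u) = UNIV" by (metis surj_def)
  then show "sau_on UNIV (blinfun_of_cop u)"
    using u uu by (simp add: sau_on_blinfun_of_cop selfadj_cinnerD)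
qed

lemma range_proj: "proj M \<Longrightarrow> range (app M) = {x. M x = x}"
  by (auto simp: proj_idem) (metis rangeI)

lemma nontrivial_sau_onI:
  assumes M: "proj M" and v: "v * v = 1" "selfadj v" "M * v = v * M"
    and inf: "\<not> cfinite_dim {x. M x = x \<and> v x = x}" "\<not> cfinite_dim {x. M x = x \<and> v x = - x}"
  shows "nontrivial_sau_on (range (app M)) (blinfun_of_cop v)"
proof -
  have vv: "v (v x) = x" for x using arg_cong[OF v(1), of "\<lambda>T. app T x"] by simp
  have inv: "M (v x) = v x" if "M x = x" for x using arg_cong[OF v(3), of "\<lambda>T. app T x"] that by simp
  have "app v ` {x. M x = x} = {x. M x = x}"
  proof
    show "{x. M x = x} \<subseteq> app v ` {x. M x = x}"
    proof
      fix x assume "x \<in> {x. M x = x}"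
      then have "x = v (v x)" "v x \<in> {x. M x = x}" using inv by (simp_all add: vv)
      then show "x \<in> app v ` {x. M x = x}" by (rule image_eqI)
    qed
  qed (use inv in auto)
  then show ?thesis
    using v(2) inf
    by (simp add: nontrivial_sau_on_def sau_on_blinfun_of_cop range_proj[OF M] eigenspace_on_def selfadj_cinnerD vv
        flip: app.rep_eq)
qed

context separable_antiunitary_root
begin

text \<open>\<open>Q\<close> takes away only finitely many dimensions, so \<open>M * N\<close> is a
  self-adjoint unitary of an infinite-dimensional range. It anti-commutes with \<open>A\<close>,
  which makes its eigenspaces at 1 and -1 infinite-dimensional, and \<open>Q\<close> vanishes on
  both.\<close>

lemma infinite_eigenspaces:
  assumes N: "N \<in> saus (1 - Q)" and Q: "proj Q" "comm Q" and fin: "cfinite_dim {x. Q x = x}"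
    and M: "proj M" "comm M" "M * N = N * M" "Q * M = M * Q" and inf: "\<not> cfinite_dim {x. M x = x}"
  shows "\<not> cfinite_dim {x. M x = x \<and> (N + Q) x = x}" "\<not> cfinite_dim {x. M x = x \<and> (N + Q) x = - x}"
proof -
  have QN: "Q * N = 0"
  proof -
    have "Q * N = Q * (1 - Q) * N" using sausD(2)[OF N] by (simp only: mult.assoc)
    then show ?thesis using Q(1) by (simp add: right_diff_distrib proj_idem)
  qed
  have MN: "M * N \<in> saus (M * (1 - Q))" by (rule saus_restrict[OF N M(1,2,3)])
  have infM: "\<not> cfinite_dim {x. (M * (1 - Q)) x = x}"
  proof
    assume f: "cfinite_dim {x. (M * (1 - Q)) x = x}"
    have "cfinite_dim {x. M x = x}"
    proof (rule cfinite_dim_sum[OF f fin])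
      fix x assume "x \<in> {x. M x = x}"
      then have x: "M x = x" by simp
      have "app M (Q x) = Q x" using arg_cong[OF M(4), of "\<lambda>T. app T x"] x by simp
      then have "(M * (1 - Q)) (x - Q x) = x - Q x" using x Q(1) by (simp add: proj_idem)
      moreover have "Q (Q x) = Q x" using Q(1) by (simp add: proj_idem)
      ultimately show "\<exists>s\<in>{x. (M * (1 - Q)) x = x}. \<exists>t\<in>{x. Q x = x}. x = s + t"
        by (intro bexI[of _ "x - Q x"] bexI[of _ "Q x"]) simp_all
    qed
    then show False using inf by simp
  qed
  have step: "M x = x \<and> N x = r *\<^sub>R x \<and> Q x = 0" if x: "(M * N) x = r *\<^sub>R x" "r * r = 1" for x r
  proof -
    have "r *\<^sub>R M x = r *\<^sub>R x"
      using arg_cong[OF x(1), of "app M"] M(1) x(1) by (simp add: proj_idem)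
    moreover have "r \<noteq> 0" using x(2) by auto
    ultimately have Mx: "M x = x" by simp
    have Nx: "N x = r *\<^sub>R x" using x(1) Mx arg_cong[OF M(3), of "\<lambda>T. app T x"] by simp
    have "Q (N x) = 0" using arg_cong[OF QN, of "\<lambda>T. app T x"] by simp
    then have "Q x = 0" using \<open>r \<noteq> 0\<close> by (simp add: Nx)
    with Mx Nx show ?thesis by simp
  qed
  have "{x. (M * N) x = x} \<subseteq> {x. M x = x \<and> (N + Q) x = x}"
    using step[of _ 1] by auto
  then show "\<not> cfinite_dim {x. M x = x \<and> (N + Q) x = x}"
    using saus_eigenspace_infinite[OF MN infM] cfinite_dim_subset by blast
  have "{x. (- (M * N)) x = x} \<subseteq> {x. M x = x \<and> (N + Q) x = - x}"
  proof clarify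
    fix x assume "(- (M * N)) x = x"
    then have "(M * N) x = (- 1) *\<^sub>R x" by (simp add: minus_equation_iff[of _ x])
    from step[OF this] show "M x = x \<and> (N + Q) x = - x" by simp
  qed
  then show "\<not> cfinite_dim {x. M x = x \<and> (N + Q) x = - x}"
    using saus_eigenspace_infinite[OF saus_uminus[OF MN] infM] cfinite_dim_subset by blast
qed

text \<open>Off the kernel of \<open>diag_part L U\<close>, the midpoint of the normalised segment from \<open>U\<close> to its reflection
  commutes with \<open>L\<close>; on the finite-dimensional kernel the identity does.\<close>

lemma exists_nontrivial_commuting:
  assumes L: "proj L" "comm L" and U: "U \<in> nsaus L"
    and inf: "\<not> cfinite_dim {x. L x = x}" "\<not> cfinite_dim {x. (1 - L) x = x}"
  obtains v where "v * v = 1" "selfadj v" "L * v = v * L" "compact_cop (U - v)"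
    "nontrivial_sau_on (range (app L)) (blinfun_of_cop v)"
    "nontrivial_sau_on (range (app (1 - L))) (blinfun_of_cop v)"
proof -
  let ?D = "off_diag L U" and ?S = "reflection L"
  note u = sausD[OF nsausD(1)[OF U]]
  obtain Q where Q: "proj Q" "\<forall>x. Q x = x \<longleftrightarrow> diag_part L U x = 0" "norm (?D * ?D * (1 - Q)) < 1"
    "?D * ?D * Q = Q" "Q * L = L * Q" "Q * U = U * Q" "comm Q" "Q * (?D * ?D) = Q"
    using exists_diag_kernel_proj[OF L U] .
  define R where "R = 1 - Q"
  have R: "proj R" "comm R" "R * U = U * R" "R * ?S = ?S * R"
    using Q by (simp_all add: R_def proj_compl comm_diff reflection_def algebra_simps)
  have SRS: "?S * (R * T) = R * (?S * T)" for T using R(4) by (simp flip: mult.assoc)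
  have RV: "R * (?S * U * ?S) = (?S * U * ?S) * R"
    using R(3,4) by (metis (no_types, lifting) mult.assoc)
  have U1: "R * U \<in> saus R" using saus_restrict[OF nsausD(1)[OF U] R(1,2,3)] by simp
  have V1: "R * (?S * U * ?S) \<in> saus R" using saus_restrict[OF reflected_saus[OF L U] R(1,2) RV] by simp
  have diff: "R * U - R * (?S * U * ?S) = R * ?D + R * ?D"
    using arg_cong[OF reflected_diff[OF L U], of "\<lambda>T. R * T"] by (simp add: algebra_simps)
  have RD: "R * ?D = ?D * R" using R(3) RV by (simp add: off_diag_def algebra_simps)
  have RR: "R * R = R" using R(1) by (rule proj_idem)
  \<comment> \<open>With \<open>Q\<close> cut off, the square of the off-diagonal part has norm
    below 1.\<close>
  have "(R * ?D) * (R * ?D) = ?D * ?D * R"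
  proof -
    have "(R * ?D) * (R * ?D) = R * (?D * R) * ?D" by (simp only: mult.assoc)
    also have "\<dots> = (R * R) * (?D * ?D)" by (simp only: RD[symmetric] mult.assoc)
    also have "\<dots> = (R * ?D) * ?D" by (simp only: RR mult.assoc)
    also have "\<dots> = ?D * (R * ?D)" by (simp only: RD mult.assoc)
    also have "\<dots> = ?D * ?D * R" by (simp only: RD mult.assoc)
    finally show ?thesis .
  qed
  then have "(norm (R * ?D))\<^sup>2 < 1"
    using norm_selfadj_square_le[OF selfadj_mult[OF proj_selfadj[OF R(1)] off_diag_selfadj[OF L U] RD]] Q(3)
    by (simp add: R_def)
  then have n: "norm (R * ?D) < 1" by (simp add: abs_square_less_1)
  have less: "norm (R * U - R * (?S * U * ?S)) < 2"
    unfolding diff using norm_triangle_ineq[of "R * ?D" "R * ?D"] n by linarith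
  have comp: "compact_cop (R * U - R * (?S * U * ?S))"
    using reflected_compact[OF L U] by (simp only: right_diff_distrib[symmetric] compact_cop_mult_left)
  show thesis
  proof (rule saus_path[OF U1 V1 less])
    fix g :: "real \<Rightarrow> 'a cop"
    assume "\<And>t. t \<in> {0..1} \<Longrightarrow> g t \<in> saus R"
      and "\<And>t. t \<in> {0..1} \<Longrightarrow> compact_cop (R * U - R * (?S * U * ?S)) \<Longrightarrow> compact_cop (g t - R * U)"
      and gS: "\<And>S. S * S = 1 \<Longrightarrow> S * (R * U) * S = R * (?S * U * ?S) \<Longrightarrow> S * g (1/2) = g (1/2) * S"
    then have N: "g (1/2) \<in> saus R" and NU: "compact_cop (g (1/2) - R * U)" using comp by simp_all
    define N where "N = g (1/2)"
    have "?S * N = N * ?S"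
      unfolding N_def by (rule gS[OF reflection_square[OF L(1)]]) (simp add: mult.assoc SRS)
    then have LN: "L * N = N * L" by (simp add: reflection_commute_iff)
    note n = sausD[OF N[folded N_def]]
    have NQ: "N * Q = 0" "Q * N = 0"
    proof -
      have "N * Q = N * (R * Q)" "Q * N = Q * R * N" using n(2,3) by (simp_all flip: mult.assoc) (simp add: mult.assoc n)
      then show "N * Q = 0" "Q * N = 0" using Q(1) by (simp_all add: R_def algebra_simps proj_idem)
    qed
    have cQ: "compact_cop Q"
      using compact_cop_mult_right[OF compact_cop_mult_left[OF off_diag_compact[OF L U], of ?D], of Q] Q(4) by simp
    \<comment> \<open>\<open>N\<close> and \<open>Q\<close> live on orthogonal ranges. Adding
      \<open>Q\<close>, which commutes with \<open>A\<close>, may break the anti-commutation, but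
      the definition demands it of \<open>U\<close> and not of its reference operator.\<close>
    have v1: "(N + Q) * (N + Q) = 1"
      using n(1) NQ Q(1) by (simp add: algebra_simps proj_idem R_def)
    have v2: "selfadj (N + Q)" by (rule selfadj_add[OF n(4) proj_selfadj[OF Q(1)]])
    have v3: "L * (N + Q) = (N + Q) * L" using LN Q(5) by (simp add: algebra_simps)
    have "U - (N + Q) = (Q * U - Q) - (N - R * U)" by (simp add: R_def algebra_simps)
    also have "compact_cop \<dots>"
      unfolding N_def by (rule compact_cop_diff[OF compact_cop_diff[OF compact_cop_mult_right[OF cQ] cQ] NU])
    finally have v4: "compact_cop (U - (N + Q))" .
    have N': "N \<in> saus (1 - Q)" using N by (simp add: N_def R_def)
    have fin: "cfinite_dim {x. Q x = x}" by (rule compact_fixed_finite_dim[OF separable cQ])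
    have nt: "nontrivial_sau_on (range (app M)) (blinfun_of_cop (N + Q))"
      if M: "proj M" "comm M" "M * N = N * M" "Q * M = M * Q" "\<not> cfinite_dim {x. M x = x}" for M
    proof (rule nontrivial_sau_onI[OF M(1) v1 v2])
      show "M * (N + Q) = (N + Q) * M" using M(3,4) by (simp add: algebra_simps)
    qed (use infinite_eigenspaces[OF N' Q(1,7) fin M] in simp_all)
    have "nontrivial_sau_on (range (app L)) (blinfun_of_cop (N + Q))"
      by (rule nt[OF L LN Q(5) inf(1)])
    moreover have "nontrivial_sau_on (range (app (1 - L))) (blinfun_of_cop (N + Q))"
    proof (rule nt)
      show "(1 - L) * N = N * (1 - L)" "Q * (1 - L) = (1 - L) * Q"
        using LN Q(5) by (simp_all add: algebra_simps)
    qed (use L inf in \<open>simp_all add: proj_compl comm_diff\<close>)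
    ultimately show thesis by (rule that[OF v1 v2 v3 v4])
  qed
qed

text \<open>A compact perturbation of an operator commuting with \<open>L\<close> has a compact
  commutator with \<open>L\<close>; \<open>exists_nontrivial_commuting\<close> supplies the
  converse.\<close>

lemma nontrivial_saus_anticomm_eq:
  assumes L: "proj L" "comm L"
    and inf: "\<not> cfinite_dim {x. L x = x}" "\<not> cfinite_dim {x. (1 - L) x = x}"
  shows "nontrivial_saus_anticomm (blinfun_of_cop L) A = blinfun_of_cop ` nsaus L"
proof (intro set_eqI iffI)
  fix X assume "X \<in> nontrivial_saus_anticomm (blinfun_of_cop L) A"
  then obtain Y where X: "sau_on UNIV X" "\<forall>x. X (A x) = - A (X x)"
    and Y: "sau_on UNIV Y" "Y o\<^sub>L blinfun_of_cop L = blinfun_of_cop L o\<^sub>L Y" "X - Y \<in> compact_ops"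
    unfolding nontrivial_saus_anticomm_def nontrivial_saus_def by blast
  obtain u where u: "X = blinfun_of_cop u" using X(1) by (auto simp: sau_on_def elim: cop_cases)
  obtain v where v: "Y = blinfun_of_cop v" using Y(1) by (auto simp: sau_on_def elim: cop_cases)
  have "u * u = 1" "selfadj u" using X(1) by (simp_all add: u sau_on_UNIV_iff)
  moreover have "anticomm u" using X(2) by (simp add: anticomm_def u app.rep_eq)
  ultimately have us: "u \<in> saus 1" by (simp add: saus_def)
  have vL: "v * L = L * v"
    using Y(2) by (simp add: v blinfun_of_cop_inject flip: blinfun_of_cop_simps)
  have K: "compact_cop (u - v)" using Y(3) by (simp add: compact_cop_iff blinfun_of_cop_simps u v)
  have "u * L - L * u = (u - v) * L - L * (u - v)" by (simp add: algebra_simps vL)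
  also have "compact_cop \<dots>"
    by (intro compact_cop_diff compact_cop_mult_left[OF K] compact_cop_mult_right[OF K])
  finally have "u \<in> nsaus L" using us by (simp add: nsaus_def)
  then show "X \<in> blinfun_of_cop ` nsaus L" by (simp add: u)
next
  fix X assume "X \<in> blinfun_of_cop ` nsaus L"
  then obtain u where u: "X = blinfun_of_cop u" "u \<in> nsaus L" by blast
  obtain v where v: "v * v = 1" "selfadj v" "L * v = v * L" "compact_cop (u - v)"
    "nontrivial_sau_on (range (app L)) (blinfun_of_cop v)"
    "nontrivial_sau_on (range (app (1 - L))) (blinfun_of_cop v)"
    using exists_nontrivial_commuting[OF L u(2) inf] .
  note u' = sausD[OF nsausD(1)[OF u(2)]]
  have "X \<in> nontrivial_saus (blinfun_of_cop L)"
    unfolding nontrivial_saus_def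
  proof (intro CollectI conjI exI)
    show "sau_on UNIV X" using u' by (simp add: u(1) sau_on_UNIV_iff)
    show "sau_on UNIV (blinfun_of_cop v)" using v by (simp add: sau_on_UNIV_iff)
    show "blinfun_of_cop v o\<^sub>L blinfun_of_cop L = blinfun_of_cop L o\<^sub>L blinfun_of_cop v"
      using v(3) by (simp flip: blinfun_of_cop_simps)
    show "nontrivial_sau_on (range (blinfun_apply (blinfun_of_cop L))) (blinfun_of_cop v)"
      using v(5) by (simp add: app.rep_eq)
    show "nontrivial_sau_on (range (blinfun_apply (id_blinfun - blinfun_of_cop L))) (blinfun_of_cop v)"
      using v(6) by (simp add: app.rep_eq blinfun_of_cop_simps)
    show "X - blinfun_of_cop v \<in> compact_ops"
      using v(4) by (simp add: u(1) compact_cop_iff blinfun_of_cop_simps)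
  qed
  moreover have "\<forall>x. X (A x) = - A (X x)"
    using u'(5) by (simp add: u(1) anticomm_def app.rep_eq)
  ultimately show "X \<in> nontrivial_saus_anticomm (blinfun_of_cop L) A"
    by (simp add: nontrivial_saus_anticomm_def)
qed

end

section \<open>Transport to the spaces of the statement\<close>

lemma dist_blinfun_of_cop: "dist (blinfun_of_cop S) (blinfun_of_cop T) = dist S T"
  by (simp add: dist_norm norm_cop.rep_eq minus_cop.rep_eq)

lemma continuous_on_blinfun_of_cop: "continuous_on S blinfun_of_cop"
  unfolding continuous_on_iff dist_blinfun_of_cop by blast

lemma path_component_blinfun_of_cop:
  assumes "path_component S a b"
  shows "path_component (blinfun_of_cop ` S) (blinfun_of_cop a) (blinfun_of_cop b)"
proof -
  obtain g where g: "path g" "path_image g \<subseteq> S" "pathstart g = a" "pathfinish g = b"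
    using assms unfolding path_component_def by blast
  show ?thesis
    unfolding path_component_def
  proof (intro exI conjI)
    show "path (blinfun_of_cop \<circ> g)"
      by (rule path_continuous_image[OF g(1) continuous_on_blinfun_of_cop])
    show "path_image (blinfun_of_cop \<circ> g) \<subseteq> blinfun_of_cop ` S"
      using g(2) by (auto simp: path_image_def)
  qed (use g in \<open>simp_all add: pathstart_def pathfinish_def\<close>)
qed

lemma ind2_eq:
  assumes "proj L"
  shows "ind2 (blinfun_of_cop L) (blinfun_of_cop U) = of_nat (cdim (compression_kernel L U))"
proof -
  have "{x. ((blinfun_of_cop L o\<^sub>L blinfun_of_cop U o\<^sub>L blinfun_of_cop L) + id_blinfun - blinfun_of_cop L) x = 0}
      = compression_kernel L U"
  proof -
    have e: "((blinfun_of_cop L o\<^sub>L blinfun_of_cop U o\<^sub>L blinfun_of_cop L) + id_blinfun - blinfun_of_cop L) x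
        = L (U (L x)) + x - L x" for x
      by (simp add: blinfun.bilinear_simps app.rep_eq)
    have "L (U (L x)) + x - L x = 0 \<longleftrightarrow> L x = x \<and> L (U x) = 0" for x
    proof
      assume x: "L (U (L x)) + x - L x = 0"
      \<comment> \<open>The other two terms cancel under \<open>L\<close>, which leaves
        \<open>L (U (L x))\<close>.\<close>
      then have "L (L (U (L x)) + x - L x) = 0" by (simp del: app_add app_diff)
      then have "L (U (L x)) = 0" using assms by (simp add: proj_idem)
      with x have "L x = x" by simp
      with \<open>L (U (L x)) = 0\<close> show "L x = x \<and> L (U x) = 0" by simp
    qed simp
    then show ?thesis by (simp only: e compression_kernel_def)
  qed
  then show ?thesis by (simp add: ind2_def)
qed

theorem theorem4p3:
  fixes \<Lambda> :: "'a::chilbert_space \<Rightarrow>\<^sub>L 'a"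
    and C J :: "'a \<Rightarrow> 'a"
  assumes "separable_space (euclidean :: 'a topology)"
    and "\<not> cfinite_dim (UNIV :: 'a set)"
    and "selfadjoint_projection \<Lambda>"
    and "\<not> cfinite_dim (range (blinfun_apply \<Lambda>))"
    and "\<not> cfinite_dim {x. blinfun_apply \<Lambda> x = 0}"
    and "antiunitary C" and "\<And>x. C (C x) = x"
    and "\<And>x. C (blinfun_apply \<Lambda> x) = blinfun_apply \<Lambda> (C x)"
    and "antiunitary J" and "\<And>x. J (J x) = - x"
    and "\<And>x. J (blinfun_apply \<Lambda> x) = blinfun_apply \<Lambda> (J x)"
  defines "SR \<equiv> top_of_set (nontrivial_saus_anticomm \<Lambda> C)"
    and "SH \<equiv> top_of_set (nontrivial_saus_anticomm \<Lambda> J)"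
  shows "card (path_components_of SR) = 2 \<and>
    continuous_map SR (discrete_topology UNIV) (ind2 \<Lambda>) \<and>
    (\<exists>f. (\<forall>U\<in>topspace SR. f (path_component_of_set SR U) = ind2 \<Lambda> U) \<and>
         bij_betw f (path_components_of SR) (UNIV :: bit set)) \<and>
    card (path_components_of SH) = 1"
proof -
  interpret R: separable_antiunitary_root C 1
    by unfold_locales (use assms(1,6,7) in auto)
  interpret H: separable_antiunitary_root J "- 1"
    by unfold_locales (use assms(1,9,10) in auto)
  have "\<Lambda> \<in> bounded_ops" using assms(3) by (simp add: selfadjoint_projection_def)
  then obtain L where \<Lambda>: "\<Lambda> = blinfun_of_cop L" by (rule cop_cases)
  have L: "proj L"
    using assms(3) unfolding selfadjoint_projection_def \<Lambda>
    by (simp add: proj_def selfadj_iff_cinner app.rep_eq blinfun_of_cop_inject flip: blinfun_of_cop_simps)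
  have cL: "R.comm L" "H.comm L"
    using assms(8,11) by (simp_all add: R.comm_def H.comm_def \<Lambda> app.rep_eq)
  have inf: "\<not> cfinite_dim {x. L x = x}" "\<not> cfinite_dim {x. (1 - L) x = x}"
  proof -
    show "\<not> cfinite_dim {x. L x = x}"
      using assms(4) range_proj[OF L] by (simp add: \<Lambda> app.rep_eq)
    have "(1 - L) x = x \<longleftrightarrow> blinfun_apply \<Lambda> x = 0" for x by (simp add: \<Lambda> flip: app.rep_eq)
    then show "\<not> cfinite_dim {x. (1 - L) x = x}" using assms(5) by simp
  qed
  define S where "S = nontrivial_saus_anticomm \<Lambda> C"
  have S: "S = blinfun_of_cop ` R.nsaus L"
    unfolding S_def \<Lambda> by (rule R.nontrivial_saus_anticomm_eq[OF L cL(1) inf])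
  have ind: "ind2 \<Lambda> (blinfun_of_cop U) = R.parity L U" for U
    by (simp add: \<Lambda> ind2_eq[OF L] R.parity_def)
  have cont: "continuous_map SR (discrete_topology UNIV) (ind2 \<Lambda>)"
    unfolding continuous_map_def
  proof (intro conjI allI impI)
    fix B :: "bit set"
    show "openin SR {x \<in> topspace SR. ind2 \<Lambda> x \<in> B}"
      unfolding SR_def S_def[symmetric] openin_euclidean_subtopology_iff
    proof (intro conjI ballI)
      fix X assume "X \<in> {x \<in> topspace (top_of_set S). ind2 \<Lambda> x \<in> B}"
      then obtain U where U: "X = blinfun_of_cop U" "U \<in> R.nsaus L" "R.parity L U \<in> B"
        by (auto simp: S ind)
      obtain d where d: "d > 0" "\<forall>U'\<in>R.nsaus L. norm (U - U') < d \<longrightarrow> R.parity L U' = R.parity L U"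
        using R.parity_locally_constant[OF refl L cL(1) U(2)] by blast
      have "\<forall>X'\<in>S. dist X' X < d \<longrightarrow> X' \<in> {x \<in> topspace (top_of_set S). ind2 \<Lambda> x \<in> B}"
      proof (intro ballI impI)
        fix X' assume "X' \<in> S" "dist X' X < d"
        then obtain U' where U': "X' = blinfun_of_cop U'" "U' \<in> R.nsaus L" "dist U' U < d"
          by (auto simp: S U(1) dist_blinfun_of_cop)
        then have "R.parity L U' = R.parity L U" using d(2) by (simp add: dist_norm norm_minus_commute)
        then show "X' \<in> {x \<in> topspace (top_of_set S). ind2 \<Lambda> x \<in> B}"
          using U' U(3) by (simp add: S ind)
      qed
      then show "\<exists>e>0. \<forall>X'\<in>S. dist X' X < e \<longrightarrow> X' \<in> {x \<in> topspace (top_of_set S). ind2 \<Lambda> x \<in> B}"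
        using d(1) by blast
    qed auto
  qed auto
  have pc: "path_component_of SR X Y \<longleftrightarrow> ind2 \<Lambda> X = ind2 \<Lambda> Y" if XY: "X \<in> S" "Y \<in> S" for X Y
  proof
    assume "path_component_of SR X Y"
    \<comment> \<open>The path components of a discrete space are its points.\<close>
    from path_component_of_continuous_image[OF cont this]
    show "ind2 \<Lambda> X = ind2 \<Lambda> Y" by simp
  next
    assume eq: "ind2 \<Lambda> X = ind2 \<Lambda> Y"
    obtain U V where UV: "X = blinfun_of_cop U" "U \<in> R.nsaus L" "Y = blinfun_of_cop V" "V \<in> R.nsaus L"
      using XY by (auto simp: S)
    then have "path_component (R.nsaus L) U V"
      using eq R.nsaus_parity(1)[OF refl L cL(1) inf UV(2,4)] by (simp add: ind)
    from path_component_blinfun_of_cop[OF this]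
    show "path_component_of SR X Y" by (simp add: SR_def flip: S_def) (simp add: S UV)
  qed
  have top: "topspace SR = S" by (simp add: SR_def S_def)
  \<comment> \<open>By \<open>pc\<close> the index of any chosen representative is the common value
    on the component.\<close>
  define f where "f K = ind2 \<Lambda> (SOME X. X \<in> K)" for K
  have f: "f (path_component_of_set SR X) = ind2 \<Lambda> X" if X: "X \<in> S" for X
  proof -
    have "X \<in> path_component_of_set SR X" using X top by (simp add: path_component_of_refl)
    then have "(SOME Y. Y \<in> path_component_of_set SR X) \<in> path_component_of_set SR X"
      by (rule someI)
    then have Y: "path_component_of SR X (SOME Y. Y \<in> path_component_of_set SR X)" by simp
    then have "(SOME Y. Y \<in> path_component_of_set SR X) \<in> S"
      using path_component_in_topspace[OF Y] top by simp
    then show ?thesis using pc[OF X] Y by (simp add: f_def)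
  qed
  have bij: "bij_betw f (path_components_of SR) (UNIV :: bit set)"
    unfolding bij_betw_def path_components_of_def top
  proof
    show "inj_on f (path_component_of_set SR ` S)"
    proof (rule inj_onI, clarify)
      fix X Y assume "X \<in> S" "Y \<in> S" "f (path_component_of_set SR X) = f (path_component_of_set SR Y)"
      then have "path_component_of SR X Y" using pc f by simp
      then show "path_component_of_set SR X = path_component_of_set SR Y"
        by (simp add: path_component_of_equiv)
    qed
    have "b \<in> f ` path_component_of_set SR ` S" for b
    proof -
      obtain U where "U \<in> R.nsaus L" "R.parity L U = b"
        using R.nsaus_parity(2)[OF refl L cL(1) inf] by blast
      then have "blinfun_of_cop U \<in> S" "ind2 \<Lambda> (blinfun_of_cop U) = b" by (simp_all add: S ind)
      then show ?thesis using f by (metis imageI)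
    qed
    then show "f ` path_component_of_set SR ` S = UNIV" by blast
  qed
  have card2: "card (path_components_of SR) = 2"
  proof -
    have "(UNIV :: bit set) = {0, 1}" by (auto intro: bit.exhaust)
    then have "card (UNIV :: bit set) = card {0, 1 :: bit}" by (rule arg_cong)
    then show ?thesis using bij_betw_same_card[OF bij] by simp
  qed
  have SHeq: "nontrivial_saus_anticomm \<Lambda> J = blinfun_of_cop ` H.nsaus L"
    unfolding \<Lambda> by (rule H.nontrivial_saus_anticomm_eq[OF L cL(2) inf])
  have "\<exists>K. path_components_of SH = {K}"
  proof -
    obtain U where U: "U \<in> H.nsaus L" using H.nsaus_quaternionic(1)[OF refl L cL(2) inf] by blast
    let ?X = "blinfun_of_cop U"
    have "path_component_of SH ?X Y" if Y: "Y \<in> topspace SH" for Y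
    proof -
      obtain V where V: "Y = blinfun_of_cop V" "V \<in> H.nsaus L" using Y by (auto simp: SH_def SHeq)
      from path_component_blinfun_of_cop[OF H.nsaus_quaternionic(2)[OF refl L cL(2) inf U V(2)]]
      show ?thesis by (simp add: SH_def SHeq V(1))
    qed
    then have "path_component_of_set SH Y = path_component_of_set SH ?X" if "Y \<in> topspace SH" for Y
      using that by (simp add: path_component_of_equiv)
    moreover have "?X \<in> topspace SH" using U by (simp add: SH_def SHeq)
    ultimately have "path_components_of SH = {path_component_of_set SH ?X}"
      unfolding path_components_of_def by blast
    then show ?thesis by blast
  qed
  then have card1: "card (path_components_of SH) = 1" by auto
  show ?thesis
    using card2 cont card1 bij f top by blast
qed

end
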